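(* Let $A\in\mathbb{R}^{n\times n}$ with spectral radius $\rho(A)<1$, $C\in\mathbb{R}^{m\times n}$, $Q\in\mathbb{R}^{n\times n}$ symmetric positive semidefinite, $R\in\mathbb{R}^{m\times m}$ symmetric positive definite, and let $\Sigma\geq 0$ be the solution of $\Sigma=A\Sigma A^{\top}+Q$. Consider the process $x_{k+1}=Ax_k+w_k$, $y_k=Cx_k+v_k$ ($k\ge 0$), where $w_k\sim\mathcal N(0,Q)$, $v_k\sim\mathcal N(0,R)$ are i.i.d. and mutually independent, and $x_0\sim\mathcal N(0,\Sigma)$ is independent of them. Let $\eta_k\in\{0,1\}$ be i.i.d. Bernoulli with $\Pr(\eta_k=1)=\lambda\in(0,1]$ and $\zeta_k$ i.i.d. uniform on $[0,1]$, all independent of each other and of $x_0,w,v$. Fix a symmetric positive definite $Y\in\mathbb{R}^{m\times m}$ and let the (open-loop) scheduler be $\varepsilon_k=1$ if $\zeta_k>\exp(-\tfrac12 y_k^{\top}Yy_k)$ and $\varepsilon_k=0$ otherwise. Let $\mathcal I_k$ be the information available to the remote estimator at time $k$, namely $\{\eta_j\}_{j=0}^k$ together with $\varepsilon_j$ and $\varepsilon_j y_j$ for every $j\le k$ with $\eta_j=1$ (when $\eta_j=0$ nothing about $\varepsilon_j$ or $y_j$ is revealed), with $\mathcal I_{-1}=\emptyset$. Let $\hat x_k^-=\mathbb E[x_k\mid\mathcal I_{k-1}]$, $\hat y_k^-=\mathbb E[y_k\mid \mathcal I_{k-1}]$, $\hat x_k=\mathbb E[x_k\mid\mathcal I_k]$,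 and let $P_k^-$, $P_k$ be the covariances of the errors $x_k-\hat x_k^-$ and $x_k-\hat x_k$ conditional on $\mathcal I_{k-1}$ and $\mathcal I_k$ respectively. Then $\hat x_0^-=0$, $P_0^-=\Sigma$, and for all $k\ge 0$: $K_k=\eta_k P_k^-C^{\top}\big(CP_k^-C^{\top}+R+(1-\varepsilon_k)Y^{-1}\big)^{-1}$, $\hat x_k=\hat x_k^-+\varepsilon_kK_ky_k-K_k\hat y_k^-=(I-K_kC)\hat x_k^-+\varepsilon_kK_ky_k$, $P_k=P_k^--K_kCP_k^-$, $\hat x_{k+1}^-=A\hat x_k$, $P_{k+1}^-=AP_kA^{\top}+Q$.
   Context: Throughout the paper $(A,\sqrt Q)$ is assumed stabilizable and $(A,C)$ detectable. When $\eta_k=0$ the gain $K_k$ is zero, so the value of $\varepsilon_k$ in these formulas is irrelevant. *)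

theory Defs
  imports "HOL-Probability.Probability"
begin

definition spectral_radius_mat :: "real^'n^'n \<Rightarrow> real" where
  "spectral_radius_mat A =
     Sup {cmod c | c. \<exists>v::complex^'n. v \<noteq> 0 \<and>
             (\<chi> i j. complex_of_real (A $ i $ j)) *v v = c *s v}"

definition psd_mat :: "real^'n^'n \<Rightarrow> bool" where
  "psd_mat S \<longleftrightarrow> transpose S = S \<and> (\<forall>u. 0 \<le> u \<bullet> (S *v u))"

definition pd_mat :: "real^'n^'n \<Rightarrow> bool" where
  "pd_mat S \<longleftrightarrow> transpose S = S \<and> (\<forall>u. u \<noteq> 0 \<longrightarrow> 0 < u \<bullet> (S *v u))"

definition centered_gaussian :: "'a measure \<Rightarrow> ('a \<Rightarrow> real^'n) \<Rightarrow> real^'n^'n \<Rightarrow> bool" where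
  "centered_gaussian M X S \<longleftrightarrow> X \<in> borel_measurable M \<and>
     (\<forall>u. distr M borel (\<lambda>\<omega>. u \<bullet> X \<omega>) =
        (if u \<bullet> (S *v u) = 0 then return borel 0
         else density lborel (normal_density 0 (sqrt (u \<bullet> (S *v u))))))"

definition gen_sets :: "'a measure \<Rightarrow> ('a \<Rightarrow> 'b::topological_space) \<Rightarrow> 'a set set" where
  "gen_sets M f = {f -` B \<inter> space M | B. B \<in> sets borel}"

datatype src = SX0 | SW nat | SV nat | SEta nat | SZeta nat

text \<open>Information of the remote estimator: \<open>info M \<eta> \<epsilon> y k\<close> is I_{k-1}, i.e.
  generated by eta_j, eta_j eps_j, eta_j eps_j y_j for j < k.  (info 0 = trivial.)\<close>
definition info :: "'a measure \<Rightarrow> (nat \<Rightarrow> 'a \<Rightarrow> real) \<Rightarrow> (nat \<Rightarrow> 'a \<Rightarrow> real)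
    \<Rightarrow> (nat \<Rightarrow> 'a \<Rightarrow> real^'m) \<Rightarrow> nat \<Rightarrow> 'a measure" where
  "info M \<eta> \<epsilon> y k = sigma (space M)
     (\<Union>j\<in>{..<k}. gen_sets M (\<eta> j) \<union> gen_sets M (\<lambda>\<omega>. \<eta> j \<omega> * \<epsilon> j \<omega>)
                  \<union> gen_sets M (\<lambda>\<omega>. (\<eta> j \<omega> * \<epsilon> j \<omega>) *\<^sub>R y j \<omega>))"

definition cond_exp_vec :: "'a measure \<Rightarrow> 'a measure \<Rightarrow> ('a \<Rightarrow> real^'n) \<Rightarrow> 'a \<Rightarrow> real^'n" where
  "cond_exp_vec M F X = (\<lambda>\<omega>. \<chi> i. real_cond_exp M F (\<lambda>\<omega>'. X \<omega>' $ i) \<omega>)"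

definition cond_err_cov :: "'a measure \<Rightarrow> 'a measure \<Rightarrow> ('a \<Rightarrow> real^'n) \<Rightarrow> 'a \<Rightarrow> real^'n^'n" where
  "cond_err_cov M F X = (\<lambda>\<omega>. \<chi> i j. real_cond_exp M F
      (\<lambda>\<omega>'. (X \<omega>' - cond_exp_vec M F X \<omega>') $ i * (X \<omega>' - cond_exp_vec M F X \<omega>') $ j) \<omega>)"

end

theory Submission
  imports Defs "HOL-Real_Asymp.Real_Asymp"
begin

text \<open>
  Conditionally on the estimator's information, the state stays Gaussian. We track the conditional
  law through its characteristic function: \<open>E[cis (u \<bullet> x\<^sub>k) | I\<^sub>k] = cis (u \<bullet> m) exp (- u \<bullet> V u / 2)\<close>,
  where the covariance \<open>V\<close> takes finitely many values, since it only depends on the history of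
  \<open>\<eta>\<close> and \<open>\<epsilon>\<close>. No densities are used, so \<open>Q\<close> and \<open>\<Sigma>\<close> may be singular.

  Adding independent Gaussian noise gives the prediction step and the joint conditional
  characteristic function of \<open>(x\<^sub>k, y\<^sub>k)\<close>. If \<open>y\<^sub>k\<close> is received, uniqueness of characteristic functions
  yields the usual Kalman update, and the event \<open>\<epsilon>\<^sub>k = 1\<close> carries no further information about \<open>x\<^sub>k\<close>.
  If \<open>\<eta>\<^sub>k = 1\<close> and \<open>\<epsilon>\<^sub>k = 0\<close>, integrating out \<open>\<zeta>\<^sub>k\<close> weights the law by \<open>exp (- y\<^sub>k \<bullet> Y y\<^sub>k / 2)\<close>,
  which keeps it Gaussian and acts like an observation of \<open>y\<^sub>k\<close> plus noise of covariance \<open>Y\<^sup>-\<^sup>1\<close>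
  that took the value \<open>0\<close>. Mean and covariance are finally read off from the
  characteristic function near \<open>0\<close>.
\<close>

section \<open>Uniqueness of characteristic functions\<close>

text \<open>The obstacle is silence: it reveals no value of \<open>y\<close>, only a likelihood
  factor, and the mass of the reweighted law depends on the random conditional mean. The proof
  therefore uses unnormalised identities. A vanishing conditional expectation is expressed by
  integrals against bounded \<open>F\<close>-measurable factors (\<open>cond_null\<close>); the
  unknown normaliser is carried along as an \<open>F\<close>-measurable function and disappears when
  frequency t is compared with frequency 0. The extra noise covariance comes from the Woodbury
  identity (T^-1 + Y)^-1 = T - T (T + Y^-1)^-1 T, where T is the conditional covariance of
  \<open>y\<close>. A second obstacle is the randomness of the gain: freezing the covariance on each
  of its level sets reduces all matrix algebra to constant matrices.\<close>

lemma borel_measurable_cis [measurable]: "cis \<in> borel_measurable borel"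
  by (intro borel_measurable_continuous_onI continuous_intros)

lemma integrable_bounded_mult:
  fixes Z D :: "'a \<Rightarrow> 'b::{real_normed_field, banach, second_countable_topology}"
  assumes D: "integrable M D" and [measurable]: "Z \<in> borel_measurable M"
    and b: "\<And>x. x \<in> space M \<Longrightarrow> norm (Z x) \<le> c"
  shows "integrable M (\<lambda>x. Z x * D x)"
proof (rule Bochner_Integration.integrable_bound)
  show "integrable M (\<lambda>x. of_real c * D x)" using D by simp
  show "(\<lambda>x. Z x * D x) \<in> borel_measurable M" using D by measurable
  show "AE x in M. norm (Z x * D x) \<le> norm (of_real c * D x)"
    using b by (auto simp: norm_mult intro!: mult_right_mono order_trans[OF b abs_ge_self])
qed

text \<open>Dynkin's pi-lambda argument for the complex measure with density \<open>D\<close>: a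
  zero total integral gives closure under complements, countable additivity gives closure under
  disjoint unions.\<close>

lemma set_integral_zero_sigma_sets:
  fixes D :: "'a \<Rightarrow> complex"
  assumes D: "integrable M D" and G: "Int_stable G" "G \<subseteq> sets M"
    and tot: "(\<integral>x. D x \<partial>M) = 0"
    and gen: "\<And>A. A \<in> G \<Longrightarrow> (\<integral>x\<in>A. D x \<partial>M) = 0"
    and A: "A \<in> sigma_sets (space M) G"
  shows "(\<integral>x\<in>A. D x \<partial>M) = 0"
proof -
  have sub: "sigma_sets (space M) G \<subseteq> sets M"
    using G(2) by (rule sets.sigma_sets_subset)
  have setint: "set_integrable M B D" if "B \<in> sets M" for B
    unfolding set_integrable_def using that D by (rule integrable_mult_indicator)
  have "G \<subseteq> Pow (space M)" using G(2) sets.space_closed by blast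
  with G(1) show ?thesis
    using A
  proof (induct rule: sigma_sets_induct_disjoint)
    case (basic A) then show ?case by (rule gen)
  next
    case empty then show ?case by (simp add: set_lebesgue_integral_def)
  next
    case (compl A)
    then have Am: "A \<in> sets M" using sub by auto
    have "(\<integral>x\<in>space M - A. D x \<partial>M) + (\<integral>x\<in>A. D x \<partial>M) = (\<integral>x\<in>(space M - A) \<union> A. D x \<partial>M)"
      using Am by (intro set_integral_Un[symmetric] setint) auto
    also have "(space M - A) \<union> A = space M" using sets.sets_into_space[OF Am] by blast
    also have "(\<integral>x\<in>space M. D x \<partial>M) = 0" using tot set_integral_space[OF D] by simp
    finally show ?case using compl by simp
  next
    case (union A)
    have Am: "A i \<in> sets M" for i using union(2) sub by blast
    have "(\<integral>x\<in>(\<Union>i. A i). D x \<partial>M) = (\<Sum>i. \<integral>x\<in>A i. D x \<partial>M)"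
      using Am union(1) by (intro lebesgue_integral_countable_add setint)
        (auto simp: disjoint_family_on_def)
    then show ?case using union(3) by simp
  qed
qed

text \<open>Uniqueness of characteristic functions is applied to the normalised positive and negative parts of \<open>D\<close>.\<close>

lemma (in prob_space) cis_transform_zero_real:
  fixes D \<xi> :: "'a \<Rightarrow> real"
  assumes D: "integrable M D" and \<xi>[measurable]: "\<xi> \<in> borel_measurable M"
    and z: "\<And>t. (\<integral>x. cis (t * \<xi> x) * of_real (D x) \<partial>M) = 0"
    and B[measurable]: "B \<in> sets borel"
  shows "(\<integral>x. indicator B (\<xi> x) * D x \<partial>M) = 0"
proof -
  define p where "p x = max 0 (D x)" for x
  define n where "n x = max 0 (- D x)" for x
  have Dm[measurable]: "D \<in> borel_measurable M" using D by auto
  have pm[measurable]: "p \<in> borel_measurable M" and nm[measurable]: "n \<in> borel_measurable M"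
    unfolding p_def n_def by measurable
  have Dpn: "D x = p x - n x" and p0: "0 \<le> p x" and n0: "0 \<le> n x" for x
    by (auto simp: p_def n_def)
  have pint: "integrable M p" and nint: "integrable M n"
    using D unfolding p_def n_def by auto
  have bint: "integrable M (\<lambda>x. cis (t * \<xi> x) * of_real (g x))"
    if "integrable M g" for t and g :: "'a \<Rightarrow> real"
    by (rule integrable_bounded_mult[where c = 1]) (use that in auto)
  have eq: "(\<integral>x. cis (t * \<xi> x) * of_real (p x) \<partial>M) = (\<integral>x. cis (t * \<xi> x) * of_real (n x) \<partial>M)" for t
  proof -
    have "(\<integral>x. cis (t * \<xi> x) * of_real (p x) \<partial>M) - (\<integral>x. cis (t * \<xi> x) * of_real (n x) \<partial>M)
       = (\<integral>x. cis (t * \<xi> x) * of_real (p x) - cis (t * \<xi> x) * of_real (n x) \<partial>M)"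
      by (intro Bochner_Integration.integral_diff[symmetric] bint pint nint)
    also have "\<dots> = 0" using z[of t] by (simp add: Dpn algebra_simps)
    finally show ?thesis by simp
  qed
  define c where "c = (\<integral>x. p x \<partial>M)"
  \<comment> \<open>Frequency 0 shows that the positive and the negative part have the same mass, so
    one constant normalises both.\<close>
  have cn: "c = (\<integral>x. n x \<partial>M)" using eq[of 0] by (simp add: c_def)
  have cnn: "c \<ge> 0" unfolding c_def using p0 by simp
  have iB: "integrable M (\<lambda>x. indicator B (\<xi> x) * g x)" if "integrable M g" for g :: "'a \<Rightarrow> real"
    by (rule integrable_bounded_mult[where c = 1]) (use that in \<open>auto simp: indicator_def\<close>)
  show ?thesis
  proof (cases "c = 0")
    \<comment> \<open>Mass 0 cannot be normalised, but then both parts vanish almost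
      everywhere.\<close>
    case True
    have "AE x in M. p x = 0" using True pint p0 unfolding c_def
      by (subst integral_nonneg_eq_0_iff_AE[symmetric]) auto
    moreover have "AE x in M. n x = 0" using True nint n0 unfolding cn
      by (subst integral_nonneg_eq_0_iff_AE[symmetric]) auto
    ultimately have "AE x in M. indicator B (\<xi> x) * D x = 0" by (auto simp: Dpn)
    then show ?thesis by (subst integral_cong_AE[of _ _ "\<lambda>_. 0"]) auto
  next
    case False
    then have c: "c > 0" using cnn by simp
    \<comment> \<open>The law of \<xi> under the probability with density \<open>g / c\<close>, used
      for both \<open>p\<close> and \<open>n\<close>.\<close>
    define L where "L g = distr (density M (\<lambda>x. ennreal (g x / c))) borel \<xi>" for g
    have rd: "real_distribution (L g)"
      and ch: "char (L g) t = (\<integral>x. cis (t * \<xi> x) * of_real (g x) \<partial>M) / c"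
      and me: "measure (L g) B = (\<integral>x. indicator B (\<xi> x) * g x \<partial>M) / c"
      if [measurable]: "g \<in> borel_measurable M" and g: "integrable M g" "\<And>x. g x \<ge> 0" "(\<integral>x. g x \<partial>M) = c" for g t
    proof -
      have "emeasure (density M (\<lambda>x. ennreal (g x / c))) (space M) = (\<integral>\<^sup>+x. ennreal (g x / c) \<partial>M)"
        by (subst emeasure_density) (auto intro!: nn_integral_cong)
      also have "\<dots> = ennreal (\<integral>x. g x / c \<partial>M)"
        using g c by (intro nn_integral_eq_integral) auto
      also have "(\<integral>x. g x / c \<partial>M) = 1" using g c by simp
      finally interpret Q: prob_space "density M (\<lambda>x. ennreal (g x / c))"
        by (intro prob_spaceI) simp
      show "real_distribution (L g)"
        unfolding L_def by (intro Q.real_distribution_distr) simp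
      show "char (L g) t = (\<integral>x. cis (t * \<xi> x) * of_real (g x) \<partial>M) / c"
        unfolding L_def char_def using g c
        by (subst integral_distr) (simp_all add: integral_density cis_conv_exp scaleR_conv_of_real mult_ac)
      have "measure (L g) B = (\<integral>s. indicator B s \<partial>L g)"
        by (simp add: L_def)
      also have "\<dots> = (\<integral>x. indicator B (\<xi> x) * g x \<partial>M) / c"
        unfolding L_def using g c
        by (subst integral_distr) (simp_all add: integral_real_density mult_ac)
      finally show "measure (L g) B = (\<integral>x. indicator B (\<xi> x) * g x \<partial>M) / c" .
    qed
    have "L p = L n"
    proof (rule Levy_uniqueness)
      show "real_distribution (L p)" by (rule rd) (auto simp: pint p0 c_def)
      show "real_distribution (L n)" by (rule rd) (auto simp: nint n0 cn)
      show "char (L p) = char (L n)"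
        by (rule ext) (simp add: ch pint nint p0 n0 c_def[symmetric] cn[symmetric] eq)
    qed
    then have "(\<integral>x. indicator B (\<xi> x) * p x \<partial>M) = (\<integral>x. indicator B (\<xi> x) * n x \<partial>M)"
      using me[of p] me[of n] c by (simp add: pint nint p0 n0 c_def[symmetric] cn[symmetric])
    moreover have "(\<integral>x. indicator B (\<xi> x) * D x \<partial>M)
      = (\<integral>x. indicator B (\<xi> x) * p x \<partial>M) - (\<integral>x. indicator B (\<xi> x) * n x \<partial>M)"
      by (subst Bochner_Integration.integral_diff[symmetric])
        (auto intro!: iB pint nint simp: Dpn right_diff_distrib)
    ultimately show ?thesis by simp
  qed
qed

text \<open>Conjugating the hypothesis at frequency -t shows that the transform of
  \<open>cnj (D x)\<close> vanishes as well. Sum and difference then give the transforms of the real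
  and the imaginary part, to which the real case applies.\<close>

lemma (in prob_space) cis_transform_zero_complex:
  fixes D :: "'a \<Rightarrow> complex" and \<xi> :: "'a \<Rightarrow> real"
  assumes D: "integrable M D" and \<xi>[measurable]: "\<xi> \<in> borel_measurable M"
    and z: "\<And>t. (\<integral>x. cis (t * \<xi> x) * D x \<partial>M) = 0"
    and B[measurable]: "B \<in> sets borel"
  shows "(\<integral>x. indicator B (\<xi> x) * D x \<partial>M) = 0"
proof -
  have Dm[measurable]: "D \<in> borel_measurable M" using D by auto
  have int: "integrable M (\<lambda>x. cis (t * \<xi> x) * g x)" if "integrable M g" for t and g :: "'a \<Rightarrow> complex"
    by (rule integrable_bounded_mult[where c = 1]) (use that in auto)
  have Dc: "integrable M (\<lambda>x. cnj (D x))" using D by simp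
  have zc: "(\<integral>x. cis (t * \<xi> x) * cnj (D x) \<partial>M) = 0" for t
  proof -
    have "(\<integral>x. cis (t * \<xi> x) * cnj (D x) \<partial>M) = (\<integral>x. cnj (cis ((-t) * \<xi> x) * D x) \<partial>M)"
      by (simp add: cis_cnj)
    also have "\<dots> = cnj (\<integral>x. cis ((-t) * \<xi> x) * D x \<partial>M)" by (rule Bochner_Integration.integral_cnj)
    finally show ?thesis using z[of "-t"] by simp
  qed
  have "(\<integral>x. cis (t * \<xi> x) * of_real (Re (D x)) \<partial>M) = 0" for t
  proof -
    have "(\<integral>x. cis (t * \<xi> x) * of_real (Re (D x)) \<partial>M)
      = (\<integral>x. (cis (t * \<xi> x) * D x + cis (t * \<xi> x) * cnj (D x)) / 2 \<partial>M)"
      by (simp add: distrib_left[symmetric] complex_add_cnj)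
    also have "\<dots> = ((\<integral>x. cis (t * \<xi> x) * D x \<partial>M) + (\<integral>x. cis (t * \<xi> x) * cnj (D x) \<partial>M)) / 2"
      using int[OF D, of t] int[OF Dc, of t] by simp
    finally show ?thesis unfolding z zc by simp
  qed
  from cis_transform_zero_real[OF _ \<xi> this B] D
  have re: "(\<integral>x. indicator B (\<xi> x) * Re (D x) \<partial>M) = 0" by simp
  have "(\<integral>x. cis (t * \<xi> x) * of_real (Im (D x)) \<partial>M) = 0" for t
  proof -
    have "(\<integral>x. cis (t * \<xi> x) * of_real (Im (D x)) \<partial>M)
      = (\<integral>x. (cis (t * \<xi> x) * D x - cis (t * \<xi> x) * cnj (D x)) / (2 * \<i>) \<partial>M)"
      by (intro Bochner_Integration.integral_cong refl)
        (simp only: right_diff_distrib[symmetric] complex_diff_cnj, simp add: complex_eq_iff)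
    also have "\<dots> = ((\<integral>x. cis (t * \<xi> x) * D x \<partial>M) - (\<integral>x. cis (t * \<xi> x) * cnj (D x) \<partial>M)) / (2 * \<i>)"
      using int[OF D, of t] int[OF Dc, of t] by simp
    finally show ?thesis unfolding z zc by simp
  qed
  from cis_transform_zero_real[OF _ \<xi> this B] D
  have im: "(\<integral>x. indicator B (\<xi> x) * Im (D x) \<partial>M) = 0" by simp
  have iB: "integrable M (\<lambda>x. indicator B (\<xi> x) * D x)"
    by (rule integrable_bounded_mult[where c = 1]) (use D in \<open>auto simp: indicator_def\<close>)
  have ind: "indicator B s = complex_of_real (indicator B s)" for s by (simp add: indicator_def)
  show ?thesis
  proof (rule complex_eqI)
    show "Re (\<integral>x. indicator B (\<xi> x) * D x \<partial>M) = Re 0"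
      using re by (subst integral_Re[OF iB, symmetric]) (simp add: ind)
    show "Im (\<integral>x. indicator B (\<xi> x) * D x \<partial>M) = Im 0"
      using im by (subst integral_Im[OF iB, symmetric]) (simp add: ind)
  qed
qed

text \<open>The characters are replaced by indicators of half-lines one coordinate at a time.\<close>

lemma (in prob_space) cis_transform_zero:
  fixes D :: "'a \<Rightarrow> complex" and X :: "'a \<Rightarrow> real^'m"
  assumes D: "integrable M D" and X[measurable]: "X \<in> borel_measurable M"
    and z: "\<And>t. (\<integral>x. cis (t \<bullet> X x) * D x \<partial>M) = 0"
    and B: "B \<in> sets borel"
  shows "(\<integral>x\<in>X -` B \<inter> space M. D x \<partial>M) = 0"
proof -
  have Dm[measurable]: "D \<in> borel_measurable M" using D by auto
  have X'[measurable]: "(\<lambda>x. X x $ i) \<in> borel_measurable M" for i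
    using borel_measurable_inner[OF X measurable_const[of "axis i 1"]] by (simp add: inner_axis)
  have pint: "integrable M (\<lambda>x. (\<Prod>i\<in>S. indicator (A i) (X x $ i)) * (cis (t \<bullet> X x) * D x))"
    if [measurable]: "\<And>i. A i \<in> sets borel" for A S t
  proof (rule Bochner_Integration.integrable_bound[OF D])
    show "AE x in M. norm ((\<Prod>i\<in>S. indicator (A i) (X x $ i)) * (cis (t \<bullet> X x) * D x)) \<le> norm (D x)"
      by (auto simp: norm_mult prod_norm[symmetric] indicator_def intro!: mult_left_le_one_le prod_le_1 prod_nonneg)
  qed measurable
  \<comment> \<open>The frequency stays arbitrary in the induction: the character in coordinate j
    that the one-dimensional lemma asks for is absorbed by shifting t along
    \<open>axis j 1\<close>.\<close>
  have coords: "(\<integral>x. (\<Prod>i\<in>S. indicator (A i) (X x $ i)) * (cis (t \<bullet> X x) * D x) \<partial>M) = 0"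
    if "finite S" "\<And>i. A i \<in> sets borel" for A S t
    using that(1)
  proof (induction S arbitrary: t)
    case empty then show ?case using z by simp
  next
    case (insert j S)
    have "(\<integral>x. indicator (A j) (X x $ j) * ((\<Prod>i\<in>S. indicator (A i) (X x $ i)) * (cis (t \<bullet> X x) * D x)) \<partial>M) = 0"
    proof (rule cis_transform_zero_complex)
      show "(\<integral>x. cis (s * X x $ j) * ((\<Prod>i\<in>S. indicator (A i) (X x $ i)) * (cis (t \<bullet> X x) * D x)) \<partial>M) = 0" for s
      proof -
        have cis_eq: "cis (s * X x $ j) * cis (t \<bullet> X x) = cis ((t + s *\<^sub>R axis j 1) \<bullet> X x)" for x
          by (simp add: cis_mult inner_left_distrib inner_axis' add.commute)
        have "cis (s * X x $ j) * ((\<Prod>i\<in>S. indicator (A i) (X x $ i)) * (cis (t \<bullet> X x) * D x))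
          = (\<Prod>i\<in>S. indicator (A i) (X x $ i)) * (cis ((t + s *\<^sub>R axis j 1) \<bullet> X x) * D x)" for x
          unfolding cis_eq[symmetric] by (simp only: mult_ac)
        then show ?thesis by (simp only: insert.IH)
      qed
    qed (use that pint in auto)
    then show ?case using insert by (simp add: mult.assoc)
  qed
  \<comment> \<open>Preimages of lower orthants; the componentwise infimum makes them a pi-system,
    and an orthant is a product of half-lines as in \<open>coords\<close>.\<close>
  define G where "G = {X -` E \<inter> space M | E. E \<in> range (\<lambda>a::real^'m. {..a})}"
  have "X -` B \<inter> space M \<in> {X -` E \<inter> space M | E. E \<in> sigma_sets UNIV (range (\<lambda>a::real^'m. {..a}))}"
    using B by (auto simp: borel_eq_atMost)
  also have "\<dots> = sigma_sets (space M) G"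
    unfolding G_def by (rule sigma_sets_vimage_commute) auto
  finally have BG: "X -` B \<inter> space M \<in> sigma_sets (space M) G" .
  show ?thesis
  proof (rule set_integral_zero_sigma_sets[OF D _ _ _ _ BG])
    show "Int_stable G"
    proof (rule Int_stableI)
      fix a b assume "a \<in> G" "b \<in> G"
      then obtain u v where *: "a = X -` {..u} \<inter> space M" "b = X -` {..v} \<inter> space M"
        unfolding G_def by auto
      have "a \<inter> b = X -` {..inf u v} \<inter> space M" unfolding * by (auto simp: le_inf_iff)
      then show "a \<inter> b \<in> G" unfolding G_def by blast
    qed
    show "G \<subseteq> sets M" unfolding G_def by auto
    show "(\<integral>x. D x \<partial>M) = 0" using z[of 0] by simp
    fix E assume "E \<in> G"
    then obtain a where E: "E = X -` {..a} \<inter> space M" unfolding G_def by auto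
    have "indicator E x *\<^sub>R D x = (\<Prod>i\<in>UNIV. indicator {..a $ i} (X x $ i)) * (cis (0 \<bullet> X x) * D x)"
      if "x \<in> space M" for x
    proof (cases "X x \<le> a")
      case True
      then show ?thesis using that by (simp add: E less_eq_vec_def indicator_def)
    next
      case False
      then obtain i where "\<not> X x $ i \<le> a $ i" by (auto simp: less_eq_vec_def)
      then have "(\<Prod>i\<in>UNIV. indicator {..a $ i} (X x $ i) :: complex) = 0"
        by (intro prod_zero bexI[of _ i]) auto
      then show ?thesis using False by (simp add: E)
    qed
    then have "(\<integral>x\<in>E. D x \<partial>M) = (\<integral>x. (\<Prod>i\<in>UNIV. indicator {..a $ i} (X x $ i)) * (cis (0 \<bullet> X x) * D x) \<partial>M)"
      unfolding set_lebesgue_integral_def by (intro Bochner_Integration.integral_cong) auto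
    also have "\<dots> = 0" by (rule coords) auto
    finally show "(\<integral>x\<in>E. D x \<partial>M) = 0" .
  qed
qed

section \<open>Vanishing conditional expectations\<close>

text \<open>E[D | F] = 0 for complex \<open>D\<close>. Testing against bounded functions instead of
  sets makes multiplication by \<open>F\<close>-measurable factors immediate, and no version of a
  complex conditional expectation has to be chosen.\<close>

definition cond_null :: "'a measure \<Rightarrow> 'a measure \<Rightarrow> ('a \<Rightarrow> complex) \<Rightarrow> bool" where
  "cond_null M F D \<longleftrightarrow> integrable M D \<and>
    (\<forall>Z c. Z \<in> borel_measurable F \<longrightarrow> (\<forall>x\<in>space M. norm (Z x) \<le> c) \<longrightarrow>
      (\<integral>x. Z x * D x \<partial>M) = 0)"

lemma cond_null_integrable: "cond_null M F D \<Longrightarrow> integrable M D"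
  by (simp add: cond_null_def)

lemma cond_nullD:
  assumes "cond_null M F D" "Z \<in> borel_measurable F" "\<And>x. x \<in> space M \<Longrightarrow> norm (Z x) \<le> c"
  shows "(\<integral>x. Z x * D x \<partial>M) = 0"
  using assms unfolding cond_null_def by blast

lemma cond_null_cong:
  assumes "cond_null M F D" "\<And>x. x \<in> space M \<Longrightarrow> D x = D' x"
  shows "cond_null M F D'"
proof -
  have "(\<integral>x. Z x * D x \<partial>M) = (\<integral>x. Z x * D' x \<partial>M)" for Z
    using assms(2) by (intro Bochner_Integration.integral_cong) auto
  moreover have "integrable M D \<longleftrightarrow> integrable M D'"
    using assms(2) by (intro Bochner_Integration.integrable_cong) auto
  ultimately show ?thesis using assms(1) unfolding cond_null_def by simp
qed

lemma cond_null_mult: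
  assumes sub: "subalgebra M F" and D: "cond_null M F D"
    and Z: "Z \<in> borel_measurable F" and b: "\<And>x. x \<in> space M \<Longrightarrow> norm (Z x) \<le> c"
  shows "cond_null M F (\<lambda>x. Z x * D x)"
  unfolding cond_null_def
proof (intro conjI allI impI)
  show "integrable M (\<lambda>x. Z x * D x)"
    using integrable_bounded_mult[OF cond_null_integrable[OF D] measurable_from_subalg[OF sub Z] b] by simp
  fix Y :: "'a \<Rightarrow> complex" and d assume Y: "Y \<in> borel_measurable F" "\<forall>x\<in>space M. norm (Y x) \<le> d"
  have "(\<integral>x. (Y x * Z x) * D x \<partial>M) = 0"
  proof (rule cond_nullD[OF D])
    show "(\<lambda>x. Y x * Z x) \<in> borel_measurable F" using Y Z by measurable
    fix x assume w: "x \<in> space M"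
    show "norm (Y x * Z x) \<le> d * c"
      unfolding norm_mult using Y(2) b w
      by (intro mult_mono) (auto intro: order_trans[OF norm_ge_zero])
  qed
  then show "(\<integral>x. Y x * (Z x * D x) \<partial>M) = 0" by (simp add: mult.assoc)
qed

lemma cond_null_add:
  assumes sub: "subalgebra M F" and "cond_null M F D" "cond_null M F E"
  shows "cond_null M F (\<lambda>x. D x + E x)"
  unfolding cond_null_def
proof (intro conjI allI impI)
  show "integrable M (\<lambda>x. D x + E x)" using assms by (auto dest: cond_null_integrable)
  fix Z :: "'a \<Rightarrow> complex" and c assume Z: "Z \<in> borel_measurable F" "\<forall>x\<in>space M. norm (Z x) \<le> c"
  have "integrable M (\<lambda>x. Z x * D x)" "integrable M (\<lambda>x. Z x * E x)"
    using Z assms measurable_from_subalg[OF sub Z(1)]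
    by (auto intro!: integrable_bounded_mult dest: cond_null_integrable)
  moreover have "(\<integral>x. Z x * D x \<partial>M) = 0" "(\<integral>x. Z x * E x \<partial>M) = 0"
    using cond_nullD[OF assms(2) Z(1)] cond_nullD[OF assms(3) Z(1)] Z(2) by auto
  ultimately show "(\<integral>x. Z x * (D x + E x) \<partial>M) = 0"
    by (simp add: distrib_left)
qed

lemma cond_null_uminus: "cond_null M F D \<Longrightarrow> cond_null M F (\<lambda>x. - D x)"
  unfolding cond_null_def by simp

lemma cond_null_diff:
  assumes "subalgebra M F" "cond_null M F D" "cond_null M F E"
  shows "cond_null M F (\<lambda>x. D x - E x)"
  using cond_null_add[OF assms(1,2) cond_null_uminus[OF assms(3)]] by simp

lemma cond_null_set_integral:
  assumes sub: "subalgebra M F" and D: "cond_null M F D" and A: "A \<in> sets F"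
  shows "(\<integral>x\<in>A. D x \<partial>M) = 0"
proof -
  have "(\<integral>x. indicator A x * D x \<partial>M) = 0"
    by (rule cond_nullD[OF D, where c = 1]) (use A in \<open>auto simp: indicator_def\<close>)
  moreover have "indicator A x * D x = indicator A x *\<^sub>R D x" for x by (simp add: indicator_def)
  ultimately show ?thesis unfolding set_lebesgue_integral_def by simp
qed

text \<open>Vanishing on the sets of \<open>F\<close> says that 0 is a version of the real
  conditional expectation, which can be integrated against bounded \<open>F\<close>-measurable
  functions. The complex case splits into four real products.\<close>

lemma (in prob_space) cond_nullI:
  assumes sub: "subalgebra M F" and D: "integrable M D"
    and z: "\<And>A. A \<in> sets F \<Longrightarrow> (\<integral>x\<in>A. D x \<partial>M) = 0"
  shows "cond_null M F D"
proof -
  interpret S: finite_measure_subalgebra M F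
    using sub by unfold_locales
  have AM: "A \<in> sets M" if "A \<in> sets F" for A using that sub by (auto simp: subalgebra_def)
  have key: "(\<integral>x. f x * g x \<partial>M) = 0"
    if f: "f \<in> borel_measurable F" "\<And>x. x \<in> space M \<Longrightarrow> norm (f x) \<le> c"
      and g: "integrable M g" "\<And>A. A \<in> sets F \<Longrightarrow> (\<integral>x\<in>A. g x \<partial>M) = 0" for f g :: "'a \<Rightarrow> real" and c
  proof -
    have fM: "f \<in> borel_measurable M" using sub f(1) by (rule measurable_from_subalg)
    have "AE x in M. real_cond_exp M F g x = 0"
      by (rule S.real_cond_exp_charact) (use g in \<open>auto simp: set_lebesgue_integral_def\<close>)
    then have "(\<integral>x. f x * real_cond_exp M F g x \<partial>M) = (\<integral>x. 0 \<partial>M)"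
      using fM by (intro integral_cong_AE) auto
    moreover have "integrable M (\<lambda>x. f x * g x)"
      by (rule integrable_bounded_mult[OF g(1) fM f(2)])
    ultimately show ?thesis
      using S.real_cond_exp_intg(2)[of f g] f(1) g(1) by auto
  qed
  have ReD: "integrable M (\<lambda>x. Re (D x))" and ImD: "integrable M (\<lambda>x. Im (D x))" using D by auto
  have zRe: "(\<integral>x\<in>A. Re (D x) \<partial>M) = 0" and zIm: "(\<integral>x\<in>A. Im (D x) \<partial>M) = 0" if "A \<in> sets F" for A
  proof -
    have i: "integrable M (\<lambda>x. indicator A x *\<^sub>R D x)"
      using AM[OF that] D by (rule integrable_mult_indicator)
    show "(\<integral>x\<in>A. Re (D x) \<partial>M) = 0"
      using z[OF that] integral_Re[OF i] unfolding set_lebesgue_integral_def by simp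
    show "(\<integral>x\<in>A. Im (D x) \<partial>M) = 0"
      using z[OF that] integral_Im[OF i] unfolding set_lebesgue_integral_def by simp
  qed
  show ?thesis
    unfolding cond_null_def
  proof (intro conjI allI impI)
    show "integrable M D" by fact
    fix Z :: "'a \<Rightarrow> complex" and c assume Z: "Z \<in> borel_measurable F" "\<forall>x\<in>space M. norm (Z x) \<le> c"
    have b: "norm (Re (Z x)) \<le> c" "norm (Im (Z x)) \<le> c" if "x \<in> space M" for x
      using Z(2) that abs_Re_le_cmod[of "Z x"] abs_Im_le_cmod[of "Z x"] by (auto intro: order_trans)
    have ZR: "(\<lambda>x. Re (Z x)) \<in> borel_measurable F" and ZI: "(\<lambda>x. Im (Z x)) \<in> borel_measurable F"
      using Z(1) by measurable
    have i: "integrable M (\<lambda>x. Z x * D x)"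
      using Z by (intro integrable_bounded_mult D measurable_from_subalg[OF sub Z(1)]) auto
    note bi = integrable_bounded_mult[OF _ measurable_from_subalg[OF sub], where c = c]
    have k: "(\<integral>x. Re (Z x) * Re (D x) \<partial>M) = 0" "(\<integral>x. Im (Z x) * Im (D x) \<partial>M) = 0"
      "(\<integral>x. Re (Z x) * Im (D x) \<partial>M) = 0" "(\<integral>x. Im (Z x) * Re (D x) \<partial>M) = 0"
      using b by (auto intro!: key[OF ZR _ ReD zRe] key[OF ZI _ ImD zIm] key[OF ZR _ ImD zIm] key[OF ZI _ ReD zRe])
    show "(\<integral>x. Z x * D x \<partial>M) = 0"
    proof (rule complex_eqI)
      show "Re (\<integral>x. Z x * D x \<partial>M) = Re 0"
        using bi[OF ReD ZR b(1)] bi[OF ImD ZI b(2)]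
        by (subst integral_Re[OF i, symmetric]) (simp add: k)
      show "Im (\<integral>x. Z x * D x \<partial>M) = Im 0"
        using bi[OF ImD ZR b(1)] bi[OF ReD ZI b(2)]
        by (subst integral_Im[OF i, symmetric]) (simp add: k)
    qed
  qed
qed

text \<open>The level sets of \<open>P\<close> form a finite partition of the space, so the integral
  against a test function is a finite sum. This is what permits freezing a random
  covariance.\<close>

lemma cond_null_simple_function:
  assumes sub: "subalgebra M F" and D: "integrable M D" and P: "simple_function F P"
    and z: "\<And>p. p \<in> P ` space M \<Longrightarrow> cond_null M F (\<lambda>x. indicator (P -` {p} \<inter> space M) x * D x)"
  shows "cond_null M F D"
  unfolding cond_null_def
proof (intro conjI allI impI)
  show "integrable M D" by fact
  fix Z :: "'a \<Rightarrow> complex" and c assume Z: "Z \<in> borel_measurable F" "\<forall>x\<in>space M. norm (Z x) \<le> c"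
  have sp: "space F = space M" using sub by (simp add: subalgebra_def)
  have fin: "finite (P ` space M)" using P by (simp add: simple_function_def sp)
  have "(\<integral>x. Z x * D x \<partial>M) = (\<integral>x. (\<Sum>p\<in>P ` space M. Z x * (indicator (P -` {p} \<inter> space M) x * D x)) \<partial>M)"
  proof (rule Bochner_Integration.integral_cong[OF refl])
    fix x assume w: "x \<in> space M"
    have "(\<Sum>p\<in>P ` space M. Z x * (indicator (P -` {p} \<inter> space M) x * D x))
      = (\<Sum>p\<in>P ` space M. if p = P x then Z x * D x else 0)"
      using w by (intro sum.cong) (auto simp: indicator_def)
    then show "Z x * D x = (\<Sum>p\<in>P ` space M. Z x * (indicator (P -` {p} \<inter> space M) x * D x))"
      using fin w by (simp add: sum.delta)
  qed
  also have "\<dots> = (\<Sum>p\<in>P ` space M. \<integral>x. Z x * (indicator (P -` {p} \<inter> space M) x * D x) \<partial>M)"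
    using Z by (intro Bochner_Integration.integral_sum integrable_bounded_mult[where c = c]
        cond_null_integrable[OF z] measurable_from_subalg[OF sub]) auto
  also have "\<dots> = 0"
    using Z by (intro sum.neutral ballI cond_nullD[OF z, where c = c]) auto
  finally show "(\<integral>x. Z x * D x \<partial>M) = 0" .
qed

lemma cond_null_coarser:
  assumes "cond_null M F D" "subalgebra F G"
  shows "cond_null M G D"
  using assms measurable_from_subalg[OF assms(2)] unfolding cond_null_def by blast

section \<open>The sigma-algebra generated by \<open>F\<close> and an observation\<close>

definition join_gen :: "'a measure \<Rightarrow> 'a measure \<Rightarrow> ('a \<Rightarrow> 'b::topological_space) \<Rightarrow> 'a measure" where
  "join_gen M F y = sigma (space M) (sets F \<union> gen_sets M y)"

lemma measurable_gen_sets: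
  assumes "gen_sets M f \<subseteq> sets N" "space N = space M"
  shows "f \<in> borel_measurable N"
  by (rule measurableI) (use assms in \<open>auto simp: gen_sets_def\<close>)

lemma gen_sets_subset_sets:
  assumes "f \<in> borel_measurable N" "space N = space M"
  shows "gen_sets M f \<subseteq> sets N"
  using measurable_sets[OF assms(1)] by (auto simp: gen_sets_def assms(2))

lemma
  assumes sub: "subalgebra M F" and y: "y \<in> borel_measurable M"
  shows subalgebra_join_gen: "subalgebra M (join_gen M F y)"
    and sub_join_gen: "subalgebra (join_gen M F y) F"
    and measurable_join_gen: "y \<in> borel_measurable (join_gen M F y)"
    and sets_join_gen: "sets (join_gen M F y) = sigma_sets (space M) (sets F \<union> gen_sets M y)"
    and space_join_gen: "space (join_gen M F y) = space M"
proof -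
  have pow: "sets F \<union> gen_sets M y \<subseteq> Pow (space M)"
    using sub gen_sets_subset_sets[OF y refl] sets.space_closed[of M] by (auto simp: subalgebra_def)
  show sp: "space (join_gen M F y) = space M" unfolding join_gen_def using pow by simp
  show s: "sets (join_gen M F y) = sigma_sets (space M) (sets F \<union> gen_sets M y)"
    unfolding join_gen_def using pow by simp
  show "subalgebra M (join_gen M F y)"
    using sub gen_sets_subset_sets[OF y refl] unfolding subalgebra_def sp s
    by (intro conjI refl sets.sigma_sets_subset) simp
  show "subalgebra (join_gen M F y) F"
    using sub unfolding subalgebra_def sp s by auto
  show "y \<in> borel_measurable (join_gen M F y)"
    using sp by (intro measurable_gen_sets[of M]) (auto simp: s)
qed

text \<open>For fixed a in \<open>F\<close> the hypothesis says that the transform of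
  \<open>indicator a x * D x\<close> along \<open>y\<close> vanishes, so its integral over every
  preimage under \<open>y\<close> is 0. The intersections of such sets form a pi-system generating
  the join.\<close>

lemma (in prob_space) cond_null_join_gen:
  fixes y :: "'a \<Rightarrow> real^'m"
  assumes sub: "subalgebra M F" and y: "y \<in> borel_measurable M" and D: "integrable M D"
    and z: "\<And>t. cond_null M F (\<lambda>x. cis (t \<bullet> y x) * D x)"
  shows "cond_null M (join_gen M F y) D"
proof (rule cond_nullI[OF subalgebra_join_gen[OF sub y] D])
  fix A assume "A \<in> sets (join_gen M F y)"
  then have A: "A \<in> sigma_sets (space M) (sets F \<union> gen_sets M y)" by (simp add: sets_join_gen[OF sub y])
  have FM: "sets F \<subseteq> sets M" and sp: "space F = space M" using sub by (auto simp: subalgebra_def)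
  have [measurable]: "D \<in> borel_measurable M" "y \<in> borel_measurable M" using D y by auto
  define G where "G = {a \<inter> b | a b. a \<in> sets F \<and> b \<in> gen_sets M y}"
  have gG: "gen_sets M y \<subseteq> G"
  proof
    fix b assume b: "b \<in> gen_sets M y"
    have "b = space M \<inter> b" using b by (auto simp: gen_sets_def)
    then show "b \<in> G" unfolding G_def using b sets.top[of F] sp by auto
  qed
  have FG: "sets F \<subseteq> G"
  proof
    fix a assume a: "a \<in> sets F"
    have "a = a \<inter> (y -` UNIV \<inter> space M)" using a sets.sets_into_space sp by fastforce
    moreover have "y -` UNIV \<inter> space M \<in> gen_sets M y"
      unfolding gen_sets_def by (auto intro!: exI[of _ UNIV])
    ultimately show "a \<in> G" unfolding G_def using a by blast
  qed
  show "(\<integral>x\<in>A. D x \<partial>M) = 0"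
  proof (rule set_integral_zero_sigma_sets[OF D])
    show "A \<in> sigma_sets (space M) G"
      using sigma_sets_subseteq[OF Un_least[OF FG gG]] A by (rule subsetD)
    show "Int_stable G"
    proof (rule Int_stableI)
      fix a b assume "a \<in> G" "b \<in> G"
      then obtain p q P Q where *: "a = p \<inter> (y -` P \<inter> space M)" "b = q \<inter> (y -` Q \<inter> space M)"
        "p \<in> sets F" "q \<in> sets F" "P \<in> sets borel" "Q \<in> sets borel"
        unfolding G_def gen_sets_def by blast
      have "a \<inter> b = (p \<inter> q) \<inter> (y -` (P \<inter> Q) \<inter> space M)" unfolding * by auto
      moreover have "p \<inter> q \<in> sets F" "P \<inter> Q \<in> sets borel" using * by auto
      ultimately show "a \<inter> b \<in> G" unfolding G_def gen_sets_def by blast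
    qed
    show "G \<subseteq> sets M" unfolding G_def using FM gen_sets_subset_sets[OF y refl] by auto
    have "(\<integral>x. 1 * (cis (0 \<bullet> y x) * D x) \<partial>M) = 0"
      by (rule cond_nullD[OF z, where c = 1]) auto
    then show "(\<integral>x. D x \<partial>M) = 0" by simp
    fix E assume "E \<in> G"
    then obtain a B where E: "E = a \<inter> (y -` B \<inter> space M)" "a \<in> sets F" "B \<in> sets borel"
      unfolding G_def gen_sets_def by blast
    have aM: "a \<in> sets M" using E FM by auto
    have "(\<integral>x\<in>y -` B \<inter> space M. indicator a x * D x \<partial>M) = 0"
    proof (rule cis_transform_zero)
      show "integrable M (\<lambda>x. indicator a x * D x)"
        by (rule integrable_bounded_mult[OF D, where c = 1]) (use aM in \<open>auto simp: indicator_def\<close>)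
      fix t
      have "(\<integral>x. indicator a x * (cis (t \<bullet> y x) * D x) \<partial>M) = 0"
        by (rule cond_nullD[OF z, where c = 1]) (use E in \<open>auto simp: indicator_def\<close>)
      then show "(\<integral>x. cis (t \<bullet> y x) * (indicator a x * D x) \<partial>M) = 0"
        by (simp add: mult_ac)
    qed (use E in auto)
    moreover have "indicator (y -` B \<inter> space M) x *\<^sub>R (indicator a x * D x) = indicator E x *\<^sub>R D x" for x
      by (auto simp: E indicator_def)
    ultimately show "(\<integral>x\<in>E. D x \<partial>M) = 0" unfolding set_lebesgue_integral_def by simp
  qed
qed

text \<open>Fubini: the uniform bound makes the product with a test function integrable. It serves
  to average over a random shift of the frequency.\<close>

lemma (in prob_space) cond_null_mixture:
  fixes f :: "real \<Rightarrow> 'a \<Rightarrow> complex"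
  assumes sub: "subalgebra M F" and N: "prob_space N"
    and f: "(\<lambda>(s, x). f s x) \<in> borel_measurable (N \<Otimes>\<^sub>M M)"
    and b: "\<And>s x. x \<in> space M \<Longrightarrow> norm (f s x) \<le> c"
    and z: "\<And>s. cond_null M F (f s)"
  shows "cond_null M F (\<lambda>x. \<integral>s. f s x \<partial>N)"
proof -
  interpret N: prob_space N by fact
  interpret NM: pair_prob_space N M ..
  have int: "integrable (N \<Otimes>\<^sub>M M) (\<lambda>(s, x). Z x * f s x)"
    if Z: "Z \<in> borel_measurable M" "\<And>x. x \<in> space M \<Longrightarrow> norm (Z x) \<le> d" for Z d
  proof (rule NM.P.integrable_const_bound[where B = "d * c"])
    show "AE p in N \<Otimes>\<^sub>M M. norm (case p of (s, x) \<Rightarrow> Z x * f s x) \<le> d * c"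
    proof (rule AE_I2)
      fix p assume "p \<in> space (N \<Otimes>\<^sub>M M)"
      then obtain s x where p: "p = (s, x)" "x \<in> space M" by (auto simp: space_pair_measure)
      show "norm (case p of (s, x) \<Rightarrow> Z x * f s x) \<le> d * c"
        using Z(2)[OF p(2)] b[OF p(2), of s] unfolding p(1)
        by (auto simp: norm_mult intro!: mult_mono intro: order_trans[OF norm_ge_zero])
    qed
    show "(\<lambda>(s, x). Z x * f s x) \<in> borel_measurable (N \<Otimes>\<^sub>M M)"
      using f Z(1) by measurable
  qed
  show ?thesis
    unfolding cond_null_def
  proof (intro conjI allI impI)
    show "integrable M (\<lambda>x. \<integral>s. f s x \<partial>N)"
      using NM.integrable_snd[OF int[of "\<lambda>_. 1" 1]] by simp
    fix Z :: "'a \<Rightarrow> complex" and d assume Z: "Z \<in> borel_measurable F" "\<forall>x\<in>space M. norm (Z x) \<le> d"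
    have "(\<integral>x. Z x * (\<integral>s. f s x \<partial>N) \<partial>M) = (\<integral>x. (\<integral>s. Z x * f s x \<partial>N) \<partial>M)" by simp
    also have "\<dots> = (\<integral>s. (\<integral>x. Z x * f s x \<partial>M) \<partial>N)"
      using Z by (intro NM.Fubini_integral int measurable_from_subalg[OF sub]) auto
    also have "\<dots> = 0"
    proof -
      have "(\<integral>x. Z x * f s x \<partial>M) = 0" for s
        using Z by (intro cond_nullD[OF z]) auto
      then show ?thesis by simp
    qed
    finally show "(\<integral>x. Z x * (\<integral>s. f s x \<partial>N) \<partial>M) = 0" .
  qed
qed

section \<open>Gaussian integrals and positive semidefinite matrices\<close>

lemma cis_integral_normal:
  assumes \<sigma>: "0 < \<sigma>"
  shows "(\<integral>s. cis (t * s) \<partial>density lborel (normal_density \<mu> \<sigma>)) = cis (t * \<mu>) * exp (- (\<sigma>\<^sup>2 * t\<^sup>2) / 2)"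
proof -
  have n: "\<sigma> * normal_density \<mu> \<sigma> (\<mu> + \<sigma> * x) = std_normal_density x" for x
    using \<sigma> by (simp add: normal_density_def power_mult_distrib real_sqrt_mult)
  have "(\<integral>s. cis (t * s) \<partial>density lborel (normal_density \<mu> \<sigma>)) = (\<integral>s. normal_density \<mu> \<sigma> s *\<^sub>R cis (t * s) \<partial>lborel)"
    by (intro integral_density) auto
  also have "\<dots> = \<bar>\<sigma>\<bar> *\<^sub>R (\<integral>x. normal_density \<mu> \<sigma> (\<mu> + \<sigma> * x) *\<^sub>R cis (t * (\<mu> + \<sigma> * x)) \<partial>lborel)"
    using \<sigma> by (intro lborel_integral_real_affine) auto
  also have "\<dots> = (\<integral>x. \<bar>\<sigma>\<bar> *\<^sub>R (normal_density \<mu> \<sigma> (\<mu> + \<sigma> * x) *\<^sub>R cis (t * (\<mu> + \<sigma> * x))) \<partial>lborel)"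
    by (rule integral_scaleR_right[symmetric])
  also have "\<dots> = (\<integral>x. std_normal_density x *\<^sub>R (cis (t * \<mu>) * cis ((t * \<sigma>) * x)) \<partial>lborel)"
    using \<sigma> by (intro Bochner_Integration.integral_cong refl)
      (simp only: scaleR_scaleR abs_of_pos n cis_mult, simp add: algebra_simps)
  also have "\<dots> = (\<integral>x. cis (t * \<mu>) * cis ((t * \<sigma>) * x) \<partial>std_normal_distribution)"
    by (intro integral_density[symmetric]) auto
  also have "\<dots> = cis (t * \<mu>) * char std_normal_distribution (t * \<sigma>)"
    by (simp add: char_def cis_conv_exp)
  finally show ?thesis by (simp add: char_std_normal_distribution power_mult_distrib mult.commute)
qed

text \<open>Read from right to left this is the Hubbard-Stratonovich linearisation: a Gaussian
  factor in r becomes an average of characters.\<close>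

lemma cis_integral_std_normal:
  "(\<integral>s. cis (s * r) \<partial>std_normal_distribution) = exp (- r\<^sup>2 / 2)"
  using cis_integral_normal[where \<sigma> = 1 and \<mu> = 0 and t = r] by (simp add: mult.commute)

text \<open>Completing the square turns the tilted standard normal density into a multiple of the
  normal density with mean - \<delta> / (1 + \<beta>) and variance 1 / (1 + \<beta>), whose
  characteristic function is known.\<close>

lemma cis_exp_quadratic_integral_std_normal:
  assumes \<beta>: "0 \<le> \<beta>"
  shows "(\<integral>s. cis (s * \<alpha>) * of_real (exp (- (s * \<delta>) - \<beta> * s\<^sup>2 / 2)) \<partial>std_normal_distribution)
    = cis (- (\<alpha> * \<delta> / (1 + \<beta>))) * of_real (exp ((\<delta>\<^sup>2 - \<alpha>\<^sup>2) / (2 * (1 + \<beta>))) / sqrt (1 + \<beta>))"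
proof -
  define \<mu> \<sigma> where "\<mu> = - \<delta> / (1 + \<beta>)" and "\<sigma> = 1 / sqrt (1 + \<beta>)"
  \<comment> \<open>The total mass of the tilted density.\<close>
  define \<kappa> where "\<kappa> = exp (\<delta>\<^sup>2 / (2 * (1 + \<beta>))) / sqrt (1 + \<beta>)"
  have \<beta>1: "1 + \<beta> > 0" using \<beta> by simp
  have \<sigma>: "\<sigma> > 0" and \<sigma>2: "\<sigma>\<^sup>2 = 1 / (1 + \<beta>)" using \<beta>1 by (auto simp: \<sigma>_def power_divide)
  have e: "- s\<^sup>2 / 2 + (- (s * \<delta>) - \<beta> * s\<^sup>2 / 2) = \<delta>\<^sup>2 / (2 * (1 + \<beta>)) + - (s - \<mu>)\<^sup>2 / (2 * \<sigma>\<^sup>2)" for s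
  proof -
    have "(s - \<mu>)\<^sup>2 = ((1 + \<beta>) * s + \<delta>)\<^sup>2 / (1 + \<beta>)\<^sup>2"
      using \<beta>1 by (simp add: \<mu>_def power_divide[symmetric] add_divide_distrib)
    moreover have "- (X / (1 + \<beta>)\<^sup>2) / (2 * (1 / (1 + \<beta>))) = - X / (2 * (1 + \<beta>))" for X
      using \<beta>1 by (simp add: power2_eq_square)
    ultimately have "- (s - \<mu>)\<^sup>2 / (2 * \<sigma>\<^sup>2) = - ((1 + \<beta>) * s + \<delta>)\<^sup>2 / (2 * (1 + \<beta>))"
      unfolding \<sigma>2 by simp
    moreover have "- s\<^sup>2 / 2 + (- (s * \<delta>) - \<beta> * s\<^sup>2 / 2) = (\<delta>\<^sup>2 - ((1 + \<beta>) * s + \<delta>)\<^sup>2) / (2 * (1 + \<beta>))"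
    proof -
      have "\<delta>\<^sup>2 - ((1 + \<beta>) * s + \<delta>)\<^sup>2 = (2 * (1 + \<beta>)) * (- s\<^sup>2 / 2 + (- (s * \<delta>) - \<beta> * s\<^sup>2 / 2))"
        by (simp add: power2_eq_square algebra_simps)
      then show ?thesis using \<beta>1 by simp
    qed
    ultimately show ?thesis by (simp add: diff_divide_distrib)
  qed
  have d: "std_normal_density s * exp (- (s * \<delta>) - \<beta> * s\<^sup>2 / 2) = \<kappa> * normal_density \<mu> \<sigma> s" for s
  proof -
    have "std_normal_density s * exp (- (s * \<delta>) - \<beta> * s\<^sup>2 / 2)
      = (1 / sqrt (2 * pi)) * exp (- s\<^sup>2 / 2 + (- (s * \<delta>) - \<beta> * s\<^sup>2 / 2))"
      unfolding exp_add by (simp add: std_normal_density_def)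
    also have "\<dots> = \<kappa> * normal_density \<mu> \<sigma> s"
      unfolding e exp_add using \<beta>1
      by (simp add: \<kappa>_def normal_density_def \<sigma>2 real_sqrt_divide real_sqrt_mult)
    finally show ?thesis .
  qed
  have "(\<integral>s. cis (s * \<alpha>) * of_real (exp (- (s * \<delta>) - \<beta> * s\<^sup>2 / 2)) \<partial>std_normal_distribution)
    = (\<integral>s. std_normal_density s *\<^sub>R (cis (s * \<alpha>) * of_real (exp (- (s * \<delta>) - \<beta> * s\<^sup>2 / 2))) \<partial>lborel)"
    by (intro integral_density) auto
  also have "\<dots> = (\<integral>s. \<kappa> *\<^sub>R (normal_density \<mu> \<sigma> s *\<^sub>R cis (\<alpha> * s)) \<partial>lborel)"
  proof (intro Bochner_Integration.integral_cong refl)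
    fix s
    have "std_normal_density s *\<^sub>R (cis (s * \<alpha>) * of_real (exp (- (s * \<delta>) - \<beta> * s\<^sup>2 / 2)))
      = (std_normal_density s * exp (- (s * \<delta>) - \<beta> * s\<^sup>2 / 2)) *\<^sub>R cis (\<alpha> * s)"
      by (simp add: scaleR_conv_of_real mult_ac)
    then show "std_normal_density s *\<^sub>R (cis (s * \<alpha>) * of_real (exp (- (s * \<delta>) - \<beta> * s\<^sup>2 / 2)))
      = \<kappa> *\<^sub>R (normal_density \<mu> \<sigma> s *\<^sub>R cis (\<alpha> * s))" unfolding d by simp
  qed
  also have "\<dots> = \<kappa> *\<^sub>R (\<integral>s. normal_density \<mu> \<sigma> s *\<^sub>R cis (\<alpha> * s) \<partial>lborel)"
    by (rule integral_scaleR_right)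
  also have "(\<integral>s. normal_density \<mu> \<sigma> s *\<^sub>R cis (\<alpha> * s) \<partial>lborel) = (\<integral>s. cis (\<alpha> * s) \<partial>density lborel (normal_density \<mu> \<sigma>))"
    by (intro integral_density[symmetric]) auto
  also have "\<kappa> *\<^sub>R \<dots> = cis (\<alpha> * \<mu>) * of_real (\<kappa> * exp (- (\<sigma>\<^sup>2 * \<alpha>\<^sup>2) / 2))"
    unfolding cis_integral_normal[OF \<sigma>] by (simp add: scaleR_conv_of_real mult_ac exp_of_real[symmetric])
  also have "\<kappa> * exp (- (\<sigma>\<^sup>2 * \<alpha>\<^sup>2) / 2) = exp ((\<delta>\<^sup>2 - \<alpha>\<^sup>2) / (2 * (1 + \<beta>))) / sqrt (1 + \<beta>)"
    using \<beta>1 by (simp add: \<kappa>_def \<sigma>2 exp_add[symmetric] diff_divide_distrib mult.commute)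
  finally show ?thesis by (simp add: \<mu>_def)
qed

section \<open>Positive semidefinite matrices\<close>

lemma inner_matrix_vector: "x \<bullet> (A *v y) = (transpose A *v x) \<bullet> y" for A :: "real^'n^'m"
  by (metis dot_lmul_matrix transpose_matrix_vector)

lemma inner_sym_matrix: "transpose S = S \<Longrightarrow> x \<bullet> (S *v y) = (S *v x) \<bullet> y" for S :: "real^'n^'n"
  using inner_matrix_vector[of x S y] by simp

lemma psd_matD:
  assumes "psd_mat S"
  shows "transpose S = S" "0 \<le> u \<bullet> (S *v u)"
  using assms by (auto simp: psd_mat_def)

lemma sym_quadratic_add:
  fixes S :: "real^'n^'n"
  assumes "transpose S = S"
  shows "(u + v) \<bullet> (S *v (u + v)) = u \<bullet> (S *v u) + 2 * (u \<bullet> (S *v v)) + v \<bullet> (S *v v)"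
proof -
  have "v \<bullet> (S *v u) = u \<bullet> (S *v v)" by (metis inner_sym_matrix[OF assms] inner_commute)
  then show ?thesis by (simp add: matrix_vector_right_distrib inner_add_left inner_add_right)
qed

text \<open>The quadratic form at \<open>u + r *\<^sub>R v\<close> is a nonnegative polynomial in r
  of degree at most 2. No definiteness is assumed, so the leading coefficient may be 0.\<close>

lemma psd_Cauchy_Schwarz:
  assumes S: "psd_mat S"
  shows "(u \<bullet> (S *v v))\<^sup>2 \<le> (u \<bullet> (S *v u)) * (v \<bullet> (S *v v))"
proof -
  define a b c where "a = u \<bullet> (S *v u)" and "b = u \<bullet> (S *v v)" and "c = v \<bullet> (S *v v)"
  have q: "0 \<le> a + 2 * r * b + r\<^sup>2 * c" for r
    using psd_matD(2)[OF S, of "u + r *\<^sub>R v"] sym_quadratic_add[OF psd_matD(1)[OF S], of u "r *\<^sub>R v"]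
    by (simp add: a_def b_def c_def matrix_vector_mult_scaleR power2_eq_square mult_ac)
  have c: "c \<ge> 0" unfolding c_def by (rule psd_matD(2)[OF S])
  show ?thesis
  proof (cases "c = 0")
    case True
    have "b = 0"
    proof (rule ccontr)
      assume "b \<noteq> 0"
      \<comment> \<open>With leading coefficient 0 this r gives the polynomial the value -1.\<close>
      then show False using q[of "- (a + 1) / (2 * b)"] True by (simp add: field_simps)
    qed
    then show ?thesis using True by (simp add: b_def c_def)
  next
    case False
    then have c: "c > 0" using c by simp
    \<comment> \<open>The minimiser r = - b / c gives the discriminant inequality.\<close>
    have "0 \<le> c * (a + 2 * (- b / c) * b + (- b / c)\<^sup>2 * c)" using q[of "- b / c"] c by simp
    also have "\<dots> = a * c - b\<^sup>2" using c by (simp add: power2_eq_square field_simps)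
    finally show ?thesis by (simp add: a_def b_def c_def)
  qed
qed

definition outer :: "real^'n \<Rightarrow> real^'n^'n" where
  "outer b = (\<chi> i j. b $ i * b $ j)"

lemma outer_mult_vec: "outer b *v z = (b \<bullet> z) *\<^sub>R b"
  by (simp add: vec_eq_iff outer_def matrix_vector_mult_def inner_vec_def sum_distrib_left sum_distrib_right mult_ac)

lemma transpose_outer: "transpose (outer b) = outer b"
  by (simp add: vec_eq_iff outer_def transpose_def mult.commute)

lemma transpose_add_mat: "transpose (A + B) = transpose A + transpose (B :: real^'n^'m)"
  and transpose_diff_mat: "transpose (A - B) = transpose A - transpose (B :: real^'n^'m)"
  and transpose_scaleR_mat: "transpose (c *\<^sub>R A) = c *\<^sub>R transpose A"
  by (simp_all add: vec_eq_iff transpose_def)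

text \<open>One Cholesky step: a direction u with positive quadratic form is eliminated by
  subtracting a rank-one matrix. Cauchy-Schwarz keeps the remainder semidefinite, and its kernel is
  strictly larger because it contains the old kernel and u. No spectral decomposition is
  involved.\<close>

lemma psd_mat_rank_one_induct [consumes 1, case_names zero add]:
  fixes Y :: "real^'n^'n"
  assumes "psd_mat Y"
    and zero: "P 0" and add: "\<And>Y b. psd_mat Y \<Longrightarrow> P Y \<Longrightarrow> P (Y + outer b)"
  shows "P Y"
  using assms(1)
proof (induction "CARD('n) - dim {u. Y *v u = 0}" arbitrary: Y rule: less_induct)
  case less
  note sym = psd_matD(1)[OF less.prems] and nn = psd_matD(2)[OF less.prems]
  show ?case
  proof (cases "\<forall>u. u \<bullet> (Y *v u) = 0")
    case True
    have "u \<bullet> (Y *v v) = 0" for u v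
      using sym_quadratic_add[OF sym, of u v] True by simp
    then have "Y *v v = 0" for v by (metis inner_eq_zero_iff)
    then have "Y = 0" by (metis matrix_eq matrix_vector_mult_0)
    then show ?thesis using zero by simp
  next
    case False
    then obtain u where u: "u \<bullet> (Y *v u) > 0" using nn by (metis less_eq_real_def)
    \<comment> \<open>Scaled so that \<open>(b \<bullet> u) *\<^sub>R b = Y *v u\<close>; hence the
      remainder annihilates u.\<close>
    define b where "b = (1 / sqrt (u \<bullet> (Y *v u))) *\<^sub>R (Y *v u)"
    define Y' where "Y' = Y - outer b"
    have bz: "b \<bullet> z = (u \<bullet> (Y *v z)) / sqrt (u \<bullet> (Y *v u))" for z
      unfolding b_def inner_sym_matrix[OF sym] by simp
    have Y': "Y' *v z = Y *v z - (b \<bullet> z) *\<^sub>R b" for z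
      by (simp add: Y'_def matrix_vector_mult_diff_rdistrib outer_mult_vec)
    have psd: "psd_mat Y'"
      unfolding psd_mat_def
    proof (intro conjI allI)
      show "transpose Y' = Y'" by (simp add: Y'_def transpose_diff_mat transpose_outer sym)
      fix z
      have "(z \<bullet> b)\<^sup>2 = (u \<bullet> (Y *v z))\<^sup>2 / (u \<bullet> (Y *v u))"
        using u bz[of z] by (simp add: inner_commute power_divide)
      also have "\<dots> \<le> z \<bullet> (Y *v z)"
        using u psd_Cauchy_Schwarz[OF less.prems, of u z] by (simp add: divide_le_eq mult.commute)
      finally show "0 \<le> z \<bullet> (Y' *v z)"
        by (simp add: Y' inner_diff_right inner_commute power2_eq_square)
    qed
    have "dim {u. Y *v u = 0} < dim {u. Y' *v u = 0}"
    proof (rule ccontr)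
      assume "\<not> ?thesis"
      moreover have "{u. Y *v u = 0} \<subseteq> {u. Y' *v u = 0}" using bz Y' by auto
      moreover have sp: "subspace {u. B *v u = 0}" for B :: "real^'n^'n"
        unfolding subspace_def by (auto simp: matrix_vector_right_distrib matrix_vector_mult_scaleR)
      ultimately have "{u. Y *v u = 0} = {u. Y' *v u = 0}"
        by (intro subspace_dim_equal sp) auto
      moreover have "Y' *v u = 0"
        using u by (simp add: Y' bz) (simp add: b_def)
      ultimately have "Y *v u = 0" by auto
      then show False using u by simp
    qed
    moreover have "dim {u. Y' *v u = 0} \<le> CARD('n)"
      using dim_subset_UNIV[of "{u. Y' *v u = 0}"] by simp
    ultimately have "P Y'" by (intro less.hyps psd) auto
    then have "P (Y' + outer b)" by (rule add[OF psd])
    then show ?thesis by (simp add: Y'_def)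
  qed
qed

lemma pd_mat_inverse:
  assumes T: "pd_mat T"
  shows "T ** matrix_inv T = mat 1" "matrix_inv T ** T = mat 1" "pd_mat (matrix_inv T)"
proof -
  have "x = 0" if "T *v x = 0" for x
    using T that unfolding pd_mat_def by (metis inner_zero_right less_irrefl)
  then have "invertible T"
    unfolding invertible_left_inverse matrix_left_invertible_ker by blast
  then show r: "T ** matrix_inv T = mat 1" and l: "matrix_inv T ** T = mat 1"
    unfolding invertible_def matrix_inv_def by (metis (mono_tags, lifting) someI_ex)+
  have sym: "transpose T = T" using T by (simp add: pd_mat_def)
  have "transpose (matrix_inv T) = transpose (matrix_inv T) ** (T ** matrix_inv T)" using r by simp
  also have "\<dots> = transpose (T ** matrix_inv T) ** matrix_inv T"
    by (simp only: matrix_transpose_mul sym matrix_mul_assoc)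
  finally have s: "transpose (matrix_inv T) = matrix_inv T" unfolding r by (simp add: transpose_mat)
  show "pd_mat (matrix_inv T)"
    unfolding pd_mat_def
  proof (intro conjI allI impI s)
    fix u :: "real^'a" assume "u \<noteq> 0"
    define z where "z = matrix_inv T *v u"
    have u: "u = T *v z" unfolding z_def by (simp add: matrix_vector_mul_assoc r)
    with \<open>u \<noteq> 0\<close> have "z \<noteq> 0" by auto
    then have "0 < z \<bullet> (T *v z)" using T by (simp add: pd_mat_def)
    also have "z \<bullet> (T *v z) = u \<bullet> (matrix_inv T *v u)"
      unfolding u[symmetric] z_def[symmetric] by (rule inner_commute)
    finally show "0 < u \<bullet> (matrix_inv T *v u)" .
  qed
qed

lemma pd_mat_inverse_vector:
  assumes "pd_mat T"
  shows "T *v (matrix_inv T *v z) = z" "matrix_inv T *v (T *v z) = z"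
  using pd_mat_inverse[OF assms] by (simp_all add: matrix_vector_mul_assoc)

lemma pd_mat_sym: "pd_mat T \<Longrightarrow> transpose T = T"
  by (simp add: pd_mat_def)

lemma pd_imp_psd: "pd_mat T \<Longrightarrow> psd_mat T"
  unfolding pd_mat_def psd_mat_def by (metis inner_zero_left less_eq_real_def)

section \<open>Quadratic exponential tilting\<close>

text \<open>Plays two roles: the characteristic function of a centered Gaussian with covariance
  \<open>S\<close>, and, with \<open>S = Y\<close>, the probability of \<epsilon> = 0 given the
  measurement t.\<close>

abbreviation quad_exp :: "real^'n^'n \<Rightarrow> real^'n \<Rightarrow> real" where
  "quad_exp S t \<equiv> exp (- (t \<bullet> (S *v t)) / 2)"

abbreviation gauss_cf :: "real^'n \<Rightarrow> real^'n \<Rightarrow> real^'n^'n \<Rightarrow> complex" where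
  "gauss_cf t m S \<equiv> cis (t \<bullet> m) * of_real (quad_exp S t)"

lemma borel_measurable_matrix_vector [measurable (raw)]:
  fixes A :: "real^'n^'m"
  assumes "X \<in> borel_measurable M"
  shows "(\<lambda>x. A *v X x) \<in> borel_measurable M"
  by (intro measurable_compose[OF assms] borel_measurable_continuous_onI linear_continuous_on
      matrix_vector_mul_bounded_linear)

lemma exp_psd_le_1: "psd_mat S \<Longrightarrow> quad_exp S t \<le> 1"
  by (simp add: psd_matD(2))

text \<open>Induction over rank-one summands of \<open>Y\<close>: each factor \<open>exp (- (b \<bullet> y)\<^sup>2 / 2)\<close> is the average of
  \<open>cis (s * (b \<bullet> y))\<close> over a standard normal \<open>s\<close>.\<close>

lemma (in prob_space) cond_null_exp_quadratic_tilt_aux: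
  fixes y c :: "'a \<Rightarrow> real^'m"
  assumes sub: "subalgebra M F" and y[measurable]: "y \<in> borel_measurable M"
    and c: "c \<in> borel_measurable F" and T: "pd_mat T"
    and U: "U \<in> borel_measurable F" and U1: "\<And>x. norm (U x) \<le> 1"
    and base: "\<And>t. cond_null M F (\<lambda>x. U x * (cis (t \<bullet> y x) - gauss_cf t (c x) T))"
    and Y: "psd_mat Y"
  shows "\<exists>B \<gamma>. psd_mat B \<and> (\<forall>z. B *v ((matrix_inv T + Y) *v z) = z) \<and>
    \<gamma> \<in> borel_measurable F \<and> (\<forall>x. 0 \<le> \<gamma> x \<and> \<gamma> x \<le> (1::real)) \<and>
    (\<forall>t. cond_null M F (\<lambda>x. U x * (cis (t \<bullet> y x) * of_real (quad_exp Y (y x))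
      - cis (t \<bullet> (B *v (matrix_inv T *v c x))) * of_real (quad_exp B t * \<gamma> x))))"
  using Y
proof (induction rule: psd_mat_rank_one_induct)
  case zero
  show ?case
    using base pd_imp_psd[OF T] pd_mat_inverse[OF T]
    by (intro exI[of _ T] exI[of _ "\<lambda>_. 1"]) (simp add: matrix_vector_mul_assoc)
next
  case (add Y b)
  \<comment> \<open>\<open>B\<close> is the inverse of \<open>matrix_inv T + Y\<close>, the
    covariance of the tilted law. Frequency t = 0 shows that \<gamma> is the conditional mass of the
    weight wherever \<open>U\<close> does not vanish.\<close>
  then obtain B \<gamma> where B: "psd_mat B" and inv: "\<And>z. B *v ((matrix_inv T + Y) *v z) = z"
    and \<gamma>: "\<gamma> \<in> borel_measurable F" and \<gamma>1: "\<And>x. 0 \<le> \<gamma> x \<and> \<gamma> x \<le> 1"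
    and null: "\<And>t. cond_null M F (\<lambda>x. U x * (cis (t \<bullet> y x) * of_real (quad_exp Y (y x))
      - cis (t \<bullet> (B *v (matrix_inv T *v c x))) * of_real (quad_exp B t * \<gamma> x)))"
    by blast
  note Bsym = psd_matD(1)[OF B]
  define a where "a x = B *v (matrix_inv T *v c x)" for x
  define \<beta> where "\<beta> = b \<bullet> (B *v b)"
  have \<beta>: "0 \<le> \<beta>" unfolding \<beta>_def by (rule psd_matD(2)[OF B])
  then have \<beta>1: "1 + \<beta> > 0" by simp
  \<comment> \<open>The Sherman-Morrison formula for adding \<open>outer b\<close> to the inverse of
    \<open>B\<close>.\<close>
  define B' where "B' = B - (1 / (1 + \<beta>)) *\<^sub>R outer (B *v b)"
  have B': "B' *v z = B *v z - ((b \<bullet> (B *v z)) / (1 + \<beta>)) *\<^sub>R (B *v b)" for z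
    unfolding B'_def matrix_vector_mult_diff_rdistrib inner_sym_matrix[OF Bsym]
    by (simp add: outer_mult_vec scaleR_matrix_vector_assoc[symmetric])
  \<comment> \<open>The new factor is the expectation of exp (- G^2 / 2) for a normal variable G
    with mean \<open>b \<bullet> a x\<close> and variance \<beta>.\<close>
  define \<gamma>' where "\<gamma>' x = exp (- (b \<bullet> a x)\<^sup>2 / (2 * (1 + \<beta>))) / sqrt (1 + \<beta>) * \<gamma> x" for x
  have aF: "a \<in> borel_measurable F" unfolding a_def using c by measurable
  have [measurable]: "a \<in> borel_measurable M" "\<gamma> \<in> borel_measurable M" "U \<in> borel_measurable M"
    using aF \<gamma> U by (auto intro: measurable_from_subalg[OF sub])
  show ?case
  proof (intro exI[of _ B'] exI[of _ \<gamma>'] conjI allI)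
    show "psd_mat B'"
      unfolding psd_mat_def
    proof (intro conjI allI)
      show "transpose B' = B'"
        by (simp add: B'_def transpose_diff_mat transpose_scaleR_mat transpose_outer Bsym)
      fix u
      have "(u \<bullet> (B *v b))\<^sup>2 \<le> (u \<bullet> (B *v u)) * \<beta>"
        unfolding \<beta>_def by (rule psd_Cauchy_Schwarz[OF B])
      also have "\<dots> \<le> (u \<bullet> (B *v u)) * (1 + \<beta>)"
        by (intro mult_left_mono psd_matD(2)[OF B]) simp
      finally have "(u \<bullet> (B *v b))\<^sup>2 / (1 + \<beta>) \<le> u \<bullet> (B *v u)"
        using \<beta>1 by (simp add: divide_le_eq)
      moreover have "b \<bullet> (B *v u) = u \<bullet> (B *v b)" by (metis inner_sym_matrix[OF Bsym] inner_commute)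
      ultimately show "0 \<le> u \<bullet> (B' *v u)" by (simp add: B' inner_diff_right power2_eq_square)
    qed
    fix z
    define w where "w = (matrix_inv T + Y) *v z"
    have Bw: "B *v w = z" unfolding w_def by (rule inv)
    have "(matrix_inv T + (Y + outer b)) *v z = w + (b \<bullet> z) *\<^sub>R b"
      by (simp add: w_def add.assoc[symmetric] matrix_vector_mult_add_rdistrib outer_mult_vec)
    moreover have "B' *v (w + (b \<bullet> z) *\<^sub>R b) = z + (b \<bullet> z) *\<^sub>R (B *v b)
       - ((b \<bullet> z + (b \<bullet> z) * \<beta>) / (1 + \<beta>)) *\<^sub>R (B *v b)"
      unfolding B'[of "w + (b \<bullet> z) *\<^sub>R b"]
      by (simp add: matrix_vector_right_distrib matrix_vector_mult_scaleR Bw inner_add_right \<beta>_def)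
    moreover have "(b \<bullet> z + (b \<bullet> z) * \<beta>) / (1 + \<beta>) = b \<bullet> z"
      using \<beta>1 by (simp add: field_simps)
    ultimately show "B' *v ((matrix_inv T + (Y + outer b)) *v z) = z" by simp
  next
    show "\<gamma>' \<in> borel_measurable F" unfolding \<gamma>'_def using aF \<gamma> by measurable
    fix x
    show "0 \<le> \<gamma>' x" unfolding \<gamma>'_def using \<gamma>1 \<beta>1 by simp
    have "exp (- (b \<bullet> a x)\<^sup>2 / (2 * (1 + \<beta>))) / sqrt (1 + \<beta>) \<le> 1 / 1"
      using \<beta> by (intro frac_le) auto
    then show "\<gamma>' x \<le> 1" unfolding \<gamma>'_def using \<gamma>1 \<beta>1 by (intro mult_le_one) auto
  next
    fix t
    define \<delta> where "\<delta> = t \<bullet> (B *v b)"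
    \<comment> \<open>The induction hypothesis at the shifted frequency
      \<open>t + s *\<^sub>R b\<close>. Averaging over a standard normal s multiplies its first term
      by the weight of \<open>outer b\<close>.\<close>
    define f where "f s x = U x * (cis ((t + s *\<^sub>R b) \<bullet> y x) * of_real (quad_exp Y (y x))
      - cis ((t + s *\<^sub>R b) \<bullet> a x) * of_real (quad_exp B (t + s *\<^sub>R b) * \<gamma> x))" for s x
    have N: "prob_space std_normal_distribution"
      by (rule real_distribution.axioms(1)) (rule real_dist_normal_dist)
    interpret N: prob_space std_normal_distribution by (rule N)
    have "cond_null M F (\<lambda>x. \<integral>s. f s x \<partial>std_normal_distribution)"
    proof (rule cond_null_mixture[OF sub N])
      show "(\<lambda>(s, x). f s x) \<in> borel_measurable (std_normal_distribution \<Otimes>\<^sub>M M)"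
        unfolding f_def by measurable
      show "cond_null M F (f s)" for s
        unfolding f_def a_def by (rule null)
      fix s x
      have "norm (f s x) \<le> 1 * (1 * 1 + 1 * (1 * 1))"
        unfolding f_def norm_mult
        using U1[of x] \<gamma>1[of x] exp_psd_le_1[OF add.hyps, of "y x"] exp_psd_le_1[OF B, of "t + s *\<^sub>R b"]
        by (intro mult_mono norm_triangle_le_diff add_mono) (auto simp: norm_mult intro!: add_mono mult_mono mult_le_one)
      then show "norm (f s x) \<le> 2" by simp
    qed
    then show "cond_null M F (\<lambda>x. U x * (cis (t \<bullet> y x) * of_real (quad_exp (Y + outer b) (y x))
      - cis (t \<bullet> (B' *v (matrix_inv T *v c x))) * of_real (quad_exp B' t * \<gamma>' x)))"
    proof (rule cond_null_cong)
      fix x assume "x \<in> space M"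
      define \<alpha> where "\<alpha> = b \<bullet> a x"
      define q where "q = quad_exp Y (y x)"
      define e where "e = quad_exp B t"
      have quad: "(t + s *\<^sub>R b) \<bullet> (B *v (t + s *\<^sub>R b)) = t \<bullet> (B *v t) + 2 * s * \<delta> + s\<^sup>2 * \<beta>" for s
        unfolding sym_quadratic_add[OF Bsym] \<delta>_def \<beta>_def
        by (simp add: matrix_vector_mult_scaleR power2_eq_square)
      have fs: "f s x = U x * (cis (t \<bullet> y x) * q) * cis (s * (b \<bullet> y x))
        - U x * (cis (t \<bullet> a x) * (e * \<gamma> x)) * (cis (s * \<alpha>) * of_real (exp (- (s * \<delta>) - \<beta> * s\<^sup>2 / 2)))" for s
      proof -
        have "quad_exp B (t + s *\<^sub>R b) = e * exp (- (s * \<delta>) - \<beta> * s\<^sup>2 / 2)"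
          unfolding quad e_def exp_add[symmetric] by (simp add: field_simps)
        then show ?thesis
          unfolding f_def q_def[symmetric] \<alpha>_def inner_add_left cis_mult[symmetric]
          by (simp add: algebra_simps)
      qed
      have i1: "integrable std_normal_distribution (\<lambda>s. cis (s * r))" for r
        by (rule N.integrable_const_bound[where B = 1]) auto
      have i2: "integrable std_normal_distribution (\<lambda>s. cis (s * \<alpha>) * of_real (exp (- (s * \<delta>) - \<beta> * s\<^sup>2 / 2)))"
      proof (rule N.integrable_const_bound[where B = "1 / e"])
        \<comment> \<open>The linear term alone would be unbounded in s; multiplied by
          \<open>e\<close> the expression is a Gaussian characteristic function again, hence at most
          1.\<close>
        have "exp (- (s * \<delta>) - \<beta> * s\<^sup>2 / 2) \<le> 1 / e" for s
        proof -
          have "e * exp (- (s * \<delta>) - \<beta> * s\<^sup>2 / 2) = quad_exp B (t + s *\<^sub>R b)"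
            unfolding quad e_def exp_add[symmetric] by (simp add: field_simps)
          also have "\<dots> \<le> 1" by (rule exp_psd_le_1[OF B])
          finally show ?thesis by (simp add: e_def field_simps)
        qed
        then show "AE s in std_normal_distribution. norm (cis (s * \<alpha>) * of_real (exp (- (s * \<delta>) - \<beta> * s\<^sup>2 / 2))) \<le> 1 / e"
          by (simp add: norm_mult)
      qed measurable
      have "(\<integral>s. f s x \<partial>std_normal_distribution)
        = U x * (cis (t \<bullet> y x) * q) * (\<integral>s. cis (s * (b \<bullet> y x)) \<partial>std_normal_distribution)
        - U x * (cis (t \<bullet> a x) * (e * \<gamma> x)) * (\<integral>s. cis (s * \<alpha>) * of_real (exp (- (s * \<delta>) - \<beta> * s\<^sup>2 / 2)) \<partial>std_normal_distribution)"
        unfolding fs using i1 i2 by (subst Bochner_Integration.integral_diff) auto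
      also have "\<dots> = U x * (cis (t \<bullet> y x) * q) * exp (- (b \<bullet> y x)\<^sup>2 / 2)
        - U x * (cis (t \<bullet> a x) * (e * \<gamma> x)) *
          (cis (- (\<alpha> * \<delta> / (1 + \<beta>))) * of_real (exp ((\<delta>\<^sup>2 - \<alpha>\<^sup>2) / (2 * (1 + \<beta>))) / sqrt (1 + \<beta>)))"
        unfolding cis_integral_std_normal cis_exp_quadratic_integral_std_normal[OF \<beta>] ..
      also have "\<dots> = U x * (cis (t \<bullet> y x) * of_real (q * exp (- (b \<bullet> y x)\<^sup>2 / 2))
         - (cis (t \<bullet> a x) * cis (- (\<alpha> * \<delta> / (1 + \<beta>)))) *
          of_real (e * exp ((\<delta>\<^sup>2 - \<alpha>\<^sup>2) / (2 * (1 + \<beta>))) / sqrt (1 + \<beta>) * \<gamma> x))"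
        by (simp add: algebra_simps)
      also have "q * exp (- (b \<bullet> y x)\<^sup>2 / 2) = quad_exp (Y + outer b) (y x)"
        unfolding q_def exp_add[symmetric]
        by (simp add: matrix_vector_mult_add_rdistrib outer_mult_vec inner_add_right inner_commute power2_eq_square add_divide_distrib)
      also have "cis (t \<bullet> a x) * cis (- (\<alpha> * \<delta> / (1 + \<beta>))) = cis (t \<bullet> (B' *v (matrix_inv T *v c x)))"
        unfolding cis_mult B' a_def[symmetric] \<alpha>_def \<delta>_def by (simp add: inner_diff_right)
      also have "e * exp ((\<delta>\<^sup>2 - \<alpha>\<^sup>2) / (2 * (1 + \<beta>))) / sqrt (1 + \<beta>) * \<gamma> x = quad_exp B' t * \<gamma>' x"
      proof -
        have "b \<bullet> (B *v t) = \<delta>" unfolding \<delta>_def by (metis inner_sym_matrix[OF Bsym] inner_commute)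
        then have "t \<bullet> (B' *v t) = t \<bullet> (B *v t) - \<delta>\<^sup>2 / (1 + \<beta>)"
          by (simp add: B' inner_diff_right power2_eq_square \<delta>_def)
        then have "- (t \<bullet> (B *v t)) / 2 + (\<delta>\<^sup>2 - \<alpha>\<^sup>2) / (2 * (1 + \<beta>)) = - (t \<bullet> (B' *v t)) / 2 + - \<alpha>\<^sup>2 / (2 * (1 + \<beta>))"
          by (simp add: diff_divide_distrib mult.commute)
        then have "e * exp ((\<delta>\<^sup>2 - \<alpha>\<^sup>2) / (2 * (1 + \<beta>))) = quad_exp B' t * exp (- \<alpha>\<^sup>2 / (2 * (1 + \<beta>)))"
          unfolding e_def exp_add[symmetric] by simp
        then show ?thesis unfolding \<gamma>'_def \<alpha>_def[symmetric] by simp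
      qed
      finally show "(\<integral>s. f s x \<partial>std_normal_distribution)
        = U x * (cis (t \<bullet> y x) * of_real (quad_exp (Y + outer b) (y x))
          - cis (t \<bullet> (B' *v (matrix_inv T *v c x))) * of_real (quad_exp B' t * \<gamma>' x))" .
    qed
  qed
qed

lemma pd_mat_add: "psd_mat S \<Longrightarrow> pd_mat T \<Longrightarrow> pd_mat (S + T)"
  unfolding psd_mat_def pd_mat_def
  by (auto simp: transpose_add_mat matrix_vector_mult_add_rdistrib inner_add_right intro: add_nonneg_pos)

text \<open>The normaliser \<gamma> is eliminated by subtracting the statement at frequency 0,
  multiplied by the tilted characteristic function at t, which is \<open>F\<close>-measurable. The
  Woodbury identity rewrites mean and covariance through \<open>S\<close>, in which
  \<open>matrix_inv Y\<close> appears as additional noise covariance.\<close>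

lemma (in prob_space) cond_null_exp_quadratic_tilt:
  fixes y c :: "'a \<Rightarrow> real^'m"
  assumes sub: "subalgebra M F" and y: "y \<in> borel_measurable M"
    and c: "c \<in> borel_measurable F" and T: "pd_mat T"
    and U: "U \<in> borel_measurable F" and U1: "\<And>x. norm (U x) \<le> 1"
    and base: "\<And>t. cond_null M F (\<lambda>x. U x * (cis (t \<bullet> y x) - gauss_cf t (c x) T))"
    and Y: "pd_mat Y"
  defines "S \<equiv> T + matrix_inv Y"
  shows "cond_null M F (\<lambda>x. U x * (of_real (quad_exp Y (y x)) *
     (cis (t \<bullet> y x) - cis (t \<bullet> (c x - T *v (matrix_inv S *v c x))) *
        of_real (exp (- (t \<bullet> (T *v t - T *v (matrix_inv S *v (T *v t)))) / 2)))))"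
proof -
  obtain B \<gamma> where B: "psd_mat B" and inv: "\<And>z. B *v ((matrix_inv T + Y) *v z) = z"
    and \<gamma>: "\<gamma> \<in> borel_measurable F" and \<gamma>1: "\<And>x. 0 \<le> \<gamma> x \<and> \<gamma> x \<le> (1::real)"
    and null: "\<And>t. cond_null M F (\<lambda>x. U x * (cis (t \<bullet> y x) * of_real (quad_exp Y (y x))
      - cis (t \<bullet> (B *v (matrix_inv T *v c x))) * of_real (quad_exp B t * \<gamma> x)))"
    using cond_null_exp_quadratic_tilt_aux[OF sub y c T U U1 base pd_imp_psd[OF Y]] by blast
  have S: "pd_mat S" unfolding S_def
    by (rule pd_mat_add[OF pd_imp_psd[OF T] pd_mat_inverse(3)[OF Y]])
  note TI = pd_mat_inverse_vector[OF T] and SI = pd_mat_inverse_vector(1)[OF S] and YI = pd_mat_inverse_vector(1)[OF Y]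
  \<comment> \<open>Woodbury identity, checked by applying \<open>matrix_inv T + Y\<close> to the
    right-hand side and cancelling with its left inverse \<open>B\<close>.\<close>
  have Bw: "B *v w = T *v w - T *v (matrix_inv S *v (T *v w))" for w
  proof -
    define h where "h = matrix_inv S *v (T *v w)"
    have "T *v w = T *v h + matrix_inv Y *v h"
      using SI[of "T *v w"] unfolding h_def[symmetric] by (simp add: S_def matrix_vector_mult_add_rdistrib)
    then have z: "T *v w - T *v h = matrix_inv Y *v h" by simp
    have "(matrix_inv T + Y) *v (T *v w - T *v h) = matrix_inv T *v (T *v (w - h)) + Y *v (matrix_inv Y *v h)"
      unfolding matrix_vector_mult_add_rdistrib z[symmetric] by (simp add: matrix_vector_mult_diff_distrib)
    also have "\<dots> = w" by (simp add: TI YI)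
    finally show ?thesis using inv[of "T *v w - T *v h"] unfolding h_def by simp
  qed
  define a where "a x = c x - T *v (matrix_inv S *v c x)" for x
  have Ba: "B *v (matrix_inv T *v c x) = a x" for x
    unfolding Bw TI a_def ..
  have aF: "a \<in> borel_measurable F" unfolding a_def using c by measurable
  define e where "e = quad_exp B t"
  \<comment> \<open>At frequency 0 only the weight and \<gamma> remain, so this term trades \<gamma>
    for the weight.\<close>
  have "cond_null M F (\<lambda>x. (cis (t \<bullet> a x) * of_real e) * (U x * (cis (0 \<bullet> y x) * of_real (quad_exp Y (y x))
      - cis (0 \<bullet> a x) * of_real (quad_exp B 0 * \<gamma> x))))"
  proof (rule cond_null_mult[OF sub null[of 0, unfolded Ba]])
    show "(\<lambda>x. cis (t \<bullet> a x) * of_real e) \<in> borel_measurable F" using aF by measurable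
    show "norm (cis (t \<bullet> a x) * of_real e) \<le> 1" for x
      using exp_psd_le_1[OF B, of t] by (simp add: norm_mult e_def)
  qed
  from cond_null_diff[OF sub null[of t, unfolded Ba, folded e_def] this]
  show ?thesis
    by (rule cond_null_cong) (simp add: a_def[symmetric] Bw[symmetric] e_def algebra_simps)
qed

section \<open>Conditionally Gaussian vectors\<close>

definition cond_gauss ::
  "'a measure \<Rightarrow> 'a measure \<Rightarrow> ('a \<Rightarrow> real^'n) \<Rightarrow> ('a \<Rightarrow> real^'n) \<Rightarrow> ('a \<Rightarrow> real^'n^'n) \<Rightarrow> bool" where
  "cond_gauss M F X m P \<longleftrightarrow> X \<in> borel_measurable M \<and> m \<in> borel_measurable F \<and>
    simple_function F P \<and> (\<forall>x\<in>space M. psd_mat (P x)) \<and>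
    (\<forall>u. cond_null M F (\<lambda>x. cis (u \<bullet> X x) - gauss_cf u (m x) (P x)))"

lemma cond_gaussD:
  assumes "cond_gauss M F X m P"
  shows "X \<in> borel_measurable M" "m \<in> borel_measurable F" "simple_function F P"
    "\<And>x. x \<in> space M \<Longrightarrow> psd_mat (P x)"
    "cond_null M F (\<lambda>x. cis (u \<bullet> X x) - gauss_cf u (m x) (P x))"
  using assms unfolding cond_gauss_def by blast+

lemma (in prob_space) integrable_simple_function_subalg:
  assumes sub: "subalgebra M F" and g: "simple_function F g"
  shows "integrable M (g :: 'a \<Rightarrow> real)"
proof (rule integrable_const_bound)
  have sp: "space F = space M" using sub by (simp add: subalgebra_def)
  have fin: "finite (g ` space M)" using g by (simp add: simple_function_def sp)
  show "AE x in M. norm (g x) \<le> Max ((\<lambda>r. \<bar>r\<bar>) ` g ` space M)"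
    using fin by (intro AE_I2) (auto intro!: Max_ge)
  show "g \<in> borel_measurable M"
    using g by (intro measurable_from_subalg[OF sub] borel_measurable_simple_function)
qed

section \<open>Conditional moments from the characteristic function\<close>

lemma cond_null_cos_sin:
  assumes sub: "subalgebra M F" and null: "cond_null M F (\<lambda>x. cis (r x) - of_real (g x))" and A: "A \<in> sets F"
  shows "(\<integral>x. indicator A x * (cos (r x) - g x) \<partial>M) = 0" "(\<integral>x. indicator A x * sin (r x) \<partial>M) = 0"
proof -
  have AM: "A \<in> sets M" using A sub by (auto simp: subalgebra_def)
  have i: "integrable M (\<lambda>x. indicator A x *\<^sub>R (cis (r x) - of_real (g x)))"
    by (intro integrable_mult_indicator AM cond_null_integrable[OF null])
  have z: "(\<integral>x. indicator A x *\<^sub>R (cis (r x) - of_real (g x)) \<partial>M) = 0"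
    using cond_null_set_integral[OF sub null A] by (simp add: set_lebesgue_integral_def)
  show "(\<integral>x. indicator A x * (cos (r x) - g x) \<partial>M) = 0"
    using integral_Re[OF i] unfolding z by simp
  show "(\<integral>x. indicator A x * sin (r x) \<partial>M) = 0"
    using integral_Im[OF i] unfolding z by simp
qed

text \<open>Half-angle formula: written as a square, the quotient is visibly nonnegative, and
  \<open>abs_mult_sin_divide_le\<close> bounds it by r^2.\<close>

lemma two_mult_one_minus_cos: "2 * N\<^sup>2 * (1 - cos (r / N)) = (2 * N * sin (r / (2 * N)))\<^sup>2" for r N :: real
proof -
  have "cos (r / N) = 1 - 2 * (sin (r / (2 * N)))\<^sup>2"
    using cos_double_sin[of "r / (2 * N)"] by simp
  then show ?thesis by (simp add: power_mult_distrib)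
qed

lemma abs_mult_sin_divide_le: "N > 0 \<Longrightarrow> \<bar>N * sin (r / N)\<bar> \<le> \<bar>r\<bar>" for N r :: real
  using abs_sin_x_le_abs_x[of "r / N"] by (simp add: abs_mult field_simps)

lemma tendsto_mult_sin_divide: "(\<lambda>n. real (Suc n) * sin (r / real (Suc n))) \<longlonglongrightarrow> r"
proof (cases "r = 0")
  case False
  then show ?thesis by real_asymp
qed simp

lemma tendsto_two_mult_sin_divide: "(\<lambda>n. 2 * real (Suc n) * sin (r / (2 * real (Suc n)))) \<longlonglongrightarrow> r"
proof (cases "r = 0")
  case False
  then show ?thesis by real_asymp
qed simp

lemma tendsto_one_minus_exp_divide: "(\<lambda>n. 2 * (real (Suc n))\<^sup>2 * (1 - exp (- (h / (real (Suc n))\<^sup>2) / 2))) \<longlonglongrightarrow> h"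
  by real_asymp

text \<open>Since \<open>2 n\<^sup>2 (1 - cos (r / n))\<close> tends to \<open>r\<^sup>2\<close>, Fatou's lemma gives integrability of the squared error;
  dominated convergence then identifies the moments.\<close>

lemma (in prob_space)
  fixes X m :: "'a \<Rightarrow> real^'n"
  assumes sub: "subalgebra M F" and G: "cond_gauss M F X m P"
  shows cond_gauss_error_square_integrable: "integrable M (\<lambda>x. (u \<bullet> (X x - m x))\<^sup>2)"
    and cond_gauss_error_mean: "A \<in> sets F \<Longrightarrow> (\<integral>x. indicator A x * (u \<bullet> (X x - m x)) \<partial>M) = 0"
    and cond_gauss_error_variance: "A \<in> sets F \<Longrightarrow>
      (\<integral>x. indicator A x * (u \<bullet> (X x - m x))\<^sup>2 \<partial>M) = (\<integral>x. indicator A x * (u \<bullet> (P x *v u)) \<partial>M)"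
proof -
  note [measurable] = cond_gaussD(1)[OF G] measurable_from_subalg[OF sub cond_gaussD(2)[OF G]]
  define r where "r x = u \<bullet> (X x - m x)" for x
  define h where "h x = u \<bullet> (P x *v u)" for x
  have [measurable]: "r \<in> borel_measurable M" unfolding r_def by measurable
  have hsf: "simple_function F h" unfolding h_def
    by (rule simple_function_compose1[OF cond_gaussD(3)[OF G]])
  have hint: "integrable M h" by (rule integrable_simple_function_subalg[OF sub hsf])
  then have [measurable]: "h \<in> borel_measurable M" by auto
  have h0: "0 \<le> h x" if "x \<in> space M" for x
    unfolding h_def using psd_matD(2)[OF cond_gaussD(4)[OF G that]] .
  define N where "N n = real (Suc n)" for n
  have N: "N n > 0" for n by (simp add: N_def)
  have null: "cond_null M F (\<lambda>x. cis (r x / N n) - of_real (exp (- (h x / (N n)\<^sup>2) / 2)))" for n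
  proof -
    \<comment> \<open>A small frequency in direction u; the \<open>F\<close>-measurable factor
      \<open>cis (- (v \<bullet> m x))\<close> recentres \<open>X\<close> at
      \<open>m\<close>.\<close>
    define v where "v = (1 / N n) *\<^sub>R u"
    have "cond_null M F (\<lambda>x. cis (- (v \<bullet> m x)) * (cis (v \<bullet> X x) - gauss_cf v (m x) (P x)))"
      by (rule cond_null_mult[OF sub cond_gaussD(5)[OF G], where c = 1]) (use cond_gaussD(2)[OF G] in \<open>auto simp: measurable_compose\<close>)
    then show ?thesis
    proof (rule cond_null_cong)
      fix x
      have 1: "cis (- (v \<bullet> m x)) * cis (v \<bullet> X x) = cis (r x / N n)"
        by (simp add: cis_mult r_def v_def inner_diff_right diff_divide_distrib)
      have 2: "cis (- (v \<bullet> m x)) * cis (v \<bullet> m x) = 1" by (simp add: cis_mult)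
      have 3: "v \<bullet> (P x *v v) = h x / (N n)\<^sup>2"
        by (simp add: v_def h_def matrix_vector_mult_scaleR power2_eq_square)
      show "cis (- (v \<bullet> m x)) * (cis (v \<bullet> X x) - gauss_cf v (m x) (P x))
        = cis (r x / N n) - of_real (exp (- (h x / (N n)\<^sup>2) / 2))"
        unfolding right_diff_distrib mult.assoc[symmetric] 1 2 3 by simp
    qed
  qed
  \<comment> \<open>\<open>S n\<close> and \<open>E n\<close> are scaled second-order differences at
    frequency 0 of the two sides of \<open>null\<close>; they have the same integral over every set
    of \<open>F\<close>.\<close>
  define S where "S n x = (2 * N n * sin (r x / (2 * N n)))\<^sup>2" for n x
  define E where "E n x = 2 * (N n)\<^sup>2 * (1 - exp (- (h x / (N n)\<^sup>2) / 2))" for n x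
  have [measurable]: "S n \<in> borel_measurable M" "E n \<in> borel_measurable M" for n
    unfolding S_def E_def by measurable
  have E0: "0 \<le> E n x" and Eh: "E n x \<le> h x" if "x \<in> space M" for n x
  proof -
    show "0 \<le> E n x" unfolding E_def using h0[OF that] by simp
    \<comment> \<open>The bound by \<open>h\<close> is uniform in n; it makes the limit in Fatou's
      lemma finite and dominates \<open>E n\<close>.\<close>
    have "1 - exp (- (h x / (N n)\<^sup>2) / 2) \<le> (h x / (N n)\<^sup>2) / 2"
      using exp_ge_add_one_self[of "- (h x / (N n)\<^sup>2) / 2"] by simp
    from mult_left_mono[OF this, of "2 * (N n)\<^sup>2"] show "E n x \<le> h x"
      unfolding E_def using N[of n] by simp
  qed
  have Eint: "integrable M (E n)" for n
    by (rule Bochner_Integration.integrable_bound[OF hint]) (use E0 Eh h0 in auto)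
  have Sint: "integrable M (S n)" for n
  proof (rule integrable_const_bound[where B = "(2 * N n)\<^sup>2"])
    show "AE x in M. norm (S n x) \<le> (2 * N n)\<^sup>2"
      unfolding S_def by (auto simp: power_mult_distrib abs_square_le_1 intro!: mult_left_le)
  qed simp
  have SE: "(\<integral>x. indicator A x * S n x \<partial>M) = (\<integral>x. indicator A x * E n x \<partial>M)" if "A \<in> sets F" for A n
  proof -
    have AM: "A \<in> sets M" using that sub by (auto simp: subalgebra_def)
    have "indicator A x * S n x - indicator A x * E n x
      = - (2 * (N n)\<^sup>2) * (indicator A x * (cos (r x / N n) - exp (- (h x / (N n)\<^sup>2) / 2)))" for x
      unfolding S_def E_def two_mult_one_minus_cos[symmetric] by (simp add: algebra_simps)
    then have "(\<integral>x. indicator A x * S n x - indicator A x * E n x \<partial>M) = 0"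
      using cond_null_cos_sin(1)[OF sub null that, of n] by simp
    then show ?thesis
      using integrable_real_mult_indicator[OF AM Sint[of n]] integrable_real_mult_indicator[OF AM Eint[of n]]
      by (simp add: mult.commute)
  qed
  have Slim: "(\<lambda>n. S n x) \<longlonglongrightarrow> (r x)\<^sup>2" for x
    unfolding S_def N_def by (intro tendsto_power tendsto_two_mult_sin_divide)
  have Elim: "(\<lambda>n. E n x) \<longlonglongrightarrow> h x" for x
    unfolding E_def N_def by (rule tendsto_one_minus_exp_divide)
  have spF: "space M \<in> sets F" using sub sets.top[of F] by (simp add: subalgebra_def)
  have r2: "integrable M (\<lambda>x. (r x)\<^sup>2)"
  proof (rule integrableI_nonneg)
    have "(\<integral>\<^sup>+x. ennreal ((r x)\<^sup>2) \<partial>M) = (\<integral>\<^sup>+x. liminf (\<lambda>n. ennreal (S n x)) \<partial>M)"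
      by (intro nn_integral_cong lim_imp_Liminf[symmetric] tendsto_ennrealI Slim) simp
    also have "\<dots> \<le> liminf (\<lambda>n. \<integral>\<^sup>+x. ennreal (S n x) \<partial>M)"
      by (rule nn_integral_liminf) simp
    also have "\<dots> \<le> ennreal (\<integral>x. h x \<partial>M)"
    proof (rule Liminf_le[OF sequentially_bot always_eventually], rule allI)
      fix n
      have "(\<integral>\<^sup>+x. ennreal (S n x) \<partial>M) = ennreal (\<integral>x. S n x \<partial>M)"
        by (rule nn_integral_eq_integral[OF Sint]) (simp add: S_def)
      also have "(\<integral>x. S n x \<partial>M) = (\<integral>x. E n x \<partial>M)"
        using SE[OF spF, of n] by (simp cong: Bochner_Integration.integral_cong)
      also have "\<dots> \<le> (\<integral>x. h x \<partial>M)"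
        by (rule integral_mono[OF Eint hint Eh])
      finally show "(\<integral>\<^sup>+x. ennreal (S n x) \<partial>M) \<le> ennreal (\<integral>x. h x \<partial>M)" by (simp add: ennreal_leI)
    qed
    finally show "(\<integral>\<^sup>+x. ennreal ((r x)\<^sup>2) \<partial>M) < \<infinity>" by (simp add: le_less_trans)
  qed auto
  then show "integrable M (\<lambda>x. (u \<bullet> (X x - m x))\<^sup>2)" unfolding r_def .
  have rint: "integrable M r" using r2 by (rule square_integrable_imp_integrable[rotated]) simp
  assume A: "A \<in> sets F"
  then have AM[measurable]: "A \<in> sets M" using sub by (auto simp: subalgebra_def)
  \<comment> \<open>The first moment comes from the imaginary part: the recentred characteristic
    function is real, so every sine integral is 0.\<close>
  have "(\<lambda>n. \<integral>x. indicator A x * (N n * sin (r x / N n)) \<partial>M) \<longlonglongrightarrow> (\<integral>x. indicator A x * r x \<partial>M)"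
  proof (rule integral_dominated_convergence[where w = "\<lambda>x. \<bar>r x\<bar>"])
    show "AE x in M. (\<lambda>n. indicator A x * (N n * sin (r x / N n))) \<longlonglongrightarrow> indicator A x * r x"
      unfolding N_def by (intro AE_I2 tendsto_mult_left tendsto_mult_sin_divide)
    show "AE x in M. norm (indicator A x * (N n * sin (r x / N n))) \<le> \<bar>r x\<bar>" for n
      using abs_mult_sin_divide_le[OF N] by (auto simp: indicator_def abs_mult)
  qed (use rint in auto)
  moreover have "(\<integral>x. indicator A x * (N n * sin (r x / N n)) \<partial>M) = 0" for n
  proof -
    have "(\<integral>x. indicator A x * (N n * sin (r x / N n)) \<partial>M) = N n * (\<integral>x. indicator A x * sin (r x / N n) \<partial>M)"
      by (subst integral_mult_right_zero[symmetric]) (simp add: mult.left_commute)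
    then show ?thesis using cond_null_cos_sin(2)[OF sub null A, of n] by simp
  qed
  ultimately show "(\<integral>x. indicator A x * (u \<bullet> (X x - m x)) \<partial>M) = 0"
    unfolding r_def[symmetric] by (simp add: LIMSEQ_const_iff)
  have "(\<lambda>n. \<integral>x. indicator A x * S n x \<partial>M) \<longlonglongrightarrow> (\<integral>x. indicator A x * (r x)\<^sup>2 \<partial>M)"
  proof (rule integral_dominated_convergence[where w = "\<lambda>x. (r x)\<^sup>2"])
    show "AE x in M. (\<lambda>n. indicator A x * S n x) \<longlonglongrightarrow> indicator A x * (r x)\<^sup>2"
      by (intro AE_I2 tendsto_mult_left Slim)
    have "S n x \<le> (r x)\<^sup>2" for n x
      unfolding S_def using abs_mult_sin_divide_le[of "2 * N n" "r x"] N[of n] by (simp add: abs_le_square_iff)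
    then show "AE x in M. norm (indicator A x * S n x) \<le> (r x)\<^sup>2" for n
      by (auto simp: indicator_def S_def)
  qed (use r2 in auto)
  moreover have "(\<lambda>n. \<integral>x. indicator A x * E n x \<partial>M) \<longlonglongrightarrow> (\<integral>x. indicator A x * h x \<partial>M)"
  proof (rule integral_dominated_convergence[where w = h])
    show "AE x in M. (\<lambda>n. indicator A x * E n x) \<longlonglongrightarrow> indicator A x * h x"
      by (intro AE_I2 tendsto_mult_left Elim)
    show "AE x in M. norm (indicator A x * E n x) \<le> h x" for n
      using E0 Eh h0 by (auto simp: indicator_def)
  qed (use hint in auto)
  ultimately show "(\<integral>x. indicator A x * (u \<bullet> (X x - m x))\<^sup>2 \<partial>M) = (\<integral>x. indicator A x * (u \<bullet> (P x *v u)) \<partial>M)"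
    unfolding r_def[symmetric] h_def[symmetric] SE[OF A] by (rule LIMSEQ_unique)
qed

lemma borel_measurable_vec_component:
  assumes "X \<in> borel_measurable M"
  shows "(\<lambda>x. X x $ i :: real) \<in> borel_measurable M"
  using borel_measurable_inner[OF assms measurable_const[of "axis i 1"]] by (simp add: inner_axis)

text \<open>The error has integral 0 over every set of \<open>F\<close>, and \<open>m\<close> is
  integrable as the difference of \<open>X\<close> and the square integrable error. These facts
  characterise the conditional expectation of each component.\<close>

lemma (in prob_space) cond_gauss_cond_exp:
  fixes X m :: "'a \<Rightarrow> real^'n"
  assumes sub: "subalgebra M F" and G: "cond_gauss M F X m P"
    and X: "\<And>i. integrable M (\<lambda>x. X x $ i)"
  shows "AE x in M. cond_exp_vec M F X x = m x"
proof -
  interpret S: finite_measure_subalgebra M F using sub by unfold_locales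
  note [measurable] = cond_gaussD(1)[OF G] measurable_from_subalg[OF sub cond_gaussD(2)[OF G]]
  have "AE x in M. real_cond_exp M F (\<lambda>x. X x $ i) x = m x $ i" for i
  proof (rule S.real_cond_exp_charact)
    have e: "axis i 1 \<bullet> (X x - m x) = X x $ i - m x $ i" for x by (simp add: inner_axis')
    have ei: "integrable M (\<lambda>x. X x $ i - m x $ i)"
      using cond_gauss_error_square_integrable[OF sub G, of "axis i 1"] unfolding e
      by (rule square_integrable_imp_integrable[rotated]) (auto intro!: borel_measurable_diff borel_measurable_vec_component)
    from Bochner_Integration.integrable_diff[OF X[of i] this]
    show mi: "integrable M (\<lambda>x. m x $ i)" by simp
    show "integrable M (\<lambda>x. X x $ i)" by (rule X)
    show "(\<lambda>x. m x $ i) \<in> borel_measurable F"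
      by (rule borel_measurable_vec_component) (rule cond_gaussD(2)[OF G])
    fix A assume A: "A \<in> sets F"
    then have AM: "A \<in> sets M" using sub by (auto simp: subalgebra_def)
    have "(\<integral>x. indicator A x * X x $ i - indicator A x * m x $ i \<partial>M) = 0"
      using cond_gauss_error_mean[OF sub G A, of "axis i 1"] unfolding e by (simp add: right_diff_distrib)
    then show "(\<integral>x\<in>A. X x $ i \<partial>M) = (\<integral>x\<in>A. m x $ i \<partial>M)"
      using integrable_mult_indicator[OF AM X[of i]] integrable_mult_indicator[OF AM mi]
      unfolding set_lebesgue_integral_def by simp
  qed
  then have "AE x in M. \<forall>i. real_cond_exp M F (\<lambda>x. X x $ i) x = m x $ i"
    by (simp add: AE_all_countable)
  then show ?thesis by eventually_elim (simp add: cond_exp_vec_def vec_eq_iff)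
qed

lemma quadratic_axis_sum:
  fixes P :: "real^'n^'n"
  assumes "transpose P = P"
  shows "(axis i 1 + axis j 1) \<bullet> (P *v (axis i 1 + axis j 1)) = P $ i $ i + 2 * P $ i $ j + P $ j $ j"
proof -
  have "axis i 1 \<bullet> (P *v axis j 1) = P $ i $ j" for i j
    by (simp add: inner_axis' matrix_vector_mult_basis column_def)
  then show ?thesis unfolding sym_quadratic_add[OF assms] by simp
qed

text \<open>Only variances in fixed directions are available, so the entry (i, j) is obtained by
  polarisation from the directions \<open>axis i 1\<close>, \<open>axis j 1\<close> and their sum.
  Beforehand \<open>cond_exp_vec\<close> is replaced by \<open>m\<close>, with which it agrees
  almost everywhere.\<close>

lemma (in prob_space) cond_gauss_cond_err_cov:
  fixes X m :: "'a \<Rightarrow> real^'n"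
  assumes sub: "subalgebra M F" and G: "cond_gauss M F X m P"
    and X: "\<And>i. integrable M (\<lambda>x. X x $ i)"
  shows "AE x in M. cond_err_cov M F X x = P x"
proof -
  interpret S: finite_measure_subalgebra M F using sub by unfold_locales
  note [measurable] = cond_gaussD(1)[OF G] measurable_from_subalg[OF sub cond_gaussD(2)[OF G]]
  define e where "e x = X x - m x" for x
  have em[measurable]: "(\<lambda>x. e x $ i) \<in> borel_measurable M" for i
    unfolding e_def by (rule borel_measurable_vec_component) measurable
  have [measurable]: "(\<lambda>x. X x $ i) \<in> borel_measurable M" for i
    by (rule borel_measurable_vec_component) measurable
  have sq: "integrable M (\<lambda>x. (e x $ i)\<^sup>2)" "integrable M (\<lambda>x. (e x $ i + e x $ j)\<^sup>2)" for i j
    using cond_gauss_error_square_integrable[OF sub G, of "axis i 1"]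
      cond_gauss_error_square_integrable[OF sub G, of "axis i 1 + axis j 1"]
    unfolding e_def[symmetric] by (simp_all add: inner_axis' inner_add_left)
  have prod: "e x $ i * e x $ j = ((e x $ i + e x $ j)\<^sup>2 - (e x $ i)\<^sup>2 - (e x $ j)\<^sup>2) / 2" for x i j
    by (simp add: power2_eq_square algebra_simps)
  have "AE x in M. real_cond_exp M F (\<lambda>x. (X x - cond_exp_vec M F X x) $ i * (X x - cond_exp_vec M F X x) $ j) x = P x $ i $ j" for i j
  proof -
    have ce: "(\<lambda>x. cond_exp_vec M F X x $ i) \<in> borel_measurable M" for i
      by (simp add: cond_exp_vec_def)
    have "AE x in M. real_cond_exp M F (\<lambda>x. (X x - cond_exp_vec M F X x) $ i * (X x - cond_exp_vec M F X x) $ j) x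
      = real_cond_exp M F (\<lambda>x. e x $ i * e x $ j) x"
    proof (rule S.real_cond_exp_cong)
      show "AE x in M. (X x - cond_exp_vec M F X x) $ i * (X x - cond_exp_vec M F X x) $ j = e x $ i * e x $ j"
        using cond_gauss_cond_exp[OF sub G X] by eventually_elim (simp add: e_def)
    qed (use ce in auto)
    moreover have "AE x in M. real_cond_exp M F (\<lambda>x. e x $ i * e x $ j) x = P x $ i $ j"
    proof (rule S.real_cond_exp_charact)
      show "integrable M (\<lambda>x. e x $ i * e x $ j)"
        unfolding prod using sq by auto
      have sf: "simple_function F (\<lambda>x. P x $ i $ j)" for i j
        by (rule simple_function_compose1[OF cond_gaussD(3)[OF G]])
      show "(\<lambda>x. P x $ i $ j) \<in> borel_measurable F"
        by (rule borel_measurable_simple_function[OF sf])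
      have Pint: "integrable M (\<lambda>x. P x $ i $ j)" for i j
        by (rule integrable_simple_function_subalg[OF sub sf])
      then show "integrable M (\<lambda>x. P x $ i $ j)" .
      fix A assume A: "A \<in> sets F"
      then have AM: "A \<in> sets M" using sub by (auto simp: subalgebra_def)
      note iA = integrable_mult_indicator[OF AM, unfolded real_scaleR_def]
      have sym: "transpose (P x) = P x" if "x \<in> space M" for x
        by (rule psd_matD(1)[OF cond_gaussD(4)[OF G that]])
      have v1: "(\<integral>x. indicator A x * (e x $ i)\<^sup>2 \<partial>M) = (\<integral>x. indicator A x * P x $ i $ i \<partial>M)" for i
        using cond_gauss_error_variance[OF sub G A, of "axis i 1"]
        unfolding e_def[symmetric] by (simp add: inner_axis' matrix_vector_mult_basis column_def)
      have v2: "(\<integral>x. indicator A x * (e x $ i + e x $ j)\<^sup>2 \<partial>M)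
        = (\<integral>x. indicator A x * (P x $ i $ i + 2 * P x $ i $ j + P x $ j $ j) \<partial>M)"
      proof -
        have "(\<integral>x. indicator A x * ((axis i 1 + axis j 1) \<bullet> (P x *v (axis i 1 + axis j 1))) \<partial>M)
          = (\<integral>x. indicator A x * (P x $ i $ i + 2 * P x $ i $ j + P x $ j $ j) \<partial>M)"
          by (intro Bochner_Integration.integral_cong refl) (simp only: quadratic_axis_sum[OF sym])
        then show ?thesis
          using cond_gauss_error_variance[OF sub G A, of "axis i 1 + axis j 1"]
          unfolding e_def[symmetric] by (simp add: inner_axis' inner_add_left)
      qed
      have "(\<integral>x\<in>A. e x $ i * e x $ j \<partial>M) = (\<integral>x. (indicator A x * (e x $ i + e x $ j)\<^sup>2 - indicator A x * (e x $ i)\<^sup>2 - indicator A x * (e x $ j)\<^sup>2) / 2 \<partial>M)"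
        unfolding set_lebesgue_integral_def prod
        by (intro Bochner_Integration.integral_cong refl) (simp add: algebra_simps)
      also have "\<dots> = ((\<integral>x. indicator A x * (e x $ i + e x $ j)\<^sup>2 \<partial>M) - (\<integral>x. indicator A x * (e x $ i)\<^sup>2 \<partial>M) - (\<integral>x. indicator A x * (e x $ j)\<^sup>2 \<partial>M)) / 2"
        using iA[OF sq(1)] iA[OF sq(2)] by simp
      also have "\<dots> = ((\<integral>x. indicator A x * (P x $ i $ i + 2 * P x $ i $ j + P x $ j $ j) \<partial>M) - (\<integral>x. indicator A x * P x $ i $ i \<partial>M) - (\<integral>x. indicator A x * P x $ j $ j \<partial>M)) / 2"
        unfolding v1 v2 ..
      also have "\<dots> = (\<integral>x. indicator A x * P x $ i $ j \<partial>M)"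
      proof -
        have "(\<integral>x. indicator A x * (P x $ i $ i + 2 * P x $ i $ j + P x $ j $ j) \<partial>M)
          = (\<integral>x. indicator A x * P x $ i $ i + 2 * (indicator A x * P x $ i $ j) + indicator A x * P x $ j $ j \<partial>M)"
          by (intro Bochner_Integration.integral_cong refl) (simp add: algebra_simps)
        also have "\<dots> = (\<integral>x. indicator A x * P x $ i $ i \<partial>M) + 2 * (\<integral>x. indicator A x * P x $ i $ j \<partial>M) + (\<integral>x. indicator A x * P x $ j $ j \<partial>M)"
          using iA[OF Pint] by simp
        finally show ?thesis by simp
      qed
      finally show "(\<integral>x\<in>A. e x $ i * e x $ j \<partial>M) = (\<integral>x\<in>A. P x $ i $ j \<partial>M)"
        unfolding set_lebesgue_integral_def by simp
    qed
    ultimately show ?thesis by eventually_elim simp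
  qed
  then have "AE x in M. \<forall>i j. real_cond_exp M F (\<lambda>x. (X x - cond_exp_vec M F X x) $ i * (X x - cond_exp_vec M F X x) $ j) x = P x $ i $ j"
    by (simp add: AE_all_countable)
  then show ?thesis by eventually_elim (simp add: cond_err_cov_def vec_eq_iff)
qed

section \<open>Gaussian measurements\<close>

text \<open>\<open>W\<close> is the effective measurement noise: \<open>R\<close> for a received
  value, \<open>R + matrix_inv Y\<close> for silence.\<close>

definition gain :: "real^'n^'m \<Rightarrow> real^'m^'m \<Rightarrow> real^'n^'n \<Rightarrow> real^'m^'n" where
  "gain C W p = p ** transpose C ** matrix_inv (C ** p ** transpose C + W)"

definition posterior_cov :: "real^'n^'m \<Rightarrow> real^'m^'m \<Rightarrow> real^'n^'n \<Rightarrow> real^'n^'n" where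
  "posterior_cov C W p = p - gain C W p ** C ** p"

lemma psd_mat_congruence:
  assumes "psd_mat p"
  shows "psd_mat (C ** p ** transpose C)"
  unfolding psd_mat_def
proof (intro conjI allI)
  show "transpose (C ** p ** transpose C) = C ** p ** transpose C"
    using psd_matD(1)[OF assms] by (simp add: matrix_transpose_mul matrix_mul_assoc)
  fix u
  have "u \<bullet> ((C ** p ** transpose C) *v u) = (transpose C *v u) \<bullet> (p *v (transpose C *v u))"
    by (simp add: matrix_vector_mul_assoc[symmetric] inner_matrix_vector)
  then show "0 \<le> u \<bullet> ((C ** p ** transpose C) *v u)" using psd_matD(2)[OF assms] by simp
qed

lemma pd_innovation: "psd_mat p \<Longrightarrow> pd_mat W \<Longrightarrow> pd_mat (C ** p ** transpose C + W)"
  by (rule pd_mat_add[OF psd_mat_congruence])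

lemma psd_mat_add: "psd_mat S \<Longrightarrow> psd_mat T \<Longrightarrow> psd_mat (S + T)"
  unfolding psd_mat_def
  by (auto simp: transpose_add_mat matrix_vector_mult_add_rdistrib inner_add_right)

text \<open>Symmetry of \<open>p\<close> moves everything onto the test vector: u enters the gain
  only through \<open>C *v (p *v u)\<close>.\<close>

lemma inner_gain:
  assumes p: "psd_mat p"
  shows "u \<bullet> (gain C W p *v z) = (C *v (p *v u)) \<bullet> (matrix_inv (C ** p ** transpose C + W) *v z)"
  unfolding gain_def
  by (simp add: matrix_vector_mul_assoc[symmetric] inner_matrix_vector[of u p] inner_matrix_vector[of _ "transpose C"] psd_matD(1)[OF p] del: transpose_matrix_vector)

lemma quadratic_posterior_cov:
  assumes p: "psd_mat p"
  shows "u \<bullet> (posterior_cov C W p *v u) =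
    u \<bullet> (p *v u) - (C *v (p *v u)) \<bullet> (matrix_inv (C ** p ** transpose C + W) *v (C *v (p *v u)))"
  unfolding posterior_cov_def
  by (simp add: matrix_vector_mult_diff_rdistrib inner_diff_right matrix_vector_mul_assoc[symmetric] inner_gain[OF p])

text \<open>Joseph form: with S g = C p u, the quadratic form of the posterior covariance at u is
  that of \<open>p\<close> at \<open>u - transpose C *v g\<close> plus that of \<open>W\<close> at
  g, a sum of nonnegative terms.\<close>

lemma psd_posterior_cov:
  assumes p: "psd_mat p" and W: "pd_mat W"
  shows "psd_mat (posterior_cov C W p)"
  unfolding psd_mat_def
proof (intro conjI allI)
  define S where "S = C ** p ** transpose C + W"
  have S: "pd_mat S" unfolding S_def by (rule pd_innovation[OF p W])
  note sym = psd_matD(1)[OF p] pd_mat_sym[OF pd_mat_inverse(3)[OF S]]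
  show "transpose (posterior_cov C W p) = posterior_cov C W p"
    unfolding posterior_cov_def gain_def S_def[symmetric]
    by (simp add: transpose_diff_mat matrix_transpose_mul sym matrix_mul_assoc)
  fix u
  define h where "h = C *v (p *v u)"
  define g where "g = matrix_inv S *v h"
  have Sg: "S *v g = h" unfolding g_def by (rule pd_mat_inverse_vector(1)[OF S])
  have "(u + - (transpose C *v g)) \<bullet> (p *v (u + - (transpose C *v g))) + g \<bullet> (W *v g)
    = u \<bullet> (p *v u) - 2 * (u \<bullet> (p *v (transpose C *v g))) + ((transpose C *v g) \<bullet> (p *v (transpose C *v g)) + g \<bullet> (W *v g))"
    unfolding sym_quadratic_add[OF sym(1)] by (simp add: vec.neg)
  also have "u \<bullet> (p *v (transpose C *v g)) = h \<bullet> g"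
    by (simp add: inner_matrix_vector[of u p] inner_matrix_vector[of _ "transpose C"] sym h_def del: transpose_matrix_vector)
  also have "(transpose C *v g) \<bullet> (p *v (transpose C *v g)) + g \<bullet> (W *v g) = g \<bullet> (S *v g)"
    unfolding S_def
    by (simp add: matrix_vector_mult_add_rdistrib inner_add_right matrix_vector_mul_assoc[symmetric] inner_matrix_vector[of g C])
  also have "g \<bullet> (S *v g) = h \<bullet> g" by (simp add: Sg inner_commute)
  finally have "u \<bullet> (posterior_cov C W p *v u) =
    (u + - (transpose C *v g)) \<bullet> (p *v (u + - (transpose C *v g))) + g \<bullet> (W *v g)"
    unfolding quadratic_posterior_cov[OF p] S_def[symmetric] h_def[symmetric] g_def[symmetric] by simp
  then show "0 \<le> u \<bullet> (posterior_cov C W p *v u)"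
    using psd_matD(2)[OF p, of "u + - (transpose C *v g)"] psd_matD(2)[OF pd_imp_psd[OF W], of g] by linarith
qed

section \<open>Measurability and splitting for simple covariances\<close>

lemma borel_measurable_vecI:
  fixes X :: "'a \<Rightarrow> real^'n"
  assumes "\<And>i. (\<lambda>x. X x $ i) \<in> borel_measurable M"
  shows "X \<in> borel_measurable M"
  using assms by (subst borel_measurable_euclidean_space) (auto simp: Basis_vec_def inner_axis)

lemma borel_measurable_simple_matrix_vector:
  fixes A :: "'a \<Rightarrow> real^'n^'m"
  assumes A: "simple_function F A" and X: "X \<in> borel_measurable F"
  shows "(\<lambda>x. A x *v X x) \<in> borel_measurable F"
proof (rule borel_measurable_vecI)
  fix i
  have "(\<lambda>x. A x $ i $ j) \<in> borel_measurable F" for j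
    by (rule borel_measurable_simple_function[OF simple_function_compose1[OF A]])
  then show "(\<lambda>x. (A x *v X x) $ i) \<in> borel_measurable F"
    unfolding matrix_vector_mult_def
    by (simp add: borel_measurable_sum borel_measurable_times borel_measurable_vec_component[OF X])
qed

lemma simple_function_subalg:
  assumes "subalgebra M F" "simple_function F f"
  shows "simple_function M f"
  using assms by (auto simp: simple_function_def subalgebra_def)

lemma simple_function_borel_measurable_quadratic:
  assumes "simple_function F P"
  shows "(\<lambda>x. u \<bullet> (P x *v u) :: real) \<in> borel_measurable F"
  by (rule borel_measurable_simple_function[OF simple_function_compose1[OF assms]])

text \<open>Freezes the random parameter: \<open>U\<close> lives on one level set, where
  \<open>P x\<close> may be replaced by the constant p. Since \<open>U\<close> is bounded and
  \<open>F\<close>-measurable, it can multiply known \<open>cond_null\<close> statements.\<close>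

lemma cond_null_split_simple:
  assumes sub: "subalgebra M F" and P: "simple_function F P" and D: "integrable M (\<lambda>x. D (P x) x)"
    and z: "\<And>p U. p \<in> P ` space M \<Longrightarrow> U \<in> borel_measurable F \<Longrightarrow> (\<And>x. norm (U x) \<le> 1) \<Longrightarrow>
      (\<And>x. U x \<noteq> 0 \<Longrightarrow> P x = p) \<Longrightarrow> cond_null M F (\<lambda>x. U x * D p x)"
  shows "cond_null M F (\<lambda>x. D (P x) x)"
proof (rule cond_null_simple_function[OF sub D P])
  fix p assume p: "p \<in> P ` space M"
  have "cond_null M F (\<lambda>x. indicator (P -` {p} \<inter> space M) x * D p x)"
    using P p sub by (intro z borel_measurable_indicator)
      (auto simp: simple_function_def subalgebra_def indicator_def split: if_splits)
  then show "cond_null M F (\<lambda>x. indicator (P -` {p} \<inter> space M) x * D (P x) x)"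
    by (rule cond_null_cong) (auto simp: indicator_def)
qed

lemma borel_measurable_cis_diff_gauss_cf:
  assumes "X \<in> borel_measurable N" "m \<in> borel_measurable N" "simple_function N P"
  shows "(\<lambda>x. cis (u \<bullet> X x) - gauss_cf u (m x) (P x)) \<in> borel_measurable N"
proof -
  note [measurable] = assms(1,2) simple_function_borel_measurable_quadratic[OF assms(3), of u]
  show ?thesis by measurable
qed

lemma norm_cis_diff_gauss_cf_le: "psd_mat S \<Longrightarrow> norm (cis r - gauss_cf u m S) \<le> 2"
  by (rule order_trans[OF norm_triangle_ineq4]) (simp add: norm_mult psd_matD(2))

text \<open>\<open>joint\<close> is the conditional characteristic function of the pair (X, C X + v)
  for noise v of covariance \<open>R\<close> independent of \<open>F\<close> and \<open>X\<close>,
  expressed without mentioning v.\<close>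

locale gaussian_measurement = prob_space M for M :: "'a measure" +
  fixes F :: "'a measure" and X m :: "'a \<Rightarrow> real^'n" and V :: "'a \<Rightarrow> real^'n^'n"
    and y :: "'a \<Rightarrow> real^'m" and C :: "real^'n^'m" and R :: "real^'m^'m"
  assumes sub: "subalgebra M F"
    and prior: "cond_gauss M F X m V"
    and y_meas [measurable]: "y \<in> borel_measurable M"
    and R: "pd_mat R"
    and joint: "\<And>u t. cond_null M F (\<lambda>x. cis (u \<bullet> X x) * cis (t \<bullet> y x) - cis (u \<bullet> m x + t \<bullet> (C *v m x)) *
      of_real (exp (- ((u + transpose C *v t) \<bullet> (V x *v (u + transpose C *v t)) + t \<bullet> (R *v t)) / 2)))"
begin

lemma measM [measurable]: "X \<in> borel_measurable M" "m \<in> borel_measurable M"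
  using cond_gaussD(1)[OF prior] measurable_from_subalg[OF sub cond_gaussD(2)[OF prior]] by auto

lemma measF: "m \<in> borel_measurable F" "simple_function F V"
  using cond_gaussD(2,3)[OF prior] by auto

lemma psd: "x \<in> space M \<Longrightarrow> psd_mat (V x)"
  by (rule cond_gaussD(4)[OF prior])

lemma cond_gauss_observation: "cond_gauss M F y (\<lambda>x. C *v m x) (\<lambda>x. C ** V x ** transpose C + R)"
  unfolding cond_gauss_def
proof (intro conjI allI ballI)
  show "y \<in> borel_measurable M" by measurable
  show "(\<lambda>x. C *v m x) \<in> borel_measurable F" using measF by measurable
  show "simple_function F (\<lambda>x. C ** V x ** transpose C + R)"
    by (rule simple_function_compose1[OF measF(2)])
  show "psd_mat (C ** V x ** transpose C + R)" if "x \<in> space M" for x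
    by (rule pd_imp_psd[OF pd_innovation[OF psd[OF that] R]])
  fix t
  show "cond_null M F (\<lambda>x. cis (t \<bullet> y x) - gauss_cf t (C *v m x) (C ** V x ** transpose C + R))"
    using joint[of 0 t]
    by (simp add: matrix_vector_mult_add_rdistrib inner_add_right matrix_vector_mul_assoc[symmetric] inner_matrix_vector[of t C])
qed

text \<open>By \<open>cond_null_join_gen\<close> it suffices to test with characters of
  \<open>y\<close>. For frozen covariance p and T g = C p u, the posterior mean depends on
  \<open>y\<close> only through \<open>g \<bullet> y\<close>, so its character merges with the test
  into one of frequency w = t + g. Both terms are then evaluated by \<open>joint\<close>, at (u, t)
  and at (0, w), and agree after completing the square.\<close>

lemma cond_null_observed:
  "cond_null M (join_gen M F y) (\<lambda>x. cis (u \<bullet> X x) - gauss_cf u (m x + gain C R (V x) *v (y x - C *v m x)) (posterior_cov C R (V x)))"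
proof (rule cond_null_join_gen[OF sub y_meas])
  define D where "D p x = cis (u \<bullet> X x) - gauss_cf u (m x + gain C R p *v (y x - C *v m x)) (posterior_cov C R p)" for p x
  note sfM = simple_function_subalg[OF sub simple_function_compose1[OF measF(2)]]
  have Dm: "(\<lambda>x. D (V x) x) \<in> borel_measurable M"
    unfolding D_def
    by (intro borel_measurable_cis_diff_gauss_cf sfM measM borel_measurable_add borel_measurable_simple_matrix_vector) measurable
  have Db: "norm (D (V x) x) \<le> 2" if "x \<in> space M" for x
    unfolding D_def by (rule norm_cis_diff_gauss_cf_le[OF psd_posterior_cov[OF psd[OF that] R]])
  show "integrable M (\<lambda>x. D (V x) x)"
    using Db Dm by (intro integrable_const_bound[where B = 2]) auto
  fix t
  show "cond_null M F (\<lambda>x. cis (t \<bullet> y x) * D (V x) x)"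
  proof (rule cond_null_split_simple[OF sub measF(2)])
    show "integrable M (\<lambda>x. cis (t \<bullet> y x) * D (V x) x)"
      using Db Dm by (intro integrable_const_bound[where B = 2]) (auto simp: norm_mult)
    fix p and I :: "'a \<Rightarrow> complex" assume "p \<in> V ` space M" and IF: "I \<in> borel_measurable F" and I1: "\<And>x. norm (I x) \<le> 1"
      and Ip: "\<And>x. I x \<noteq> 0 \<Longrightarrow> V x = p"
    then have p: "psd_mat p" using psd by auto
    define T where "T = C ** p ** transpose C + R"
    have T: "pd_mat T" unfolding T_def by (rule pd_innovation[OF p R])
    define h where "h = C *v (p *v u)"
    define g where "g = matrix_inv T *v h"
    have Tg: "T *v g = h" unfolding g_def by (rule pd_mat_inverse_vector(1)[OF T])
    note Tsym = pd_mat_sym[OF T] and Isym = pd_mat_sym[OF pd_mat_inverse(3)[OF T]]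
    have ug: "u \<bullet> (gain C R p *v z) = g \<bullet> z" for z
      unfolding inner_gain[OF p] T_def[symmetric] g_def h_def inner_sym_matrix[OF Isym] ..
    define w where "w = t + g"
    define e where "e = quad_exp (posterior_cov C R p) u"
    have e1: "e \<le> 1" unfolding e_def by (rule exp_psd_le_1[OF psd_posterior_cov[OF p R]])
    define J where "J u t x = cis (u \<bullet> X x) * cis (t \<bullet> y x) - cis (u \<bullet> m x + t \<bullet> (C *v m x)) *
      of_real (exp (- ((u + transpose C *v t) \<bullet> (V x *v (u + transpose C *v t)) + t \<bullet> (R *v t)) / 2))" for u t x
    have J: "cond_null M F (J u t)" for u t unfolding J_def by (rule joint)
    have "cond_null M F (\<lambda>x. I x * J u t x)"
      by (rule cond_null_mult[OF sub J IF I1])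
    moreover have "cond_null M F (\<lambda>x. (I x * (cis (u \<bullet> m x - g \<bullet> (C *v m x)) * e)) * J 0 w x)"
    proof (rule cond_null_mult[OF sub J])
      show "(\<lambda>x. I x * (cis (u \<bullet> m x - g \<bullet> (C *v m x)) * e)) \<in> borel_measurable F"
        using IF measF(1) by measurable
      show "norm (I x * (cis (u \<bullet> m x - g \<bullet> (C *v m x)) * e)) \<le> 1" for x
        using I1[of x] e1 by (simp add: norm_mult e_def mult_le_one)
    qed
    ultimately have "cond_null M F (\<lambda>x. I x * J u t x - (I x * (cis (u \<bullet> m x - g \<bullet> (C *v m x)) * e)) * J 0 w x)"
      by (rule cond_null_diff[OF sub])
    then show "cond_null M F (\<lambda>x. I x * (cis (t \<bullet> y x) * D p x))"
    proof (rule cond_null_cong)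
      fix x assume "x \<in> space M"
      show "I x * J u t x - (I x * (cis (u \<bullet> m x - g \<bullet> (C *v m x)) * e)) * J 0 w x =
        I x * (cis (t \<bullet> y x) * D p x)"
      proof (cases "V x = p")
        case False then have "I x = 0" using Ip by blast
        then show ?thesis by simp
      next
        case True
        have quadT: "(transpose C *v z) \<bullet> (p *v (transpose C *v z)) + z \<bullet> (R *v z) = z \<bullet> (T *v z)" for z
          unfolding T_def
          by (simp add: matrix_vector_mult_add_rdistrib inner_add_right matrix_vector_mul_assoc[symmetric] inner_matrix_vector[of z C])
        have cross: "u \<bullet> (p *v (transpose C *v t)) = h \<bullet> t"
          by (simp add: inner_matrix_vector[of u p] inner_matrix_vector[of _ "transpose C"] psd_matD(1)[OF p] h_def del: transpose_matrix_vector)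
        have post: "u \<bullet> (posterior_cov C R p *v u) = u \<bullet> (p *v u) - h \<bullet> g"
          unfolding quadratic_posterior_cov[OF p] h_def g_def T_def ..
        have "(u + transpose C *v t) \<bullet> (p *v (u + transpose C *v t)) + t \<bullet> (R *v t)
          = u \<bullet> (p *v u) + 2 * (h \<bullet> t) + t \<bullet> (T *v t)"
          unfolding sym_quadratic_add[OF psd_matD(1)[OF p]] cross quadT[symmetric] by simp
        \<comment> \<open>Completing the square: T g = h turns the cross term of the form at t + g
          into 2 (h \<bullet> t), and its surplus \<open>h \<bullet> g\<close> is exactly what the
          posterior covariance loses.\<close>
        also have "\<dots> = w \<bullet> (T *v w) + u \<bullet> (posterior_cov C R p *v u)"
          unfolding w_def sym_quadratic_add[OF Tsym] post Tg by (simp add: inner_commute)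
        finally have q1: "exp (- ((u + transpose C *v t) \<bullet> (V x *v (u + transpose C *v t)) + t \<bullet> (R *v t)) / 2)
          = quad_exp T w * e"
          unfolding True e_def exp_add[symmetric] by simp
        have q2: "exp (- ((0 + transpose C *v w) \<bullet> (V x *v (0 + transpose C *v w)) + w \<bullet> (R *v w)) / 2) = quad_exp T w"
          unfolding True add_0_left quadT ..
        have c1: "cis (u \<bullet> m x - g \<bullet> (C *v m x)) * cis (w \<bullet> y x) = cis (t \<bullet> y x) * cis (u \<bullet> (m x + gain C R p *v (y x - C *v m x)))"
          unfolding cis_mult w_def inner_add_right ug by (simp add: inner_diff_right inner_add_left algebra_simps)
        have c2: "cis (u \<bullet> m x - g \<bullet> (C *v m x)) * cis (w \<bullet> (C *v m x)) = cis (u \<bullet> m x + t \<bullet> (C *v m x))"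
          unfolding cis_mult w_def by (simp add: inner_add_left)
        have "J u t x - (cis (u \<bullet> m x - g \<bullet> (C *v m x)) * e) * J 0 w x
          = cis (u \<bullet> X x) * cis (t \<bullet> y x) - (cis (u \<bullet> m x - g \<bullet> (C *v m x)) * cis (w \<bullet> y x)) * e
            + ((cis (u \<bullet> m x - g \<bullet> (C *v m x)) * cis (w \<bullet> (C *v m x))) - cis (u \<bullet> m x + t \<bullet> (C *v m x))) * (quad_exp T w * e)"
          unfolding J_def q1 q2 by (simp add: algebra_simps)
        also have "\<dots> = cis (t \<bullet> y x) * D p x"
          unfolding c1 c2 D_def e_def[symmetric] by (simp add: algebra_simps)
        finally have eq: "cis (t \<bullet> y x) * D p x = J u t x - (cis (u \<bullet> m x - g \<bullet> (C *v m x)) * e) * J 0 w x" ..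
        show ?thesis unfolding eq by (simp only: right_diff_distrib mult_ac)
      qed
    qed
  qed
qed

text \<open>By \<open>cond_null_observed\<close> the state may be replaced by its regression on \<open>y\<close>, which reduces the claim to
  the tilted law of \<open>y\<close> alone.\<close>

lemma cond_null_silent:
  assumes Y: "pd_mat Y"
  shows "cond_null M F (\<lambda>x. of_real (quad_exp Y (y x)) *
    (cis (u \<bullet> X x) - gauss_cf u (m x - gain C (R + matrix_inv Y) (V x) *v (C *v m x)) (posterior_cov C (R + matrix_inv Y) (V x))))"
proof -
  define W where "W = R + matrix_inv Y"
  have W: "pd_mat W" unfolding W_def by (rule pd_mat_add[OF pd_imp_psd[OF R] pd_mat_inverse(3)[OF Y]])
  define q where "q x = quad_exp Y (y x)" for x
  have q1: "q x \<le> 1" "0 < q x" for x unfolding q_def using exp_psd_le_1[OF pd_imp_psd[OF Y]] by auto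
  have [measurable]: "q \<in> borel_measurable M" unfolding q_def by measurable
  have qJ: "q \<in> borel_measurable (join_gen M F y)" unfolding q_def
    using measurable_join_gen[OF sub y_meas] by measurable
  define D where "D p x = cis (u \<bullet> X x) - gauss_cf u (m x - gain C W p *v (C *v m x)) (posterior_cov C W p)" for p x
  note sfM = simple_function_subalg[OF sub simple_function_compose1[OF measF(2)]]
  have Dm: "(\<lambda>x. D (V x) x) \<in> borel_measurable M"
    unfolding D_def
    by (intro borel_measurable_cis_diff_gauss_cf sfM measM borel_measurable_diff borel_measurable_simple_matrix_vector) measurable
  have Db: "norm (D (V x) x) \<le> 2" if "x \<in> space M" for x
    unfolding D_def by (rule norm_cis_diff_gauss_cf_le[OF psd_posterior_cov[OF psd[OF that] W]])
  have "cond_null M F (\<lambda>x. of_real (q x) * D (V x) x)"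
  proof (rule cond_null_split_simple[OF sub measF(2)])
    show "integrable M (\<lambda>x. of_real (q x) * D (V x) x)"
    proof (rule integrable_const_bound[where B = 2])
      show "AE x in M. norm (of_real (q x) * D (V x) x) \<le> 2"
      proof (rule AE_I2)
        fix x assume w: "x \<in> space M"
        have "q x * norm (D (V x) x) \<le> 1 * 2"
          using q1[of x] Db[OF w] by (intro mult_mono) auto
        then show "norm (of_real (q x) * D (V x) x) \<le> 2" using q1(2)[of x] by (simp add: norm_mult)
      qed
    qed (use Dm in measurable)
    fix p and I :: "'a \<Rightarrow> complex" assume "p \<in> V ` space M" and IF: "I \<in> borel_measurable F" and I1: "\<And>x. norm (I x) \<le> 1"
      and Ip: "\<And>x. I x \<noteq> 0 \<Longrightarrow> V x = p"
    then have p: "psd_mat p" using psd by auto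
    define T where "T = C ** p ** transpose C + R"
    define S where "S = C ** p ** transpose C + W"
    have ST: "S = T + matrix_inv Y" by (simp add: S_def T_def W_def add.assoc)
    have T: "pd_mat T" unfolding T_def by (rule pd_innovation[OF p R])
    have S: "pd_mat S" unfolding S_def by (rule pd_innovation[OF p W])
    define h where "h = C *v (p *v u)"
    define g where "g = matrix_inv T *v h"
    have Tg: "T *v g = h" unfolding g_def by (rule pd_mat_inverse_vector(1)[OF T])
    note Tsym = pd_mat_sym[OF T] and Isym = pd_mat_sym[OF pd_mat_inverse(3)[OF T]]
    have ug: "u \<bullet> (gain C R p *v z) = g \<bullet> z" for z
      unfolding inner_gain[OF p] T_def[symmetric] g_def h_def inner_sym_matrix[OF Isym] ..
    define e where "e = quad_exp (posterior_cov C R p) u"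
    have e1: "e \<le> 1" unfolding e_def by (rule exp_psd_le_1[OF psd_posterior_cov[OF p R]])
    have base: "cond_null M F (\<lambda>x. I x * (cis (t \<bullet> y x) - gauss_cf t (C *v m x) T))" for t
      by (rule cond_null_cong[OF cond_null_mult[OF sub cond_gaussD(5)[OF cond_gauss_observation, of t] IF I1]])
        (use Ip in \<open>auto simp: T_def\<close>)
    have CmF: "(\<lambda>x. C *v m x) \<in> borel_measurable F" using measF(1) by measurable
    define a where "a x = C *v m x - T *v (matrix_inv S *v (C *v m x))" for x
    define e' where "e' = exp (- (g \<bullet> (T *v g - T *v (matrix_inv S *v (T *v g)))) / 2)"
    \<comment> \<open>Once \<open>X\<close> is replaced by its regression, \<open>y\<close> enters
      only through \<open>cis (g \<bullet> y x)\<close>; the tilted law is needed at the single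
      frequency g.\<close>
    have tilt: "cond_null M F (\<lambda>x. I x * (of_real (q x) * (cis (g \<bullet> y x) - cis (g \<bullet> a x) * of_real e')))"
      using cond_null_exp_quadratic_tilt[OF sub y_meas CmF T IF I1 base Y, of g]
      unfolding ST[symmetric] q_def a_def e'_def .
    have second: "cond_null M F (\<lambda>x. (cis (u \<bullet> m x - g \<bullet> (C *v m x)) * of_real e) *
        (I x * (of_real (q x) * (cis (g \<bullet> y x) - cis (g \<bullet> a x) * of_real e'))))"
    proof (rule cond_null_mult[OF sub tilt])
      show "(\<lambda>x. cis (u \<bullet> m x - g \<bullet> (C *v m x)) * of_real e) \<in> borel_measurable F"
        using measF(1) by measurable
      show "norm (cis (u \<bullet> m x - g \<bullet> (C *v m x)) * of_real e) \<le> 1" for x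
        using e1 by (simp add: norm_mult e_def)
    qed
    \<comment> \<open>The weight is a function of \<open>y\<close> and may therefore multiply the
      identity over the join; afterwards only \<open>F\<close>-measurable tests are kept.\<close>
    have first: "cond_null M F (\<lambda>x. I x * (of_real (q x) * (cis (u \<bullet> X x) - gauss_cf u (m x + gain C R (V x) *v (y x - C *v m x)) (posterior_cov C R (V x)))))"
    proof (rule cond_null_mult[OF sub _ IF I1])
      show "cond_null M F (\<lambda>x. of_real (q x) * (cis (u \<bullet> X x) - gauss_cf u (m x + gain C R (V x) *v (y x - C *v m x)) (posterior_cov C R (V x))))"
        by (rule cond_null_coarser[OF cond_null_mult[OF subalgebra_join_gen[OF sub y_meas] cond_null_observed, where c = 1]
              sub_join_gen[OF sub y_meas]])
          (use qJ q1 in \<open>auto simp: less_imp_le\<close>)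
    qed
    from cond_null_add[OF sub first second]
    show "cond_null M F (\<lambda>x. I x * (of_real (q x) * D p x))"
    proof (rule cond_null_cong)
      fix x assume "x \<in> space M"
      show "I x * (of_real (q x) * (cis (u \<bullet> X x) - gauss_cf u (m x + gain C R (V x) *v (y x - C *v m x)) (posterior_cov C R (V x)))) +
        (cis (u \<bullet> m x - g \<bullet> (C *v m x)) * of_real e) *
        (I x * (of_real (q x) * (cis (g \<bullet> y x) - cis (g \<bullet> a x) * of_real e')))
        = I x * (of_real (q x) * D p x)"
      proof (cases "V x = p")
        case False then have "I x = 0" using Ip by blast
        then show ?thesis by simp
      next
        case True
        have c1: "cis (u \<bullet> m x - g \<bullet> (C *v m x)) * cis (g \<bullet> y x) = cis (u \<bullet> (m x + gain C R p *v (y x - C *v m x)))"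
          unfolding cis_mult inner_add_right ug by (simp add: inner_diff_right algebra_simps)
        have ga: "g \<bullet> (T *v z) = h \<bullet> z" for z
          unfolding inner_sym_matrix[OF Tsym] Tg ..
        have c2: "cis (u \<bullet> m x - g \<bullet> (C *v m x)) * cis (g \<bullet> a x) = cis (u \<bullet> (m x - gain C W p *v (C *v m x)))"
          unfolding cis_mult a_def inner_diff_right inner_gain[OF p] S_def[symmetric] h_def[symmetric] ga by simp
        \<comment> \<open>Observing \<open>y\<close> lowers the form of p by
          \<open>h \<bullet> g\<close>; averaging over the tilted law of \<open>y\<close> restores
          \<open>h \<bullet> g\<close> minus the form of \<open>matrix_inv S\<close> at h. The terms
          \<open>h \<bullet> g\<close> cancel, leaving the posterior for noise
          \<open>W\<close>.\<close>
        have e2: "e * e' = quad_exp (posterior_cov C W p) u"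
          unfolding e_def e'_def exp_add[symmetric] quadratic_posterior_cov[OF p] S_def[symmetric] T_def[symmetric]
            h_def[symmetric] g_def[symmetric] inner_diff_right ga Tg by (simp add: inner_commute field_simps)
        have "(cis (u \<bullet> X x) - cis (u \<bullet> (m x + gain C R p *v (y x - C *v m x))) * of_real e) +
          (cis (u \<bullet> m x - g \<bullet> (C *v m x)) * of_real e) * (cis (g \<bullet> y x) - cis (g \<bullet> a x) * of_real e')
          = cis (u \<bullet> X x) - cis (u \<bullet> (m x + gain C R p *v (y x - C *v m x))) * of_real e
            + (cis (u \<bullet> m x - g \<bullet> (C *v m x)) * cis (g \<bullet> y x)) * of_real e
            - (cis (u \<bullet> m x - g \<bullet> (C *v m x)) * cis (g \<bullet> a x)) * of_real (e * e')"
          by (simp add: algebra_simps)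
        also have "\<dots> = D p x" unfolding c1 c2 e2 D_def by simp
        finally have eq: "D p x = (cis (u \<bullet> X x) - cis (u \<bullet> (m x + gain C R p *v (y x - C *v m x))) * of_real e) +
          (cis (u \<bullet> m x - g \<bullet> (C *v m x)) * of_real e) * (cis (g \<bullet> y x) - cis (g \<bullet> a x) * of_real e')" ..
        show ?thesis unfolding True e_def[symmetric] eq
          by (simp only: distrib_left mult_ac)
      qed
    qed
  qed
  then show ?thesis unfolding q_def D_def W_def .
qed

end

section \<open>Update and prediction\<close>

text \<open>\<open>ind\<close> is independence of the noise from \<open>F\<close> and
  \<open>X\<close> in integrated form. It splits off the characteristic function of the noise, a
  constant, and the remaining factor is covered by \<open>cond_gauss\<close>.\<close>

lemma cond_null_independent_noise:
  fixes w :: "'a \<Rightarrow> real^'k"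
  assumes sub: "subalgebra M F" and G: "cond_gauss M F X m V"
    and w: "w \<in> borel_measurable M" and M: "finite_measure M"
    and ind: "\<And>Z c. Z \<in> borel_measurable F \<Longrightarrow> (\<And>x. x \<in> space M \<Longrightarrow> norm (Z x) \<le> c) \<Longrightarrow>
      (\<integral>x. Z x * cis (u \<bullet> X x) * cis (t \<bullet> w x) \<partial>M)
        = (\<integral>x. Z x * cis (u \<bullet> X x) \<partial>M) * of_real (quad_exp W t)"
  shows "cond_null M F (\<lambda>x. cis (u \<bullet> X x) * cis (t \<bullet> w x)
    - cis (u \<bullet> m x) * of_real (exp (- (u \<bullet> (V x *v u) + t \<bullet> (W *v t)) / 2)))"
proof -
  interpret finite_measure M by fact
  note [measurable] = cond_gaussD(1)[OF G] measurable_from_subalg[OF sub cond_gaussD(2)[OF G]] w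
  have [measurable]: "(\<lambda>x. u \<bullet> (V x *v u)) \<in> borel_measurable M"
    by (rule measurable_from_subalg[OF sub simple_function_borel_measurable_quadratic[OF cond_gaussD(3)[OF G]]])
  define g where "g x = quad_exp (V x) u" for x
  define e where "e = quad_exp W t"
  have g1: "g x \<le> 1" if "x \<in> space M" for x
    unfolding g_def by (rule exp_psd_le_1[OF cond_gaussD(4)[OF G that]])
  have gM[measurable]: "g \<in> borel_measurable M" unfolding g_def by measurable
  have ge: "exp (- (u \<bullet> (V x *v u) + t \<bullet> (W *v t)) / 2) = g x * e" for x
    unfolding g_def e_def exp_add[symmetric] by (simp add: add_divide_distrib)
  have i1: "integrable M (\<lambda>x. cis (u \<bullet> X x) * cis (t \<bullet> w x))"
    by (rule integrable_const_bound[where B = 1]) (auto simp: norm_mult)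
  have i2: "integrable M (\<lambda>x. cis (u \<bullet> m x) * of_real (g x))"
    using g1 by (intro integrable_const_bound[where B = 1]) (auto simp: norm_mult g_def)
  have i3: "integrable M (\<lambda>x. cis (u \<bullet> X x))"
    by (rule integrable_const_bound[where B = 1]) auto
  show ?thesis
    unfolding cond_null_def ge
  proof (intro conjI allI impI)
    show "integrable M (\<lambda>x. cis (u \<bullet> X x) * cis (t \<bullet> w x) - cis (u \<bullet> m x) * of_real (g x * e))"
      using i1 Bochner_Integration.integrable_mult_left[OF i2, of "of_real e"] by (simp add: mult.assoc)
    fix Z :: "'a \<Rightarrow> complex" and c assume Z: "Z \<in> borel_measurable F" "\<forall>x\<in>space M. norm (Z x) \<le> c"
    have ZM: "Z \<in> borel_measurable M" by (rule measurable_from_subalg[OF sub Z(1)])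
    have z: "(\<integral>x. Z x * (cis (u \<bullet> X x) - cis (u \<bullet> m x) * of_real (g x)) \<partial>M) = 0"
      using cond_nullD[OF cond_gaussD(5)[OF G, of u] Z(1)] Z(2) unfolding g_def by blast
    note ib = integrable_bounded_mult[OF _ ZM, where c = c]
    have "(\<integral>x. Z x * (cis (u \<bullet> X x) * cis (t \<bullet> w x) - cis (u \<bullet> m x) * of_real (g x * e)) \<partial>M)
      = (\<integral>x. Z x * (cis (u \<bullet> X x) * cis (t \<bullet> w x)) - Z x * (cis (u \<bullet> m x) * of_real (g x)) * of_real e \<partial>M)"
      by (simp add: algebra_simps)
    also have "\<dots> = (\<integral>x. Z x * (cis (u \<bullet> X x) * cis (t \<bullet> w x)) \<partial>M)
      - (\<integral>x. Z x * (cis (u \<bullet> m x) * of_real (g x)) \<partial>M) * of_real e"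
      using ib[OF i1] ib[OF i2] Z(2) by simp
    also have "(\<integral>x. Z x * (cis (u \<bullet> X x) * cis (t \<bullet> w x)) \<partial>M) = (\<integral>x. Z x * cis (u \<bullet> X x) \<partial>M) * of_real e"
      using ind[OF Z(1) bspec[OF Z(2)]] unfolding e_def by (simp add: mult.assoc)
    also have "(\<integral>x. Z x * cis (u \<bullet> X x) \<partial>M) = (\<integral>x. Z x * (cis (u \<bullet> m x) * of_real (g x)) \<partial>M)"
      using z ib[OF i2] ib[OF i3] Z(2) by (simp add: right_diff_distrib)
    finally show "(\<integral>x. Z x * (cis (u \<bullet> X x) * cis (t \<bullet> w x) - cis (u \<bullet> m x) * of_real (g x * e)) \<partial>M) = 0"
      by simp
  qed
qed

text \<open>The joint characteristic function is read at the pair of frequencies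
  \<open>transpose A *v u\<close> and u.\<close>

lemma cond_gauss_predict:
  fixes A :: "real^'n^'n"
  assumes sub: "subalgebra M F" and G: "cond_gauss M F X m V"
    and w: "w \<in> borel_measurable M" and Q: "psd_mat Q"
    and noise: "\<And>u t. cond_null M F (\<lambda>x. cis (u \<bullet> X x) * cis (t \<bullet> w x)
      - cis (u \<bullet> m x) * of_real (exp (- (u \<bullet> (V x *v u) + t \<bullet> (Q *v t)) / 2)))"
  shows "cond_gauss M F (\<lambda>x. A *v X x + w x) (\<lambda>x. A *v m x) (\<lambda>x. A ** V x ** transpose A + Q)"
  unfolding cond_gauss_def
proof (intro conjI allI ballI)
  note [measurable] = cond_gaussD(1)[OF G] w
  show "(\<lambda>x. A *v X x + w x) \<in> borel_measurable M" by measurable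
  show "(\<lambda>x. A *v m x) \<in> borel_measurable F" using cond_gaussD(2)[OF G] by measurable
  show "simple_function F (\<lambda>x. A ** V x ** transpose A + Q)"
    by (rule simple_function_compose1[OF cond_gaussD(3)[OF G]])
  show "psd_mat (A ** V x ** transpose A + Q)" if "x \<in> space M" for x
    by (rule psd_mat_add[OF psd_mat_congruence[OF cond_gaussD(4)[OF G that]] Q])
  fix u
  show "cond_null M F (\<lambda>x. cis (u \<bullet> (A *v X x + w x)) - gauss_cf u (A *v m x) (A ** V x ** transpose A + Q))"
    using noise[of "transpose A *v u" u]
    by (simp add: matrix_vector_mult_add_rdistrib inner_add_right matrix_vector_mul_assoc[symmetric]
        inner_matrix_vector[of u A] cis_mult del: transpose_matrix_vector)
qed

text \<open>A frequency t for the measurement acts on the state as \<open>transpose C *v t\<close>,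
  so \<open>joint\<close> is \<open>noise\<close> at \<open>u + transpose C *v t\<close> and
  t.\<close>

lemma gaussian_measurement_linear:
  assumes M: "prob_space M" and sub: "subalgebra M F" and G: "cond_gauss M F X m V"
    and v: "v \<in> borel_measurable M" and R: "pd_mat R"
    and noise: "\<And>u t. cond_null M F (\<lambda>x. cis (u \<bullet> X x) * cis (t \<bullet> v x)
      - cis (u \<bullet> m x) * of_real (exp (- (u \<bullet> (V x *v u) + t \<bullet> (R *v t)) / 2)))"
  shows "gaussian_measurement M F X m V (\<lambda>x. C *v X x + v x) C R"
proof -
  interpret prob_space M by fact
  note [measurable] = cond_gaussD(1)[OF G] v
  show ?thesis
  proof
    show "(\<lambda>x. C *v X x + v x) \<in> borel_measurable M" by measurable
    fix u t
    have c: "cis (u \<bullet> X x) * cis (t \<bullet> (C *v X x + v x)) = cis ((u + transpose C *v t) \<bullet> X x) * cis (t \<bullet> v x)"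
      "cis (u \<bullet> m x + t \<bullet> (C *v m x)) = cis ((u + transpose C *v t) \<bullet> m x)" for x
      by (simp_all add: cis_mult inner_add_right inner_add_left inner_matrix_vector[of t C] add.assoc del: transpose_matrix_vector)
    show "cond_null M F (\<lambda>x. cis (u \<bullet> X x) * cis (t \<bullet> (C *v X x + v x)) - cis (u \<bullet> m x + t \<bullet> (C *v m x)) *
      of_real (exp (- ((u + transpose C *v t) \<bullet> (V x *v (u + transpose C *v t)) + t \<bullet> (R *v t)) / 2)))"
      unfolding c by (rule noise)
  qed fact+
qed

text \<open>\<open>F'\<close> refines \<open>F\<close> by \<open>\<eta>\<close>, \<open>\<eta> * \<epsilon>\<close> and \<open>(\<eta> * \<epsilon>) *\<^sub>R y\<close>: on the events of loss, silence and transmission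
  its trace is that of \<open>F\<close>, of \<open>F\<close> and of \<open>F\<close> joined with \<open>y\<close>.\<close>

lemma (in gaussian_measurement) cond_gauss_update:
  fixes \<eta> \<epsilon> :: "'a \<Rightarrow> real" and Y :: "real^'m^'m"
  defines "q \<equiv> \<lambda>x. quad_exp Y (y x)"
  defines "K \<equiv> \<lambda>x. \<eta> x *\<^sub>R gain C (R + (1 - \<eta> x * \<epsilon> x) *\<^sub>R matrix_inv Y) (V x)"
  assumes Y: "pd_mat Y"
    and F': "subalgebra M F'" "subalgebra F' F"
    and F'_meas: "simple_function F' \<eta>" "simple_function F' (\<lambda>x. \<eta> x * \<epsilon> x)"
      "(\<lambda>x. (\<eta> x * \<epsilon> x) *\<^sub>R y x) \<in> borel_measurable F'"
    and vals: "\<And>x. x \<in> space M \<Longrightarrow> \<eta> x \<in> {0, 1}" "\<And>x. x \<in> space M \<Longrightarrow> \<epsilon> x \<in> {0, 1}"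
    and eps_meas: "\<epsilon> \<in> borel_measurable M"
    and trace_lost: "\<And>B. B \<in> sets F' \<Longrightarrow> \<exists>A\<in>sets F. \<forall>x\<in>space M. \<eta> x = 0 \<longrightarrow> (x \<in> B \<longleftrightarrow> x \<in> A)"
    and trace_silent: "\<And>B. B \<in> sets F' \<Longrightarrow> \<exists>A\<in>sets F. \<forall>x\<in>space M. \<eta> x = 1 \<and> \<epsilon> x = 0 \<longrightarrow> (x \<in> B \<longleftrightarrow> x \<in> A)"
    and trace_sent: "\<And>B. B \<in> sets F' \<Longrightarrow> \<exists>A\<in>sets (join_gen M F y). \<forall>x\<in>space M. \<eta> x = 1 \<and> \<epsilon> x = 1 \<longrightarrow> (x \<in> B \<longleftrightarrow> x \<in> A)"
    and H: "subalgebra M H" "subalgebra H F" "X \<in> borel_measurable H" "y \<in> borel_measurable H"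
    and ind_lost: "\<And>f c. f \<in> borel_measurable H \<Longrightarrow> (\<And>x. x \<in> space M \<Longrightarrow> norm (f x) \<le> c) \<Longrightarrow>
      (\<integral>x. complex_of_real (1 - \<eta> x) * f x \<partial>M) = of_real (1 - lam) * (\<integral>x. f x \<partial>M)"
    and ind_silent: "\<And>f c. f \<in> borel_measurable H \<Longrightarrow> (\<And>x. x \<in> space M \<Longrightarrow> norm (f x) \<le> c) \<Longrightarrow>
      (\<integral>x. complex_of_real (\<eta> x * (1 - \<epsilon> x)) * f x \<partial>M) = of_real lam * (\<integral>x. of_real (q x) * f x \<partial>M)"
    and ind_sent: "\<And>f c. f \<in> borel_measurable H \<Longrightarrow> (\<And>x. x \<in> space M \<Longrightarrow> norm (f x) \<le> c) \<Longrightarrow>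
      (\<integral>x. complex_of_real (\<eta> x * \<epsilon> x) * f x \<partial>M) = of_real lam * (\<integral>x. of_real (1 - q x) * f x \<partial>M)"
  shows "cond_gauss M F' X (\<lambda>x. (mat 1 - K x ** C) *v m x + K x *v ((\<eta> x * \<epsilon> x) *\<^sub>R y x)) (\<lambda>x. V x - K x ** C ** V x)"
proof -
  define m' where "m' x = (mat 1 - K x ** C) *v m x + K x *v ((\<eta> x * \<epsilon> x) *\<^sub>R y x)" for x
  define V' where "V' x = V x - K x ** C ** V x" for x
  define W where "W = R + matrix_inv Y"
  have W: "pd_mat W" unfolding W_def by (rule pd_mat_add[OF pd_imp_psd[OF R] pd_mat_inverse(3)[OF Y]])
  have lost: "m' x = m x" "V' x = V x" if "\<eta> x = 0" for x
    using that by (auto simp: m'_def V'_def K_def)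
  have sent: "m' x = m x + gain C R (V x) *v (y x - C *v m x)" "V' x = posterior_cov C R (V x)"
    if "\<eta> x = 1" "\<epsilon> x = 1" for x
    using that by (auto simp: m'_def V'_def K_def posterior_cov_def matrix_vector_mult_diff_rdistrib
        matrix_vector_mult_diff_distrib matrix_vector_mul_assoc)
  have silent: "m' x = m x - gain C W (V x) *v (C *v m x)" "V' x = posterior_cov C W (V x)"
    if "\<eta> x = 1" "\<epsilon> x = 0" for x
    using that by (auto simp: m'_def V'_def K_def W_def posterior_cov_def matrix_vector_mult_diff_rdistrib
        matrix_vector_mul_assoc)
  have sp: "space F = space M" "space F' = space M" "space H = space M"
    using sub F'(1) H(1) by (auto simp: subalgebra_def)
  have VF': "simple_function F' V" by (rule simple_function_subalg[OF F'(2) measF(2)])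
  \<comment> \<open>The gain is written with the product \<eta> \<epsilon>, since this is what the
    estimator knows; if \<eta> = 0 the factor in front removes it, and if \<eta> = 1 it equals
    \<epsilon>.\<close>
  have KF': "simple_function F' K" unfolding K_def
    using simple_function_compose2[OF simple_function_compose2[OF F'_meas(1,2), of Pair] VF',
        of "\<lambda>(a, b) p. a *\<^sub>R gain C (R + (1 - b) *\<^sub>R matrix_inv Y) p"] by simp
  have V'F': "simple_function F' V'" unfolding V'_def
    by (rule simple_function_compose2[OF VF' KF', of "\<lambda>p k. p - k ** C ** p"])
  have m'F': "m' \<in> borel_measurable F'" unfolding m'_def
    by (intro borel_measurable_add borel_measurable_simple_matrix_vector F'_meas(3)
        simple_function_compose1[OF KF'] KF' measurable_from_subalg[OF F'(2) measF(1)])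
  have psd': "psd_mat (V' x)" if w: "x \<in> space M" for x
  proof -
    consider "\<eta> x = 0" | "\<eta> x = 1" "\<epsilon> x = 0" | "\<eta> x = 1" "\<epsilon> x = 1" using vals[OF w] by auto
    then show ?thesis
      by cases (simp_all add: lost sent silent psd[OF w] psd_posterior_cov[OF psd[OF w]] W R)
  qed
  have null: "cond_null M F' (\<lambda>x. cis (u \<bullet> X x) - gauss_cf u (m' x) (V' x))" for u
  proof (rule cond_nullI[OF F'(1)])
    define D where "D m V x = cis (u \<bullet> X x) - gauss_cf u m V" for m V x
    have Dm: "(\<lambda>x. D (m0 x) (V0 x) x) \<in> borel_measurable N"
      if "X \<in> borel_measurable N" "m0 \<in> borel_measurable N" "simple_function N V0" for N m0 V0
      unfolding D_def using that by (rule borel_measurable_cis_diff_gauss_cf)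
    have Db: "norm (D m V x) \<le> 2" if "psd_mat V" for m V x
      unfolding D_def by (rule norm_cis_diff_gauss_cf_le[OF that])
    have "integrable M (\<lambda>x. D (m' x) (V' x) x)"
      using Db[OF psd'] Dm[OF measM(1) measurable_from_subalg[OF F'(1) m'F'] simple_function_subalg[OF F'(1) V'F']]
      by (intro integrable_const_bound[where B = 2]) auto
    then show "integrable M (\<lambda>x. cis (u \<bullet> X x) - gauss_cf u (m' x) (V' x))"
      unfolding D_def .
    fix B assume B: "B \<in> sets F'"
    obtain A0 where A0: "A0 \<in> sets F" "\<And>x. x \<in> space M \<Longrightarrow> \<eta> x = 0 \<Longrightarrow> x \<in> B \<longleftrightarrow> x \<in> A0"
      using trace_lost[OF B] by blast
    obtain A1 where A1: "A1 \<in> sets F" "\<And>x. x \<in> space M \<Longrightarrow> \<eta> x = 1 \<Longrightarrow> \<epsilon> x = 0 \<Longrightarrow> x \<in> B \<longleftrightarrow> x \<in> A1"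
      using trace_silent[OF B] by blast
    obtain A2 where A2: "A2 \<in> sets (join_gen M F y)" "\<And>x. x \<in> space M \<Longrightarrow> \<eta> x = 1 \<Longrightarrow> \<epsilon> x = 1 \<Longrightarrow> x \<in> B \<longleftrightarrow> x \<in> A2"
      using trace_sent[OF B] by blast
    have FH: "sets F \<subseteq> sets H" using H(2) by (auto simp: subalgebra_def)
    have JH: "sets (join_gen M F y) \<subseteq> sets H"
    proof -
      have "gen_sets M y \<subseteq> sets H" by (rule gen_sets_subset_sets[OF H(4) sp(3)])
      then show ?thesis unfolding sets_join_gen[OF sub y_meas]
        using FH sets.sigma_sets_subset[of "sets F \<union> gen_sets M y" H] by (simp add: sp)
    qed
    have VH: "simple_function H V" and mH: "m \<in> borel_measurable H"
      using simple_function_subalg[OF H(2) measF(2)] measurable_from_subalg[OF H(2) measF(1)] by auto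
    have b: "norm (indicator A x * D m0 V0 x) \<le> 2" if "psd_mat V0" for A x m0 V0
      using Db[OF that, of m0 x] by (auto simp: norm_mult indicator_def)
    \<comment> \<open>The integrands of the three events, extended to the whole space. They are
      \<open>H\<close>-measurable, so \<open>ind_lost\<close>, \<open>ind_silent\<close> and
      \<open>ind_sent\<close> replace the indicators of the events by constants and weights
      depending on \<open>y\<close> only.\<close>
    define f0 where "f0 x = indicator A0 x * D (m x) (V x) x" for x
    define f1 where "f1 x = indicator A1 x * D (m x - gain C W (V x) *v (C *v m x)) (posterior_cov C W (V x)) x" for x
    define f2 where "f2 x = indicator A2 x * D (m x + gain C R (V x) *v (y x - C *v m x)) (posterior_cov C R (V x)) x" for x
    have mgain: "(\<lambda>x. m x - gain C W (V x) *v (C *v m x)) \<in> borel_measurable H"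
      "(\<lambda>x. m x + gain C R (V x) *v (y x - C *v m x)) \<in> borel_measurable H"
      by (intro borel_measurable_diff borel_measurable_add borel_measurable_simple_matrix_vector
          simple_function_compose1[OF VH] mH H(4) borel_measurable_matrix_vector)+
    have f0H: "f0 \<in> borel_measurable H" and f1H: "f1 \<in> borel_measurable H" and f2H: "f2 \<in> borel_measurable H"
      unfolding f0_def f1_def f2_def using A0(1) A1(1) A2(1) FH JH
      by (auto intro!: borel_measurable_times borel_measurable_indicator Dm H(3) mH VH mgain simple_function_compose1[OF VH])
    have f0b: "norm (f0 x) \<le> 2" and f1b: "norm (f1 x) \<le> 2" and f2b: "norm (f2 x) \<le> 2" if "x \<in> space M" for x
      unfolding f0_def f1_def f2_def using psd[OF that] psd_posterior_cov[OF psd[OF that]] W R by (auto intro!: b)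
    have J: "subalgebra M (join_gen M F y)" by (rule subalgebra_join_gen[OF sub y_meas])
    have z0: "(\<integral>x. of_real (1 - \<eta> x) * f0 x \<partial>M) = 0"
    proof -
      have "(\<integral>x. f0 x \<partial>M) = 0" unfolding f0_def D_def
        by (rule cond_nullD[OF cond_gaussD(5)[OF prior], where c = 1]) (use A0(1) in \<open>auto simp: indicator_def\<close>)
      then show ?thesis using ind_lost[OF f0H f0b] by simp
    qed
    have z1: "(\<integral>x. of_real (\<eta> x * (1 - \<epsilon> x)) * f1 x \<partial>M) = 0"
    proof -
      have "(\<integral>x. indicator A1 x * (of_real (q x) * D (m x - gain C W (V x) *v (C *v m x)) (posterior_cov C W (V x)) x) \<partial>M) = 0"
        unfolding D_def q_def W_def
        by (rule cond_nullD[OF cond_null_silent[OF Y], where c = 1]) (use A1(1) in \<open>auto simp: indicator_def\<close>)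
      then have "(\<integral>x. of_real (q x) * f1 x \<partial>M) = 0"
        unfolding f1_def by (simp only: mult.left_commute)
      then show ?thesis using ind_silent[OF f1H f1b] by simp
    qed
    have z2: "(\<integral>x. of_real (\<eta> x * \<epsilon> x) * f2 x \<partial>M) = 0"
    proof -
      \<comment> \<open>The weight of transmission is a bounded function of \<open>y\<close>, hence
        an admissible test function over the join: this is why the event adds no information once
        \<open>y\<close> is known.\<close>
      have "(\<integral>x. (of_real (1 - q x) * indicator A2 x) * D (m x + gain C R (V x) *v (y x - C *v m x)) (posterior_cov C R (V x)) x \<partial>M) = 0"
        unfolding D_def
      proof (rule cond_nullD[OF cond_null_observed, where c = 1])
        have [measurable]: "y \<in> borel_measurable (join_gen M F y)" by (rule measurable_join_gen[OF sub y_meas])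
        show "(\<lambda>x. complex_of_real (1 - q x) * indicator A2 x) \<in> borel_measurable (join_gen M F y)"
          unfolding q_def using A2(1) by measurable
        show "norm (complex_of_real (1 - q x) * indicator A2 x) \<le> 1" for x
        proof -
          have "0 \<le> 1 - q x" "1 - q x \<le> 1"
            using exp_psd_le_1[OF pd_imp_psd[OF Y], of "y x"] by (auto simp: q_def)
          then show ?thesis by (simp add: norm_mult indicator_def del: of_real_diff)
        qed
      qed
      then have "(\<integral>x. of_real (1 - q x) * f2 x \<partial>M) = 0"
        unfolding f2_def by (simp only: mult.assoc)
      then show ?thesis using ind_sent[OF f2H f2b] by simp
    qed
    have eta_M: "\<eta> \<in> borel_measurable M"
      by (rule measurable_from_subalg[OF F'(1) borel_measurable_simple_function[OF F'_meas(1)]])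
    have int: "integrable M (\<lambda>x. complex_of_real (g x) * f x)"
      if f: "f \<in> borel_measurable H" "\<And>x. x \<in> space M \<Longrightarrow> norm (f x) \<le> 2"
        and g: "g \<in> borel_measurable M" "\<And>x. x \<in> space M \<Longrightarrow> g x \<in> {0, 1}" for f and g :: "'a \<Rightarrow> real"
    proof (rule integrable_bounded_mult[where c = 1])
      show "integrable M f"
        using f(2) by (intro integrable_const_bound[where B = 2] measurable_from_subalg[OF H(1) f(1)]) auto
    qed (use g in fastforce)+
    note [measurable] = eta_M eps_meas
    have i0: "integrable M (\<lambda>x. of_real (1 - \<eta> x) * f0 x)"
      using vals by (intro int[OF f0H f0b]) (measurable, fastforce)
    have i1: "integrable M (\<lambda>x. of_real (\<eta> x * (1 - \<epsilon> x)) * f1 x)"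
      using vals by (intro int[OF f1H f1b]) (measurable, fastforce)
    have i2: "integrable M (\<lambda>x. of_real (\<eta> x * \<epsilon> x) * f2 x)"
      using vals by (intro int[OF f2H f2b]) (measurable, fastforce)
    have "(\<integral>x\<in>B. D (m' x) (V' x) x \<partial>M) = (\<integral>x. of_real (1 - \<eta> x) * f0 x +
      of_real (\<eta> x * (1 - \<epsilon> x)) * f1 x + of_real (\<eta> x * \<epsilon> x) * f2 x \<partial>M)"
      unfolding set_lebesgue_integral_def
    proof (rule Bochner_Integration.integral_cong[OF refl])
      fix x assume w: "x \<in> space M"
      consider "\<eta> x = 0" | "\<eta> x = 1" "\<epsilon> x = 0" | "\<eta> x = 1" "\<epsilon> x = 1" using vals[OF w] by auto
      then show "indicator B x *\<^sub>R D (m' x) (V' x) x = of_real (1 - \<eta> x) * f0 x +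
        of_real (\<eta> x * (1 - \<epsilon> x)) * f1 x + of_real (\<eta> x * \<epsilon> x) * f2 x"
      proof cases
        case 1
        then show ?thesis using A0(2)[OF w 1] by (simp add: f0_def lost indicator_def)
      next
        case 2
        then show ?thesis using A1(2)[OF w 2] by (simp add: f1_def silent indicator_def)
      next
        case 3
        then show ?thesis using A2(2)[OF w 3] by (simp add: f2_def sent indicator_def)
      qed
    qed
    also have "\<dots> = 0"
      using Bochner_Integration.integral_add[OF Bochner_Integration.integrable_add[OF i0 i1] i2]
        Bochner_Integration.integral_add[OF i0 i1] z0 z1 z2 by simp
    finally show "(\<integral>x\<in>B. (cis (u \<bullet> X x) - gauss_cf u (m' x) (V' x)) \<partial>M) = 0"
      unfolding D_def .
  qed
  have "cond_gauss M F' X m' V'"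
    unfolding cond_gauss_def using null psd' V'F' m'F' measM(1) by blast
  then show ?thesis unfolding m'_def V'_def .
qed

section \<open>Independent sources and the information of the estimator\<close>

definition src_sigma :: "'a measure \<Rightarrow> ('i \<Rightarrow> 'a set set) \<Rightarrow> 'i set \<Rightarrow> 'a measure" where
  "src_sigma M E S = sigma (space M) (\<Union>s\<in>S. E s)"

text \<open>Grouping an independent family of pi-systems into two disjoint blocks yields independent
  generated sigma-algebras.\<close>

lemma (in prob_space) indep_var_disjoint_sources:
  assumes E: "indep_sets E UNIV" "\<And>i. Int_stable (E i)" and disj: "S \<inter> S' = {}"
    and X: "X \<in> measurable (src_sigma M E S) N1" and Z: "Z \<in> measurable (src_sigma M E S') N2"
  shows "indep_var N1 X N2 Z"
proof -
  have ev: "E i \<subseteq> events" for i using E(1) by (auto simp: indep_sets_def)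
  have pow: "(\<Union>s\<in>S. E s) \<subseteq> Pow (space M)" for S using ev sets.space_closed by blast
  have sets: "sets (src_sigma M E S) = sigma_sets (space M) (\<Union>s\<in>S. E s)"
    and space: "space (src_sigma M E S) = space M" for S
    unfolding src_sigma_def using pow by auto
  have "subalgebra M (src_sigma M E S)" for S
    unfolding subalgebra_def sets space using ev by (intro conjI refl sets.sigma_sets_subset) auto
  then have rv: "random_variable N1 X" "random_variable N2 Z"
    using X Z measurable_from_subalg by blast+
  have "indep_sets (\<lambda>j. sigma_sets (space M) (\<Union>i\<in>case_bool S S' j. E i)) UNIV"
    using E disj by (intro indep_sets_collect_sigma)
      (auto intro: indep_sets_mono_index simp: disjoint_family_on_def split: bool.splits)
  then have ind: "indep_set (sets (src_sigma M E S)) (sets (src_sigma M E S'))"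
    unfolding indep_set_def sets by (rule indep_sets_mono_sets) (auto split: bool.splits)
  have "sigma_sets (space M) {X -` A \<inter> space M | A. A \<in> sets N1} \<subseteq> sets (src_sigma M E S)"
    unfolding space[of S, symmetric] by (rule sets.sigma_sets_subset) (auto intro: measurable_sets[OF X])
  moreover have "sigma_sets (space M) {Z -` A \<inter> space M | A. A \<in> sets N2} \<subseteq> sets (src_sigma M E S')"
    unfolding space[of S', symmetric] by (rule sets.sigma_sets_subset) (auto intro: measurable_sets[OF Z])
  ultimately have "indep_set (sigma_sets (space M) {X -` A \<inter> space M | A. A \<in> sets N1})
      (sigma_sets (space M) {Z -` A \<inter> space M | A. A \<in> sets N2})"
    using ind unfolding indep_sets2_eq by (meson subset_iff)
  then show ?thesis
    unfolding indep_var_eq using rv by blast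
qed

text \<open>Freezing lemma: under independence the joint law is a product measure, so
  \<open>X\<close> can be held fixed while \<open>Z\<close> is integrated out.\<close>

lemma (in prob_space) indep_var_integral_iterated:
  fixes h :: "_ \<Rightarrow> complex"
  assumes ind: "indep_var N1 X N2 Z" and h: "h \<in> borel_measurable (N1 \<Otimes>\<^sub>M N2)"
    and int: "integrable M (\<lambda>x. h (X x, Z x))"
  shows "(\<integral>x. h (X x, Z x) \<partial>M) = (\<integral>x. (\<integral>x'. h (X x, Z x') \<partial>M) \<partial>M)"
proof -
  have X[measurable]: "X \<in> measurable M N1" and Z[measurable]: "Z \<in> measurable M N2"
    and d: "distr M (N1 \<Otimes>\<^sub>M N2) (\<lambda>x. (X x, Z x)) = distr M N1 X \<Otimes>\<^sub>M distr M N2 Z"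
    using ind unfolding indep_var_distribution_eq by auto
  interpret D1: prob_space "distr M N1 X" by (rule prob_space_distr) fact
  interpret D2: prob_space "distr M N2 Z" by (rule prob_space_distr) fact
  interpret D: pair_prob_space "distr M N1 X" "distr M N2 Z" ..
  have hi: "integrable (distr M N1 X \<Otimes>\<^sub>M distr M N2 Z) h"
    unfolding d[symmetric] using h int by (subst integrable_distr_eq) auto
  have "(\<integral>x. h (X x, Z x) \<partial>M) = (\<integral>p. h p \<partial>(distr M N1 X \<Otimes>\<^sub>M distr M N2 Z))"
    unfolding d[symmetric] using h by (subst integral_distr) auto
  also have "\<dots> = (\<integral>a. (\<integral>b. h (a, b) \<partial>distr M N2 Z) \<partial>distr M N1 X)"
    using D.integral_fst[of "\<lambda>a b. h (a, b)"] hi by simp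
  also have "\<dots> = (\<integral>a. (\<integral>x'. h (a, Z x') \<partial>M) \<partial>distr M N1 X)"
    using h by (intro Bochner_Integration.integral_cong refl integral_distr) (auto simp: space_distr)
  also have "\<dots> = (\<integral>x. (\<integral>x'. h (X x, Z x') \<partial>M) \<partial>M)"
    using h by (intro integral_distr borel_measurable_lebesgue_integral) auto
  finally show ?thesis .
qed

lemma centered_gaussian_cis_integral:
  assumes X: "centered_gaussian M X S" and S: "psd_mat S"
  shows "(\<integral>x. cis (u \<bullet> X x) \<partial>M) = complex_of_real (quad_exp S u)"
proof -
  have [measurable]: "X \<in> borel_measurable M" using X by (simp add: centered_gaussian_def)
  have d: "distr M borel (\<lambda>x. u \<bullet> X x) = (if u \<bullet> (S *v u) = 0 then return borel 0
         else density lborel (normal_density 0 (sqrt (u \<bullet> (S *v u)))))"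
    using X by (simp add: centered_gaussian_def)
  have "(\<integral>x. cis (u \<bullet> X x) \<partial>M) = (\<integral>s. cis s \<partial>distr M borel (\<lambda>x. u \<bullet> X x))"
    by (rule integral_distr[symmetric]) measurable
  also have "\<dots> = complex_of_real (quad_exp S u)"
  proof (cases "u \<bullet> (S *v u) = 0")
    case True
    then show ?thesis unfolding d by (simp add: integral_return)
  next
    case False
    then have "u \<bullet> (S *v u) > 0" using psd_matD(2)[OF S, of u] by simp
    then show ?thesis unfolding d 
      using False cis_integral_normal[where \<sigma> = "sqrt (u \<bullet> (S *v u))" and t = 1 and \<mu> = 0] by simp
  qed
  finally show ?thesis .
qed

lemma Int_stable_gen_sets: "Int_stable (gen_sets M f)"
proof (rule Int_stableI)
  fix a b assume "a \<in> gen_sets M f" "b \<in> gen_sets M f"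
  then obtain P Q where "a = f -` P \<inter> space M" "b = f -` Q \<inter> space M" "P \<in> sets borel" "Q \<in> sets borel"
    unfolding gen_sets_def by blast
  then have "a \<inter> b = f -` (P \<inter> Q) \<inter> space M" "P \<inter> Q \<in> sets borel" by auto
  then show "a \<inter> b \<in> gen_sets M f" unfolding gen_sets_def by blast
qed

text \<open>Good sets principle: the sets that agree on p with a set of \<open>N\<close> are closed
  under complements and countable unions.\<close>

lemma sigma_sets_trace:
  assumes gen: "\<And>g. g \<in> G \<Longrightarrow> \<exists>A\<in>sets N. \<forall>x\<in>space N. p x \<longrightarrow> (x \<in> g \<longleftrightarrow> x \<in> A)"
    and B: "B \<in> sigma_sets (space N) G"
  shows "\<exists>A\<in>sets N. \<forall>x\<in>space N. p x \<longrightarrow> (x \<in> B \<longleftrightarrow> x \<in> A)"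
  using B
proof induction
  case (Basic a) then show ?case by (rule gen)
next
  case Empty then show ?case by (intro bexI[of _ "{}"]) auto
next
  case (Compl a)
  then obtain A where "A \<in> sets N" "\<forall>x\<in>space N. p x \<longrightarrow> (x \<in> a \<longleftrightarrow> x \<in> A)" by blast
  then show ?case by (intro bexI[of _ "space N - A"]) auto
next
  case (Union a)
  then obtain A where "\<And>i. A i \<in> sets N" "\<And>i. \<forall>x\<in>space N. p x \<longrightarrow> (x \<in> a i \<longleftrightarrow> x \<in> A i)" by metis
  then show ?case by (intro bexI[of _ "\<Union>i. A i"]) auto
qed

section \<open>The information sigma-algebra and its traces on events\<close>

lemma space_info: "space (info M \<eta> \<epsilon> y k) = space M"
  and sets_info: "sets (info M \<eta> \<epsilon> y k) = sigma_sets (space M)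
     (\<Union>j\<in>{..<k}. gen_sets M (\<eta> j) \<union> gen_sets M (\<lambda>x. \<eta> j x * \<epsilon> j x)
                  \<union> gen_sets M (\<lambda>x. (\<eta> j x * \<epsilon> j x) *\<^sub>R y j x))"
proof -
  have "(\<Union>j\<in>{..<k}. gen_sets M (\<eta> j) \<union> gen_sets M (\<lambda>x. \<eta> j x * \<epsilon> j x)
      \<union> gen_sets M (\<lambda>x. (\<eta> j x * \<epsilon> j x) *\<^sub>R y j x)) \<subseteq> Pow (space M)"
    by (auto simp: gen_sets_def)
  then show "space (info M \<eta> \<epsilon> y k) = space M"
    "sets (info M \<eta> \<epsilon> y k) = sigma_sets (space M)
     (\<Union>j\<in>{..<k}. gen_sets M (\<eta> j) \<union> gen_sets M (\<lambda>x. \<eta> j x * \<epsilon> j x)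
                  \<union> gen_sets M (\<lambda>x. (\<eta> j x * \<epsilon> j x) *\<^sub>R y j x))"
    unfolding info_def by auto
qed

lemma measurable_info:
  assumes "j < k"
  shows "\<eta> j \<in> borel_measurable (info M \<eta> \<epsilon> y k)"
    "(\<lambda>x. \<eta> j x * \<epsilon> j x) \<in> borel_measurable (info M \<eta> \<epsilon> y k)"
    "(\<lambda>x. (\<eta> j x * \<epsilon> j x) *\<^sub>R y j x) \<in> borel_measurable (info M \<eta> \<epsilon> y k)"
proof -
  have "gen_sets M (\<eta> j) \<union> gen_sets M (\<lambda>x. \<eta> j x * \<epsilon> j x)
    \<union> gen_sets M (\<lambda>x. (\<eta> j x * \<epsilon> j x) *\<^sub>R y j x) \<subseteq> sets (info M \<eta> \<epsilon> y k)"
    unfolding sets_info using assms by (intro subsetI sigma_sets.Basic UN_I[of j]) simp_all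
  then show "\<eta> j \<in> borel_measurable (info M \<eta> \<epsilon> y k)"
    "(\<lambda>x. \<eta> j x * \<epsilon> j x) \<in> borel_measurable (info M \<eta> \<epsilon> y k)"
    "(\<lambda>x. (\<eta> j x * \<epsilon> j x) *\<^sub>R y j x) \<in> borel_measurable (info M \<eta> \<epsilon> y k)"
    by (simp_all add: measurable_gen_sets[of M] space_info)
qed

lemma subalgebra_info:
  assumes "space N = space M"
    and "\<And>j. j < k \<Longrightarrow> \<eta> j \<in> borel_measurable N"
    "\<And>j. j < k \<Longrightarrow> (\<lambda>x. \<eta> j x * \<epsilon> j x) \<in> borel_measurable N"
    "\<And>j. j < k \<Longrightarrow> (\<lambda>x. (\<eta> j x * \<epsilon> j x) *\<^sub>R y j x) \<in> borel_measurable N"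
  shows "subalgebra N (info M \<eta> \<epsilon> y k)"
proof -
  have "(\<Union>j\<in>{..<k}. gen_sets M (\<eta> j) \<union> gen_sets M (\<lambda>x. \<eta> j x * \<epsilon> j x)
      \<union> gen_sets M (\<lambda>x. (\<eta> j x * \<epsilon> j x) *\<^sub>R y j x)) \<subseteq> sets N"
    using assms by (intro UN_least Un_least gen_sets_subset_sets) auto
  from sets.sigma_sets_subset[OF this] show ?thesis
    unfolding subalgebra_def space_info sets_info by (simp add: assms(1))
qed

lemma gen_sets_trace:
  assumes a: "a \<in> gen_sets M f" and g: "g \<in> borel_measurable N" and N: "space N = space M"
    and eq: "\<And>x. x \<in> space M \<Longrightarrow> p x \<Longrightarrow> f x = g x"
  shows "\<exists>A\<in>sets N. \<forall>x\<in>space N. p x \<longrightarrow> (x \<in> a \<longleftrightarrow> x \<in> A)"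
proof -
  obtain P where P: "a = f -` P \<inter> space M" "P \<in> sets borel" using a unfolding gen_sets_def by blast
  show ?thesis
    using measurable_sets[OF g P(2)] eq P(1) N by (intro bexI[of _ "g -` P \<inter> space N"]) auto
qed

text \<open>Where the three variables of step k coincide with \<open>N\<close>-measurable functions,
  they contribute nothing beyond \<open>N\<close>. The functions are constants on loss and silence
  and involve \<open>y k\<close> on transmission.\<close>

lemma info_Suc_trace:
  assumes N: "space N = space M" "subalgebra N (info M \<eta> \<epsilon> y k)"
    and g: "g1 \<in> borel_measurable N" "g2 \<in> borel_measurable N" "g3 \<in> borel_measurable N"
    and eq: "\<And>x. x \<in> space M \<Longrightarrow> p x \<Longrightarrow> \<eta> k x = g1 x"
      "\<And>x. x \<in> space M \<Longrightarrow> p x \<Longrightarrow> \<eta> k x * \<epsilon> k x = g2 x"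
      "\<And>x. x \<in> space M \<Longrightarrow> p x \<Longrightarrow> (\<eta> k x * \<epsilon> k x) *\<^sub>R y k x = g3 x"
    and B: "B \<in> sets (info M \<eta> \<epsilon> y (Suc k))"
  shows "\<exists>A\<in>sets N. \<forall>x\<in>space M. p x \<longrightarrow> (x \<in> B \<longleftrightarrow> x \<in> A)"
proof -
  show ?thesis
    unfolding N(1)[symmetric]
  proof (rule sigma_sets_trace)
    show "B \<in> sigma_sets (space N) (\<Union>j\<in>{..<Suc k}. gen_sets M (\<eta> j) \<union> gen_sets M (\<lambda>x. \<eta> j x * \<epsilon> j x)
       \<union> gen_sets M (\<lambda>x. (\<eta> j x * \<epsilon> j x) *\<^sub>R y j x))"
      using B by (simp only: sets_info N(1))
    fix a assume "a \<in> (\<Union>j\<in>{..<Suc k}. gen_sets M (\<eta> j) \<union> gen_sets M (\<lambda>x. \<eta> j x * \<epsilon> j x)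
       \<union> gen_sets M (\<lambda>x. (\<eta> j x * \<epsilon> j x) *\<^sub>R y j x))"
    then consider (old) j where "j < k" "a \<in> gen_sets M (\<eta> j) \<union> gen_sets M (\<lambda>x. \<eta> j x * \<epsilon> j x)
       \<union> gen_sets M (\<lambda>x. (\<eta> j x * \<epsilon> j x) *\<^sub>R y j x)"
      | (n1) "a \<in> gen_sets M (\<eta> k)" | (n2) "a \<in> gen_sets M (\<lambda>x. \<eta> k x * \<epsilon> k x)"
      | (n3) "a \<in> gen_sets M (\<lambda>x. (\<eta> k x * \<epsilon> k x) *\<^sub>R y k x)"
      by (auto simp: less_Suc_eq)
    then show "\<exists>A\<in>sets N. \<forall>x\<in>space N. p x \<longrightarrow> (x \<in> a \<longleftrightarrow> x \<in> A)"
    proof cases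
      case old
      then have "a \<in> sets (info M \<eta> \<epsilon> y k)" unfolding sets_info by (intro sigma_sets.Basic) auto
      then have "a \<in> sets N" using N(2) by (auto simp: subalgebra_def)
      then show ?thesis by blast
    next
      case n1 then show ?thesis using g(1) N(1) eq(1) by (rule gen_sets_trace)
    next
      case n2 then show ?thesis using g(2) N(1) eq(2) by (rule gen_sets_trace)
    next
      case n3 then show ?thesis using g(3) N(1) eq(3) by (rule gen_sets_trace)
    qed
  qed
qed

section \<open>The filter\<close>

locale remote_estimation = prob_space M for M :: "'a measure" +
  fixes A Q \<Sigma> :: "real^'n^'n" and C :: "real^'n^'m" and R Y :: "real^'m^'m"
    and x w :: "nat \<Rightarrow> 'a \<Rightarrow> real^'n" and y v :: "nat \<Rightarrow> 'a \<Rightarrow> real^'m"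
    and \<eta> \<zeta> \<epsilon> :: "nat \<Rightarrow> 'a \<Rightarrow> real" and lam :: real
  assumes Qpsd: "psd_mat Q" and Rpd: "pd_mat R" and Ypd: "pd_mat Y" and Sigma_psd: "psd_mat \<Sigma>"
    and x_succ: "\<And>k \<omega>. x (Suc k) \<omega> = A *v x k \<omega> + w k \<omega>"
    and y_def: "\<And>k \<omega>. y k \<omega> = C *v x k \<omega> + v k \<omega>"
    and x0_gauss: "centered_gaussian M (x 0) \<Sigma>"
    and w_gauss: "\<And>k. centered_gaussian M (w k) Q"
    and v_gauss: "\<And>k. centered_gaussian M (v k) R"
    and eta_meas [measurable]: "\<And>k. \<eta> k \<in> borel_measurable M"
    and eta_vals: "\<And>k \<omega>. \<omega> \<in> space M \<Longrightarrow> \<eta> k \<omega> \<in> {0, 1}"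
    and eta_prob: "\<And>k. measure M {\<omega> \<in> space M. \<eta> k \<omega> = 1} = lam"
    and zeta_meas [measurable]: "\<And>k. \<zeta> k \<in> borel_measurable M"
    and zeta_unif: "\<And>k. distr M lborel (\<zeta> k) = uniform_measure lborel {0..1}"
    and indep: "indep_sets
         (\<lambda>s. case s of SX0 \<Rightarrow> gen_sets M (x 0)
                      | SW k \<Rightarrow> gen_sets M (w k)
                      | SV k \<Rightarrow> gen_sets M (v k)
                      | SEta k \<Rightarrow> gen_sets M (\<eta> k)
                      | SZeta k \<Rightarrow> gen_sets M (\<zeta> k)) UNIV"
    and eps_def: "\<And>k \<omega>. \<epsilon> k \<omega> =
         (if \<zeta> k \<omega> > exp (- (1/2) * (y k \<omega> \<bullet> (Y *v y k \<omega>))) then 1 else 0)"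
begin

section \<open>Measurability with respect to groups of sources\<close>

definition src_gen :: "src \<Rightarrow> 'a set set" where
  "src_gen s = (case s of SX0 \<Rightarrow> gen_sets M (x 0)
                      | SW k \<Rightarrow> gen_sets M (w k)
                      | SV k \<Rightarrow> gen_sets M (v k)
                      | SEta k \<Rightarrow> gen_sets M (\<eta> k)
                      | SZeta k \<Rightarrow> gen_sets M (\<zeta> k))"

abbreviation G :: "src set \<Rightarrow> 'a measure" where
  "G S \<equiv> src_sigma M src_gen S"

abbreviation I :: "nat \<Rightarrow> 'a measure" where
  "I k \<equiv> info M \<eta> \<epsilon> y k"

text \<open>Two counters, because the state runs ahead of the data: a process noises determine the
  states up to time a, while b counts the completed steps of measurement, channel and
  scheduler.\<close>

definition sources :: "nat \<Rightarrow> nat \<Rightarrow> src set" where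
  "sources a b = {SX0} \<union> SW ` {..<a} \<union> SV ` {..<b} \<union> SEta ` {..<b} \<union> SZeta ` {..<b}"

lemma src_gen_indep: "indep_sets src_gen UNIV"
  using indep unfolding src_gen_def .

lemma Int_stable_src_gen: "Int_stable (src_gen s)"
  by (cases s) (simp_all add: src_gen_def Int_stable_gen_sets)

lemma src_gen_events: "src_gen s \<subseteq> sets M"
  using src_gen_indep by (auto simp: indep_sets_def)

lemma space_G: "space (G S) = space M" and sets_G: "sets (G S) = sigma_sets (space M) (\<Union>s\<in>S. src_gen s)"
proof -
  have "(\<Union>s\<in>S. src_gen s) \<subseteq> Pow (space M)" using src_gen_events sets.space_closed by blast
  then show "space (G S) = space M" "sets (G S) = sigma_sets (space M) (\<Union>s\<in>S. src_gen s)"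
    unfolding src_sigma_def by auto
qed

lemma subalgebra_G: "subalgebra M (G S)"
  unfolding subalgebra_def space_G sets_G using src_gen_events
  by (intro conjI refl sets.sigma_sets_subset) auto

lemma src_gen_G: "s \<in> S \<Longrightarrow> src_gen s \<subseteq> sets (G S)"
  unfolding sets_G by (intro subsetI sigma_sets.Basic UN_I)

lemma source_measurable_G:
  "SX0 \<in> S \<Longrightarrow> x 0 \<in> borel_measurable (G S)"
  "SW k \<in> S \<Longrightarrow> w k \<in> borel_measurable (G S)"
  "SV k \<in> S \<Longrightarrow> v k \<in> borel_measurable (G S)"
  "SEta k \<in> S \<Longrightarrow> \<eta> k \<in> borel_measurable (G S)"
  "SZeta k \<in> S \<Longrightarrow> \<zeta> k \<in> borel_measurable (G S)"
  using src_gen_G[of SX0 S] src_gen_G[of "SW k" S] src_gen_G[of "SV k" S] src_gen_G[of "SEta k" S] src_gen_G[of "SZeta k" S]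
  by (simp_all add: src_gen_def measurable_gen_sets[of M] space_G)

lemma x_measurable_G: "sources a b \<subseteq> S \<Longrightarrow> k \<le> a \<Longrightarrow> x k \<in> borel_measurable (G S)"
proof (induction k)
  case 0 then show ?case by (intro source_measurable_G) (auto simp: sources_def)
next
  case (Suc k)
  then have [measurable]: "x k \<in> borel_measurable (G S)" "w k \<in> borel_measurable (G S)"
    by (auto intro!: source_measurable_G(2) simp: sources_def)
  have "(\<lambda>\<omega>. A *v x k \<omega> + w k \<omega>) \<in> borel_measurable (G S)" by measurable
  then show ?case by (simp add: x_succ[abs_def])
qed

lemma y_measurable_G: "sources a b \<subseteq> S \<Longrightarrow> k \<le> a \<Longrightarrow> SV k \<in> S \<Longrightarrow> y k \<in> borel_measurable (G S)"
proof -
  assume "sources a b \<subseteq> S" "k \<le> a" "SV k \<in> S"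
  then have [measurable]: "x k \<in> borel_measurable (G S)" "v k \<in> borel_measurable (G S)"
    by (auto intro!: source_measurable_G(3) x_measurable_G)
  have "(\<lambda>\<omega>. C *v x k \<omega> + v k \<omega>) \<in> borel_measurable (G S)" by measurable
  then show ?thesis by (simp add: y_def[abs_def])
qed

lemma eps_measurable_G:
  "sources a b \<subseteq> S \<Longrightarrow> k \<le> a \<Longrightarrow> SV k \<in> S \<Longrightarrow> SZeta k \<in> S \<Longrightarrow> \<epsilon> k \<in> borel_measurable (G S)"
proof -
  assume "sources a b \<subseteq> S" "k \<le> a" "SV k \<in> S" "SZeta k \<in> S"
  then have [measurable]: "y k \<in> borel_measurable (G S)" "\<zeta> k \<in> borel_measurable (G S)"
    by (auto intro!: source_measurable_G(5) y_measurable_G)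
  have "(\<lambda>\<omega>. if \<zeta> k \<omega> > exp (- (1/2) * (y k \<omega> \<bullet> (Y *v y k \<omega>))) then 1 else 0 :: real) \<in> borel_measurable (G S)"
    by measurable
  then show ?thesis by (simp add: eps_def[abs_def])
qed

text \<open>\<open>I k\<close> contains data of the steps j < k only, so the states up to k - 1
  suffice; hence the bound \<open>k \<le> Suc a\<close>.\<close>

lemma subalgebra_G_info:
  assumes "sources a k \<subseteq> S" "k \<le> Suc a"
  shows "subalgebra (G S) (I k)"
proof (rule subalgebra_info[OF space_G])
  fix j assume j: "j < k"
  then have "SV j \<in> S" "SEta j \<in> S" "SZeta j \<in> S" "j \<le> a" using assms by (auto simp: sources_def)
  then have [measurable]: "\<eta> j \<in> borel_measurable (G S)" "\<epsilon> j \<in> borel_measurable (G S)" "y j \<in> borel_measurable (G S)"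
    using assms(1) by (auto intro!: source_measurable_G(4) eps_measurable_G y_measurable_G)
  show "\<eta> j \<in> borel_measurable (G S)" "(\<lambda>\<omega>. \<eta> j \<omega> * \<epsilon> j \<omega>) \<in> borel_measurable (G S)"
    "(\<lambda>\<omega>. (\<eta> j \<omega> * \<epsilon> j \<omega>) *\<^sub>R y j \<omega>) \<in> borel_measurable (G S)"
    by measurable
qed

lemma subalgebra_info_M: "subalgebra M (I k)"
  using subalgebra_G_info[of k k UNIV] subalgebra_G[of UNIV] by (auto simp: subalgebra_def)

lemma x_meas [measurable]: "x k \<in> borel_measurable M"
  and y_meas [measurable]: "y k \<in> borel_measurable M"
  and eps_meas [measurable]: "\<epsilon> k \<in> borel_measurable M"
  and w_meas [measurable]: "w k \<in> borel_measurable M"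
  and v_meas [measurable]: "v k \<in> borel_measurable M"
  using x_measurable_G[of k k UNIV k] y_measurable_G[of k k UNIV k] eps_measurable_G[of k k UNIV k]
    source_measurable_G(2,3)[of k UNIV]
  by (auto intro: measurable_from_subalg[OF subalgebra_G])

section \<open>Integrating out one independent source\<close>

lemma integral_mult_independent:
  fixes f g :: "'a \<Rightarrow> complex"
  assumes "f \<in> borel_measurable (G S)" "\<And>\<omega>. \<omega> \<in> space M \<Longrightarrow> norm (f \<omega>) \<le> c"
    and "g \<in> borel_measurable (G {s})" "\<And>\<omega>. \<omega> \<in> space M \<Longrightarrow> norm (g \<omega>) \<le> d" and "s \<notin> S"
  shows "(\<integral>\<omega>. f \<omega> * g \<omega> \<partial>M) = (\<integral>\<omega>. f \<omega> \<partial>M) * (\<integral>\<omega>. g \<omega> \<partial>M)"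
proof (rule indep_var_lebesgue_integral)
  show "indep_var borel f borel g"
    using assms by (intro indep_var_disjoint_sources[OF src_gen_indep Int_stable_src_gen]) auto
  show "integrable M f"
    using assms(2) by (intro integrable_const_bound[where B = c] measurable_from_subalg[OF subalgebra_G assms(1)]) auto
  show "integrable M g"
    using assms(4) by (intro integrable_const_bound[where B = d] measurable_from_subalg[OF subalgebra_G assms(3)]) auto
qed

text \<open>The noise comes from a source outside the block \<open>S\<close> that carries both
  \<open>F\<close> and \<open>X\<close>; used for the measurement noise and for the process
  noise.\<close>

lemma noise_independent:
  assumes w: "centered_gaussian M w' W" and W: "psd_mat W" and wG: "w' \<in> borel_measurable (G {s})"
    and S: "s \<notin> S" and F: "subalgebra (G S) F" and X: "X \<in> borel_measurable (G S)"
    and g: "cond_gauss M F X m V" and sub: "subalgebra M F"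
  shows "cond_null M F (\<lambda>\<omega>. cis (u \<bullet> X \<omega>) * cis (t \<bullet> w' \<omega>)
    - cis (u \<bullet> m \<omega>) * of_real (exp (- (u \<bullet> (V \<omega> *v u) + t \<bullet> (W *v t)) / 2)))"
proof (rule cond_null_independent_noise[OF sub g])
  show "w' \<in> borel_measurable M" using w by (simp add: centered_gaussian_def)
  show "finite_measure M" by (rule finite_measure_axioms)
  fix Z :: "'a \<Rightarrow> complex" and c assume Z: "Z \<in> borel_measurable F" "\<And>\<omega>. \<omega> \<in> space M \<Longrightarrow> norm (Z \<omega>) \<le> c"
  have [measurable]: "Z \<in> borel_measurable (G S)" by (rule measurable_from_subalg[OF F Z(1)])
  note [measurable] = X wG
  have "(\<integral>\<omega>. Z \<omega> * cis (u \<bullet> X \<omega>) * cis (t \<bullet> w' \<omega>) \<partial>M)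
     = (\<integral>\<omega>. Z \<omega> * cis (u \<bullet> X \<omega>) \<partial>M) * (\<integral>\<omega>. cis (t \<bullet> w' \<omega>) \<partial>M)"
    by (rule integral_mult_independent[where S = S and s = s and c = c and d = 1])
      (use Z(2) S in \<open>auto simp: norm_mult\<close>)
  then show "(\<integral>\<omega>. Z \<omega> * cis (u \<bullet> X \<omega>) * cis (t \<bullet> w' \<omega>) \<partial>M)
     = (\<integral>\<omega>. Z \<omega> * cis (u \<bullet> X \<omega>) \<partial>M) * of_real (quad_exp W t)"
    unfolding centered_gaussian_cis_integral[OF w W] .
qed

lemma eta_integral: "(\<integral>\<omega>. complex_of_real (\<eta> k \<omega>) \<partial>M) = complex_of_real lam"
proof -
  have "(\<integral>\<omega>. \<eta> k \<omega> \<partial>M) = (\<integral>\<omega>. indicator {\<omega> \<in> space M. \<eta> k \<omega> = 1} \<omega> \<partial>M)"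
    using eta_vals by (intro Bochner_Integration.integral_cong refl) (fastforce simp: indicator_def)
  also have "\<dots> = lam" using eta_prob[of k] by simp
  finally show ?thesis by simp
qed

lemma eta_integral_mult:
  assumes "f \<in> borel_measurable (G S)" "\<And>\<omega>. \<omega> \<in> space M \<Longrightarrow> norm (f \<omega>) \<le> c" "SEta k \<notin> S"
  shows "(\<integral>\<omega>. complex_of_real (\<eta> k \<omega>) * f \<omega> \<partial>M) = complex_of_real lam * (\<integral>\<omega>. f \<omega> \<partial>M)"
proof -
  have [measurable]: "\<eta> k \<in> borel_measurable (G {SEta k})" by (rule source_measurable_G(4)) simp
  have "(\<integral>\<omega>. f \<omega> * complex_of_real (\<eta> k \<omega>) \<partial>M) = (\<integral>\<omega>. f \<omega> \<partial>M) * (\<integral>\<omega>. complex_of_real (\<eta> k \<omega>) \<partial>M)"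
    by (rule integral_mult_independent[where S = S and s = "SEta k" and c = c and d = 1])
      (use assms eta_vals in \<open>auto dest!: eta_vals[of _ k]\<close>)
  then show ?thesis unfolding eta_integral by (simp add: mult.commute)
qed

lemma zeta_greater_integral:
  assumes "0 \<le> r" "r \<le> 1"
  shows "(\<integral>\<omega>. complex_of_real (if \<zeta> k \<omega> > r then 1 else 0) \<partial>M) = complex_of_real (1 - r)"
proof -
  have "(\<integral>\<omega>. (if \<zeta> k \<omega> > r then 1 else 0 :: real) \<partial>M) = (\<integral>\<omega>. indicator {r<..} (\<zeta> k \<omega>) \<partial>M)"
    by (intro Bochner_Integration.integral_cong refl) (simp add: indicator_def)
  also have "\<dots> = (\<integral>z. indicator {r<..} z \<partial>distr M lborel (\<zeta> k))"
    by (subst integral_distr) auto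
  also have "\<dots> = measure (uniform_measure lborel {0..1}) {r<..}"
    unfolding zeta_unif by simp
  also have "\<dots> = 1 - r"
  proof -
    have "{0..1} \<inter> {r<..} = {r<..1}" using assms by auto
    then show ?thesis using assms by (simp add: measure_uniform_measure)
  qed
  finally have "complex_of_real (\<integral>\<omega>. (if \<zeta> k \<omega> > r then 1 else 0 :: real) \<partial>M) = complex_of_real (1 - r)" by simp
  then show ?thesis by (simp only: integral_complex_of_real)
qed

text \<open>\<open>f\<close> and the threshold \<open>r\<close> do not depend on source
  \<open>SZeta k\<close>; freezing them and integrating the uniform variable alone turns the
  indicator into 1 - r.\<close>

lemma zeta_integral_mult:
  assumes f: "f \<in> borel_measurable (G S)" "\<And>\<omega>. \<omega> \<in> space M \<Longrightarrow> norm (f \<omega>) \<le> c"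
    and r: "r \<in> borel_measurable (G S)" "\<And>\<omega>. \<omega> \<in> space M \<Longrightarrow> 0 \<le> r \<omega> \<and> r \<omega> \<le> 1" and S: "SZeta k \<notin> S"
  shows "(\<integral>\<omega>. complex_of_real (if \<zeta> k \<omega> > r \<omega> then 1 else 0) * f \<omega> \<partial>M) = (\<integral>\<omega>. complex_of_real (1 - r \<omega>) * f \<omega> \<partial>M)"
proof -
  have fM[measurable]: "f \<in> borel_measurable M" "r \<in> borel_measurable M"
    by (rule measurable_from_subalg[OF subalgebra_G f(1)], rule measurable_from_subalg[OF subalgebra_G r(1)])
  define h :: "(complex \<times> real) \<times> (complex \<times> real) \<Rightarrow> complex" where
    "h p = complex_of_real (if snd (snd p) > snd (fst p) then 1 else 0) * fst (fst p)" for p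
  \<comment> \<open>\<open>indep_var\<close> needs both variables to have the same type, hence the dummy \<open>0\<close>.\<close>
  have ind: "indep_var (borel \<Otimes>\<^sub>M borel) (\<lambda>\<omega>. (f \<omega>, r \<omega>)) (borel \<Otimes>\<^sub>M borel) (\<lambda>\<omega>. (0, \<zeta> k \<omega>))"
  proof (rule indep_var_disjoint_sources[OF src_gen_indep Int_stable_src_gen, where S = S and S' = "{SZeta k}"])
    show "(\<lambda>\<omega>. (f \<omega>, r \<omega>)) \<in> G S \<rightarrow>\<^sub>M borel \<Otimes>\<^sub>M borel" using f(1) r(1) by (rule measurable_Pair)
    show "(\<lambda>\<omega>. (0, \<zeta> k \<omega>)) \<in> G {SZeta k} \<rightarrow>\<^sub>M borel \<Otimes>\<^sub>M borel"
      by (intro measurable_Pair measurable_const source_measurable_G(5)) auto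
  qed (use S in auto)
  have "(\<integral>\<omega>. h ((f \<omega>, r \<omega>), (0, \<zeta> k \<omega>)) \<partial>M) = (\<integral>\<omega>. (\<integral>\<omega>'. h ((f \<omega>, r \<omega>), (0, \<zeta> k \<omega>')) \<partial>M) \<partial>M)"
  proof (rule indep_var_integral_iterated[OF ind])
    show "h \<in> borel_measurable ((borel \<Otimes>\<^sub>M borel) \<Otimes>\<^sub>M (borel \<Otimes>\<^sub>M borel))" unfolding h_def by measurable
    show "integrable M (\<lambda>\<omega>. h ((f \<omega>, r \<omega>), (0, \<zeta> k \<omega>)))"
    proof (rule integrable_const_bound[where B = c])
      show "AE \<omega> in M. norm (h ((f \<omega>, r \<omega>), (0, \<zeta> k \<omega>))) \<le> c"
        using f(2) by (intro AE_I2) (auto simp: h_def norm_mult intro: order_trans[OF norm_ge_zero])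
      show "(\<lambda>\<omega>. h ((f \<omega>, r \<omega>), (0, \<zeta> k \<omega>))) \<in> borel_measurable M"
        unfolding h_def fst_conv snd_conv by measurable
    qed
  qed
  also have "\<dots> = (\<integral>\<omega>. complex_of_real (1 - r \<omega>) * f \<omega> \<partial>M)"
  proof (rule Bochner_Integration.integral_cong[OF refl])
    fix \<omega> assume "\<omega> \<in> space M"
    then have "(\<integral>\<omega>'. complex_of_real (if \<zeta> k \<omega>' > r \<omega> then 1 else 0) \<partial>M) = complex_of_real (1 - r \<omega>)"
      using r(2) by (intro zeta_greater_integral) auto
    then show "(\<integral>\<omega>'. h ((f \<omega>, r \<omega>), (0, \<zeta> k \<omega>')) \<partial>M) = complex_of_real (1 - r \<omega>) * f \<omega>"
      unfolding h_def fst_conv snd_conv by (simp only: integral_mult_left_zero)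
  qed
  finally show ?thesis unfolding h_def by simp
qed

text \<open>One cycle of output prediction, update and state prediction. It is stated for an
  arbitrary representation \<open>m\<close>, \<open>V\<close> of the prior, so that it serves both
  the induction on k and the final comparison with conditional expectations.\<close>

lemma filter_step:
  assumes prior: "cond_gauss M (I k) (x k) m V"
  defines "K \<equiv> \<lambda>\<omega>. \<eta> k \<omega> *\<^sub>R gain C (R + (1 - \<eta> k \<omega> * \<epsilon> k \<omega>) *\<^sub>R matrix_inv Y) (V \<omega>)"
  defines "m' \<equiv> \<lambda>\<omega>. (mat 1 - K \<omega> ** C) *v m \<omega> + K \<omega> *v ((\<eta> k \<omega> * \<epsilon> k \<omega>) *\<^sub>R y k \<omega>)"
  defines "V' \<equiv> \<lambda>\<omega>. V \<omega> - K \<omega> ** C ** V \<omega>"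
  shows "cond_gauss M (I k) (y k) (\<lambda>\<omega>. C *v m \<omega>) (\<lambda>\<omega>. C ** V \<omega> ** transpose C + R)"
    "cond_gauss M (I (Suc k)) (x k) m' V'"
    "cond_gauss M (I (Suc k)) (x (Suc k)) (\<lambda>\<omega>. A *v m' \<omega>) (\<lambda>\<omega>. A ** V' \<omega> ** transpose A + Q)"
proof -
  \<comment> \<open>All sources behind \<open>x k\<close>, \<open>y k\<close> and the past
    information, but neither \<eta> nor \<zeta> of step k; \<open>G S\<close> plays the role of
    \<open>H\<close> in \<open>cond_gauss_update\<close>.\<close>
  define S where "S = insert (SV k) (sources k k)"
  define q where "q \<omega> = quad_exp Y (y k \<omega>)" for \<omega>
  have yk: "y k = (\<lambda>\<omega>. C *v x k \<omega> + v k \<omega>)" by (rule ext) (rule y_def)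
  interpret gaussian_measurement M "I k" "x k" m V "y k" C R
    unfolding yk
  proof (rule gaussian_measurement_linear[OF prob_space_axioms subalgebra_info_M prior v_meas Rpd])
    show "cond_null M (I k) (\<lambda>\<omega>. cis (u \<bullet> x k \<omega>) * cis (t \<bullet> v k \<omega>)
      - cis (u \<bullet> m \<omega>) * of_real (exp (- (u \<bullet> (V \<omega> *v u) + t \<bullet> (R *v t)) / 2)))" for u t
      by (rule noise_independent[OF v_gauss pd_imp_psd[OF Rpd], where s = "SV k" and S = "sources k k"])
        (auto intro!: source_measurable_G(3) subalgebra_G_info[of k] x_measurable_G[of k k] prior subalgebra_info_M simp: sources_def)
  qed
  show "cond_gauss M (I k) (y k) (\<lambda>\<omega>. C *v m \<omega>) (\<lambda>\<omega>. C ** V \<omega> ** transpose C + R)"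
    by (rule cond_gauss_observation)
  have SS: "sources k k \<subseteq> S" "SV k \<in> S" "SEta k \<notin> S" "SZeta k \<notin> S" by (auto simp: S_def sources_def)
  have xG: "x k \<in> borel_measurable (G S)" by (rule x_measurable_G[OF SS(1)]) simp
  have yG: "y k \<in> borel_measurable (G S)" by (rule y_measurable_G[OF SS(1) _ SS(2)]) simp
  have qG: "q \<in> borel_measurable (G S)" unfolding q_def using yG by measurable
  have q01: "0 \<le> q \<omega> \<and> q \<omega> \<le> 1" for \<omega>
    unfolding q_def using exp_psd_le_1[OF pd_imp_psd[OF Ypd]] by simp
  have eps: "\<epsilon> k \<omega> = (if \<zeta> k \<omega> > q \<omega> then 1 else 0)" for \<omega>
    by (simp add: eps_def q_def)
  have sent: "(\<integral>\<omega>. complex_of_real (\<eta> k \<omega> * \<epsilon> k \<omega>) * f \<omega> \<partial>M) = complex_of_real lam * (\<integral>\<omega>. complex_of_real (1 - q \<omega>) * f \<omega> \<partial>M)"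
    if f: "f \<in> borel_measurable (G S)" "\<And>\<omega>. \<omega> \<in> space M \<Longrightarrow> norm (f \<omega>) \<le> c" for f c
  proof -
    let ?S = "insert (SEta k) S"
    have sub: "subalgebra (G ?S) (G S)"
      unfolding subalgebra_def space_G sets_G by (auto intro!: sigma_sets_subseteq)
    have [measurable]: "\<eta> k \<in> borel_measurable (G ?S)" by (rule source_measurable_G(4)) simp
    have [measurable]: "f \<in> borel_measurable (G ?S)" "q \<in> borel_measurable (G ?S)"
      using f(1) qG by (auto intro: measurable_from_subalg[OF sub])
    have "(\<integral>\<omega>. complex_of_real (if \<zeta> k \<omega> > q \<omega> then 1 else 0) * (complex_of_real (\<eta> k \<omega>) * f \<omega>) \<partial>M)
      = (\<integral>\<omega>. complex_of_real (1 - q \<omega>) * (complex_of_real (\<eta> k \<omega>) * f \<omega>) \<partial>M)"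
    proof (rule zeta_integral_mult[where S = ?S and c = c])
      show "norm (complex_of_real (\<eta> k \<omega>) * f \<omega>) \<le> c" if "\<omega> \<in> space M" for \<omega>
        using eta_vals[OF that, of k] f(2)[OF that] by (auto simp: norm_mult intro: order_trans[OF norm_ge_zero])
    qed (use SS(4) q01 in auto)
    moreover have "(\<integral>\<omega>. complex_of_real (\<eta> k \<omega>) * (complex_of_real (1 - q \<omega>) * f \<omega>) \<partial>M)
      = complex_of_real lam * (\<integral>\<omega>. complex_of_real (1 - q \<omega>) * f \<omega> \<partial>M)"
    proof (rule eta_integral_mult[where S = S and c = c])
      show "(\<lambda>\<omega>. complex_of_real (1 - q \<omega>) * f \<omega>) \<in> borel_measurable (G S)" using f(1) qG by measurable
      fix \<omega> assume w: "\<omega> \<in> space M"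
      have "\<bar>1 - q \<omega>\<bar> * norm (f \<omega>) \<le> 1 * c"
        using q01[of \<omega>] f(2)[OF w] by (intro mult_mono) auto
      then show "norm (complex_of_real (1 - q \<omega>) * f \<omega>) \<le> c"
        unfolding norm_mult norm_of_real by simp
    qed (use SS(3) in auto)
    ultimately show ?thesis
      unfolding eps of_real_mult by (simp only: mult_ac)
  qed
  have fint: "integrable M f" if "f \<in> borel_measurable (G S)" "\<And>\<omega>. \<omega> \<in> space M \<Longrightarrow> norm (f \<omega>) \<le> c"
    for f :: "'a \<Rightarrow> complex" and c
    using that by (intro integrable_const_bound[where B = c] measurable_from_subalg[OF subalgebra_G]) auto
  have bint: "integrable M (\<lambda>\<omega>. complex_of_real (g \<omega>) * f \<omega>)"
    if "f \<in> borel_measurable (G S)" "\<And>\<omega>. \<omega> \<in> space M \<Longrightarrow> norm (f \<omega>) \<le> c"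
      "g \<in> borel_measurable M" "\<And>\<omega>. \<omega> \<in> space M \<Longrightarrow> \<bar>g \<omega>\<bar> \<le> 1" for f c g
    using that by (intro integrable_bounded_mult[where c = 1] fint[OF that(1,2)]) auto
  have eta1: "\<bar>\<eta> k \<omega>\<bar> \<le> 1" if "\<omega> \<in> space M" for \<omega> using eta_vals[OF that, of k] by auto
  have eps01: "\<epsilon> k \<omega> \<in> {0, 1}" for \<omega> by (simp add: eps)
  have qM: "q \<in> borel_measurable M" by (rule measurable_from_subalg[OF subalgebra_G qG])
  have post: "cond_gauss M (I (Suc k)) (x k) m' V'"
    unfolding m'_def V'_def K_def
  proof (rule cond_gauss_update[OF Ypd, where H = "G S" and lam = lam])
    show sub': "subalgebra M (I (Suc k))" by (rule subalgebra_info_M)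
    show "subalgebra (I (Suc k)) (I k)"
      by (rule subalgebra_info) (auto simp: space_info intro!: measurable_info)
    have sf: "simple_function (I (Suc k)) g"
      if "g \<in> borel_measurable (I (Suc k))" "\<And>\<omega>. \<omega> \<in> space M \<Longrightarrow> g \<omega> \<in> {0, 1}" for g :: "'a \<Rightarrow> real"
    proof -
      have "finite (g ` space (I (Suc k)))"
        by (rule finite_subset[of _ "{0, 1}"]) (use that(2) in \<open>auto simp: space_info\<close>)
      then show ?thesis using that(1) by (simp add: simple_function_borel_measurable)
    qed
    show "simple_function (I (Suc k)) (\<eta> k)"
      by (rule sf) (use eta_vals in \<open>auto intro!: measurable_info\<close>)
    show "simple_function (I (Suc k)) (\<lambda>\<omega>. \<eta> k \<omega> * \<epsilon> k \<omega>)"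
      by (rule sf[OF measurable_info(2)]) (use eta_vals eps01 in fastforce)+
    show "(\<lambda>\<omega>. (\<eta> k \<omega> * \<epsilon> k \<omega>) *\<^sub>R y k \<omega>) \<in> borel_measurable (I (Suc k))"
      by (rule measurable_info) simp
    show "\<eta> k \<omega> \<in> {0, 1}" if "\<omega> \<in> space M" for \<omega> by (rule eta_vals[OF that])
    show "\<epsilon> k \<omega> \<in> {0, 1}" for \<omega> by (rule eps01)
    show "\<epsilon> k \<in> borel_measurable M" by measurable
    have subI: "subalgebra (I k) (I k)" by (simp add: subalgebra_def)
    \<comment> \<open>On loss the three new variables are 0, 0, 0 and on silence 1, 0, 0, so past
      information already gives the trace. Only transmission brings in \<open>y k\<close>.\<close>
    show "\<exists>A\<in>sets (I k). \<forall>\<omega>\<in>space M. \<eta> k \<omega> = 0 \<longrightarrow> (\<omega> \<in> B \<longleftrightarrow> \<omega> \<in> A)" if "B \<in> sets (I (Suc k))" for B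
      by (rule info_Suc_trace[OF space_info subI _ _ _ _ _ _ that, where ?g1.0 = "\<lambda>_. 0" and ?g2.0 = "\<lambda>_. 0" and ?g3.0 = "\<lambda>_. 0"]) auto
    show "\<exists>A\<in>sets (I k). \<forall>\<omega>\<in>space M. \<eta> k \<omega> = 1 \<and> \<epsilon> k \<omega> = 0 \<longrightarrow> (\<omega> \<in> B \<longleftrightarrow> \<omega> \<in> A)" if "B \<in> sets (I (Suc k))" for B
      by (rule info_Suc_trace[OF space_info subI _ _ _ _ _ _ that, where ?g1.0 = "\<lambda>_. 1" and ?g2.0 = "\<lambda>_. 0" and ?g3.0 = "\<lambda>_. 0"]) auto
    show "\<exists>A\<in>sets (join_gen M (I k) (y k)). \<forall>\<omega>\<in>space M. \<eta> k \<omega> = 1 \<and> \<epsilon> k \<omega> = 1 \<longrightarrow> (\<omega> \<in> B \<longleftrightarrow> \<omega> \<in> A)" if "B \<in> sets (I (Suc k))" for B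
      by (rule info_Suc_trace[OF space_join_gen[OF sub y_meas] sub_join_gen[OF sub y_meas] _ _ _ _ _ _ that,
            where ?g1.0 = "\<lambda>_. 1" and ?g2.0 = "\<lambda>_. 1" and ?g3.0 = "y k"])
        (auto intro: measurable_join_gen[OF sub y_meas])
    show "subalgebra M (G S)" by (rule subalgebra_G)
    show "subalgebra (G S) (I k)" by (rule subalgebra_G_info[OF SS(1)]) simp
    show "x k \<in> borel_measurable (G S)" "y k \<in> borel_measurable (G S)" by fact+
    fix f :: "'a \<Rightarrow> complex" and c
    assume f: "f \<in> borel_measurable (G S)" "\<And>\<omega>. \<omega> \<in> space M \<Longrightarrow> norm (f \<omega>) \<le> c"
    have ie: "(\<integral>\<omega>. complex_of_real (\<eta> k \<omega>) * f \<omega> \<partial>M) = complex_of_real lam * (\<integral>\<omega>. f \<omega> \<partial>M)"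
      by (rule eta_integral_mult[OF f SS(3)])
    have i\<eta>: "integrable M (\<lambda>\<omega>. complex_of_real (\<eta> k \<omega>) * f \<omega>)"
      by (rule bint[OF f]) (use eta1 in auto)
    have i\<eta>\<epsilon>: "integrable M (\<lambda>\<omega>. complex_of_real (\<eta> k \<omega> * \<epsilon> k \<omega>) * f \<omega>)"
    proof (rule bint[OF f])
      show "\<bar>\<eta> k \<omega> * \<epsilon> k \<omega>\<bar> \<le> 1" if "\<omega> \<in> space M" for \<omega> using eta1[OF that] by (simp add: eps)
    qed measurable
    have iq: "integrable M (\<lambda>\<omega>. complex_of_real (q \<omega>) * f \<omega>)"
      by (rule bint[OF f]) (use qM q01 in auto)
    show "(\<integral>\<omega>. complex_of_real (1 - \<eta> k \<omega>) * f \<omega> \<partial>M) = complex_of_real (1 - lam) * (\<integral>\<omega>. f \<omega> \<partial>M)"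
      using Bochner_Integration.integral_diff[OF fint[OF f] i\<eta>] ie by (simp add: algebra_simps)
    show "(\<integral>\<omega>. complex_of_real (\<eta> k \<omega> * \<epsilon> k \<omega>) * f \<omega> \<partial>M) = complex_of_real lam *
      (\<integral>\<omega>. complex_of_real (1 - quad_exp Y (y k \<omega>)) * f \<omega> \<partial>M)"
      using sent[OF f] unfolding q_def .
    \<comment> \<open>Silence is reception without transmission, so its identity is the difference
      of those for \<eta> and for \<eta> \<epsilon>.\<close>
    have "(\<integral>\<omega>. complex_of_real (\<eta> k \<omega> * (1 - \<epsilon> k \<omega>)) * f \<omega> \<partial>M)
      = (\<integral>\<omega>. complex_of_real (\<eta> k \<omega>) * f \<omega> - complex_of_real (\<eta> k \<omega> * \<epsilon> k \<omega>) * f \<omega> \<partial>M)"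
      by (simp add: algebra_simps)
    also have "\<dots> = complex_of_real lam * (\<integral>\<omega>. f \<omega> \<partial>M) - complex_of_real lam * (\<integral>\<omega>. complex_of_real (1 - q \<omega>) * f \<omega> \<partial>M)"
      using sent[OF f] unfolding Bochner_Integration.integral_diff[OF i\<eta> i\<eta>\<epsilon>] ie by simp
    also have "(\<integral>\<omega>. complex_of_real (1 - q \<omega>) * f \<omega> \<partial>M) = (\<integral>\<omega>. f \<omega> \<partial>M) - (\<integral>\<omega>. complex_of_real (q \<omega>) * f \<omega> \<partial>M)"
      using Bochner_Integration.integral_diff[OF fint[OF f] iq] by (simp add: algebra_simps)
    finally show "(\<integral>\<omega>. complex_of_real (\<eta> k \<omega> * (1 - \<epsilon> k \<omega>)) * f \<omega> \<partial>M) = complex_of_real lam *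
      (\<integral>\<omega>. complex_of_real (quad_exp Y (y k \<omega>)) * f \<omega> \<partial>M)"
      unfolding q_def by (simp add: right_diff_distrib)
  qed
  then show "cond_gauss M (I (Suc k)) (x k) m' V'" .
  have xS: "x (Suc k) = (\<lambda>\<omega>. A *v x k \<omega> + w k \<omega>)" by (rule ext) (rule x_succ)
  show "cond_gauss M (I (Suc k)) (x (Suc k)) (\<lambda>\<omega>. A *v m' \<omega>) (\<lambda>\<omega>. A ** V' \<omega> ** transpose A + Q)"
    unfolding xS
  proof (rule cond_gauss_predict[OF subalgebra_info_M post w_meas Qpsd])
    show "cond_null M (I (Suc k)) (\<lambda>\<omega>. cis (u \<bullet> x k \<omega>) * cis (t \<bullet> w k \<omega>)
      - cis (u \<bullet> m' \<omega>) * of_real (exp (- (u \<bullet> (V' \<omega> *v u) + t \<bullet> (Q *v t)) / 2)))" for u t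
      \<comment> \<open>\<open>sources k (Suc k)\<close> holds the process noises before step k but
        the measurement sources including step k: it carries \<open>I (Suc k)\<close> and
        \<open>x k\<close> and leaves out \<open>w k\<close>.\<close>
      by (rule noise_independent[OF w_gauss Qpsd, where s = "SW k" and S = "sources k (Suc k)"])
        (auto intro!: source_measurable_G(2) subalgebra_G_info[of k] x_measurable_G[of k "Suc k"] post subalgebra_info_M simp: sources_def)
  qed
qed

text \<open>\<open>I 0\<close> contains only the empty set and the whole space, so conditional and
  ordinary characteristic functions coincide. Besides starting the induction, this yields the second
  moments of the noises.\<close>

lemma trivial_cond_gauss:
  assumes X: "centered_gaussian M X W" and W: "psd_mat W"
  shows "cond_gauss M (I 0) X (\<lambda>_. 0) (\<lambda>_. W)"
  unfolding cond_gauss_def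
proof (intro conjI allI ballI)
  show Xm[measurable]: "X \<in> borel_measurable M" using X by (simp add: centered_gaussian_def)
  fix u
  have i: "integrable M (\<lambda>\<omega>. cis (u \<bullet> X \<omega>))" by (rule integrable_const_bound[where B = 1]) auto
  show "cond_null M (I 0) (\<lambda>\<omega>. cis (u \<bullet> X \<omega>) - gauss_cf u 0 W)"
  proof (rule cond_nullI[OF subalgebra_info_M])
    show int: "integrable M (\<lambda>\<omega>. cis (u \<bullet> X \<omega>) - gauss_cf u 0 W)"
      using i by simp
    fix B assume "B \<in> sets (I 0)"
    then have "B = {} \<or> B = space M" by (simp add: sets_info sigma_sets_empty_eq)
    then show "(\<integral>\<omega>\<in>B. (cis (u \<bullet> X \<omega>) - gauss_cf u 0 W) \<partial>M) = 0"
    proof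
      assume "B = space M"
      then show ?thesis
        using set_integral_space[OF int] i centered_gaussian_cis_integral[OF X W, of u] by (simp add: prob_space)
    qed (simp add: set_lebesgue_integral_def)
  qed
qed (use W in auto)

lemma integrable_centered_gaussian:
  fixes X :: "'a \<Rightarrow> real^'k"
  assumes X: "centered_gaussian M X W" and W: "psd_mat W"
  shows "integrable M (\<lambda>\<omega>. X \<omega> $ i)"
proof (rule square_integrable_imp_integrable)
  show "(\<lambda>\<omega>. X \<omega> $ i) \<in> borel_measurable M"
    by (rule borel_measurable_vec_component) (use X in \<open>simp add: centered_gaussian_def\<close>)
  show "integrable M (\<lambda>\<omega>. (X \<omega> $ i)\<^sup>2)"
    using cond_gauss_error_square_integrable[OF subalgebra_info_M trivial_cond_gauss[OF X W], of "axis i 1"]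
    by (simp add: inner_axis')
qed

lemma integrable_matrix_vector:
  fixes X :: "'a \<Rightarrow> real^'k" and B :: "real^'k^'l"
  assumes "\<And>i. integrable M (\<lambda>\<omega>. X \<omega> $ i)"
  shows "integrable M (\<lambda>\<omega>. (B *v X \<omega>) $ i)"
  using assms by (simp add: matrix_vector_mult_def)

text \<open>\<open>cond_gauss\<close> controls only the error \<open>X - m\<close>; integrability of
  the state itself is obtained from the recursion.\<close>

lemma x_integrable: "integrable M (\<lambda>\<omega>. x k \<omega> $ i)"
proof (induction k arbitrary: i)
  case 0 show ?case by (rule integrable_centered_gaussian[OF x0_gauss Sigma_psd])
next
  case (Suc k)
  show ?case
    using integrable_matrix_vector[OF Suc, of A i] integrable_centered_gaussian[OF w_gauss Qpsd, of k i]
    by (simp add: x_succ)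
qed

lemma y_integrable: "integrable M (\<lambda>\<omega>. y k \<omega> $ i)"
  using integrable_matrix_vector[OF x_integrable, of C k i] integrable_centered_gaussian[OF v_gauss pd_imp_psd[OF Rpd], of k i]
  by (simp add: y_def)

lemma prior_exists: "\<exists>m V. cond_gauss M (I k) (x k) m V"
proof (induction k)
  case 0 show ?case using trivial_cond_gauss[OF x0_gauss Sigma_psd] by blast
next
  case (Suc k) then show ?case using filter_step(3) by blast
qed

end

theorem theorem1:
  fixes M :: "'a measure"
    and A :: "real^'n^'n" and Q \<Sigma> :: "real^'n^'n"
    and C :: "real^'n^'m" and R Y :: "real^'m^'m"
    and x :: "nat \<Rightarrow> 'a \<Rightarrow> real^'n" and w :: "nat \<Rightarrow> 'a \<Rightarrow> real^'n"
    and y :: "nat \<Rightarrow> 'a \<Rightarrow> real^'m" and v :: "nat \<Rightarrow> 'a \<Rightarrow> real^'m"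
    and \<eta> \<zeta> \<epsilon> :: "nat \<Rightarrow> 'a \<Rightarrow> real"
    and lam :: real
  assumes prob: "prob_space M"
    and rhoA: "spectral_radius_mat A < 1"
    and Qpsd: "psd_mat Q" and Rpd: "pd_mat R" and Ypd: "pd_mat Y"
    and Sigma_psd: "psd_mat \<Sigma>" and Sigma_eq: "\<Sigma> = A ** \<Sigma> ** transpose A + Q"
    and x_succ: "\<And>k \<omega>. x (Suc k) \<omega> = A *v x k \<omega> + w k \<omega>"
    and y_def: "\<And>k \<omega>. y k \<omega> = C *v x k \<omega> + v k \<omega>"
    and x0_gauss: "centered_gaussian M (x 0) \<Sigma>"
    and w_gauss: "\<And>k. centered_gaussian M (w k) Q"
    and v_gauss: "\<And>k. centered_gaussian M (v k) R"
    and lam_bds: "0 < lam" "lam \<le> 1"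
    and eta_meas: "\<And>k. \<eta> k \<in> borel_measurable M"
    and eta_vals: "\<And>k \<omega>. \<omega> \<in> space M \<Longrightarrow> \<eta> k \<omega> \<in> {0, 1}"
    and eta_prob: "\<And>k. measure M {\<omega> \<in> space M. \<eta> k \<omega> = 1} = lam"
    and zeta_meas: "\<And>k. \<zeta> k \<in> borel_measurable M"
    and zeta_unif: "\<And>k. distr M lborel (\<zeta> k) = uniform_measure lborel {0..1}"
    and indep: "prob_space.indep_sets M
         (\<lambda>s. case s of SX0 \<Rightarrow> gen_sets M (x 0)
                      | SW k \<Rightarrow> gen_sets M (w k)
                      | SV k \<Rightarrow> gen_sets M (v k)
                      | SEta k \<Rightarrow> gen_sets M (\<eta> k)
                      | SZeta k \<Rightarrow> gen_sets M (\<zeta> k)) UNIV"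
    and eps_def: "\<And>k \<omega>. \<epsilon> k \<omega> =
         (if \<zeta> k \<omega> > exp (- (1/2) * (y k \<omega> \<bullet> (Y *v y k \<omega>))) then 1 else 0)"
  defines "I \<equiv> info M \<eta> \<epsilon> y"
  defines "xm \<equiv> (\<lambda>k. cond_exp_vec M (I k) (x k))"
  defines "ym \<equiv> (\<lambda>k. cond_exp_vec M (I k) (y k))"
  defines "xh \<equiv> (\<lambda>k. cond_exp_vec M (I (Suc k)) (x k))"
  defines "Pm \<equiv> (\<lambda>k. cond_err_cov M (I k) (x k))"
  defines "P \<equiv> (\<lambda>k. cond_err_cov M (I (Suc k)) (x k))"
  defines "K \<equiv> (\<lambda>k \<omega>. \<eta> k \<omega> *\<^sub>R (Pm k \<omega> ** transpose C **
            matrix_inv (C ** Pm k \<omega> ** transpose C + R + (1 - \<epsilon> k \<omega>) *\<^sub>R matrix_inv Y)))"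
  shows "(AE \<omega> in M. xm 0 \<omega> = 0) \<and> (AE \<omega> in M. Pm 0 \<omega> = \<Sigma>) \<and>
    (\<forall>k. AE \<omega> in M.
        xh k \<omega> = xm k \<omega> + \<epsilon> k \<omega> *\<^sub>R (K k \<omega> *v y k \<omega>) - K k \<omega> *v ym k \<omega> \<and>
        xh k \<omega> = (mat 1 - K k \<omega> ** C) *v xm k \<omega> + \<epsilon> k \<omega> *\<^sub>R (K k \<omega> *v y k \<omega>) \<and>
        P k \<omega> = Pm k \<omega> - K k \<omega> ** C ** Pm k \<omega> \<and>
        xm (Suc k) \<omega> = A *v xh k \<omega> \<and>
        Pm (Suc k) \<omega> = A ** P k \<omega> ** transpose A + Q)"
proof -
  interpret remote: remote_estimation M A Q \<Sigma> C R Y x w y v \<eta> \<zeta> \<epsilon> lam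
    by (intro remote_estimation.intro remote_estimation_axioms.intro) fact+
  have sub: "subalgebra M (I k)" for k
    unfolding I_def by (rule remote.subalgebra_info_M)
  have init: "cond_gauss M (I 0) (x 0) (\<lambda>_. 0) (\<lambda>_. \<Sigma>)"
    unfolding I_def by (rule remote.trivial_cond_gauss[OF x0_gauss Sigma_psd])
  note mean = remote.cond_gauss_cond_exp[OF sub] and cov = remote.cond_gauss_cond_err_cov[OF sub]
  have "AE \<omega> in M. xm 0 \<omega> = 0" "AE \<omega> in M. Pm 0 \<omega> = \<Sigma>"
    unfolding xm_def Pm_def by (rule mean[OF init remote.x_integrable], rule cov[OF init remote.x_integrable])
  moreover have "AE \<omega> in M.
        xh k \<omega> = xm k \<omega> + \<epsilon> k \<omega> *\<^sub>R (K k \<omega> *v y k \<omega>) - K k \<omega> *v ym k \<omega> \<and>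
        xh k \<omega> = (mat 1 - K k \<omega> ** C) *v xm k \<omega> + \<epsilon> k \<omega> *\<^sub>R (K k \<omega> *v y k \<omega>) \<and>
        P k \<omega> = Pm k \<omega> - K k \<omega> ** C ** Pm k \<omega> \<and>
        xm (Suc k) \<omega> = A *v xh k \<omega> \<and>
        Pm (Suc k) \<omega> = A ** P k \<omega> ** transpose A + Q" for k
  proof -
    obtain m V where prior: "cond_gauss M (I k) (x k) m V"
      using remote.prior_exists unfolding I_def by blast
    \<comment> \<open>The gain formed from the representative \<open>V\<close> and the product
      \<eta> \<epsilon>. It equals \<open>K\<close> wherever
      \<open>Pm k \<omega> = V \<omega>\<close>: both vanish for \<eta> = 0, and for \<eta> = 1 the
      product is \<epsilon>.\<close>
    define L where "L \<omega> = \<eta> k \<omega> *\<^sub>R gain C (R + (1 - \<eta> k \<omega> * \<epsilon> k \<omega>) *\<^sub>R matrix_inv Y) (V \<omega>)" for \<omega>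
    define m' where "m' \<omega> = (mat 1 - L \<omega> ** C) *v m \<omega> + L \<omega> *v ((\<eta> k \<omega> * \<epsilon> k \<omega>) *\<^sub>R y k \<omega>)" for \<omega>
    define V' where "V' \<omega> = V \<omega> - L \<omega> ** C ** V \<omega>" for \<omega>
    note step = remote.filter_step[OF prior[unfolded I_def], folded I_def L_def, folded m'_def V'_def]
    have "AE \<omega> in M. xm k \<omega> = m \<omega>" "AE \<omega> in M. Pm k \<omega> = V \<omega>"
      unfolding xm_def Pm_def by (rule mean[OF prior remote.x_integrable], rule cov[OF prior remote.x_integrable])
    moreover have "AE \<omega> in M. ym k \<omega> = C *v m \<omega>"
      unfolding ym_def by (rule mean[OF step(1) remote.y_integrable])
    moreover have "AE \<omega> in M. xh k \<omega> = m' \<omega>" "AE \<omega> in M. P k \<omega> = V' \<omega>"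
      unfolding xh_def P_def by (rule mean[OF step(2) remote.x_integrable], rule cov[OF step(2) remote.x_integrable])
    moreover have "AE \<omega> in M. xm (Suc k) \<omega> = A *v m' \<omega>" "AE \<omega> in M. Pm (Suc k) \<omega> = A ** V' \<omega> ** transpose A + Q"
      unfolding xm_def Pm_def by (rule mean[OF step(3) remote.x_integrable], rule cov[OF step(3) remote.x_integrable])
    ultimately show ?thesis
      using AE_space
    proof eventually_elim
      case (elim \<omega>)
      have eta: "\<eta> k \<omega> = 0 \<or> \<eta> k \<omega> = 1" using eta_vals[OF elim(8), of k] by simp
      have K: "K k \<omega> = L \<omega>"
        using eta unfolding K_def elim(2) L_def gain_def by (auto simp: add.assoc)
      have Ky: "L \<omega> *v ((\<eta> k \<omega> * \<epsilon> k \<omega>) *\<^sub>R y k \<omega>) = \<epsilon> k \<omega> *\<^sub>R (L \<omega> *v y k \<omega>)"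
        using eta by (auto simp: L_def matrix_vector_mult_scaleR)
      show ?case
        unfolding elim(1-7) K m'_def V'_def Ky
        by (simp add: matrix_vector_mult_diff_rdistrib matrix_vector_mul_assoc)
    qed
  qed
  ultimately show ?thesis by blast
qed

end
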